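(* Let $X$ be a separable infinite-dimensional Banach space and let $L(X)$ be the space of bounded operators on $X$ equipped with the strong operator topology $S_{op}$. Let $\mathcal{SE}(X)\subseteq L(X)$ be the set of super-ergodic operators and $\mathcal{UE}(X)\subseteq L(X)$ the set of uniformly ergodic operators on $X$. Let $\eta_e$ be the index on $L(X)$ with values in the ordinals $\le\omega_1$ given by $\eta_e(T)=\sup_{\varepsilon>0}h\big(\mathcal{A}_e(T,\varepsilon)\big)$ if $T$ is super-ergodic and $\eta_e(T)=\omega_1$ if $T$ is not super-ergodic. Then: (a) An operator $T\in L(X)$ is super-ergodic if and only if $\eta_e(T)<\omega_1$. (b) The set $\mathcal{SE}(X)$ is coanalytic. (c) $\eta_e$ is a coanalytic rank on $\mathcal{SE}(X)$. (d) There exists $\alpha<\omega_1$ such that $\mathcal{UE}(X)\subseteq\{T\in\mathcal{SE}(X):\eta_e(T)\le\alpha\}$. (e) $\mathcal{SE}(X)$ is a Borel set if and only if $\eta_e(X):=\sup_{T\in\mathcal{SE}(X)}\eta_e(T)<\omega_1$.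
   Context: For $T\in L(X)$ and $n\ge1$, the $n$-th Cesaro-mean of $T$ is $A_n=\frac1n\sum_{k=0}^{n-1}T^k$. $T$ is ergodic if $(A_n)_n$ converges in $L(X)$ for the strong operator topology, and uniformly ergodic if $(A_n)_n$ converges in operator norm. For an ultrafilter $\mathcal U$ on $\mathbb N$, let $X_{\mathcal U}=\ell^\infty(X)/\mathcal C_{\mathcal U}(X)$, where $\ell^\infty(X)$ is the Banach space of bounded sequences in $X$ and $\mathcal C_{\mathcal U}(X)$ is the subspace of sequences $(x_n)$ with $\lim_{\mathcal U}\|x_n\|=0$; the ultrapower operator is $T_{\mathcal U}\big((x_n)_n+\mathcal C_{\mathcal U}(X)\big)=(Tx_n)_n+\mathcal C_{\mathcal U}(X)$. $T$ is super-ergodic if $T_{\mathcal U}$ is ergodic on $X_{\mathcal U}$ for every ultrafilter $\mathcal U$ on $\mathbb N$. $\mathbb N=\{1,2,\dots\}$. $\mathbb N^{\uparrow<\mathbb N}$ is the set of finite strictly increasing sequences in $\mathbb N$, including the empty sequence; $|s|$ is the length of $s$ and $s_p$ its $p$-th element. $B_X$ is the closed unit ball of $X$. For $\varepsilon>0$, $\mathcal A_e(T,\varepsilon)$ is the tree on $\mathbb N$ consisting of all $s\in\mathbb N^{\uparrow<\mathbb N}$ such that $|s|\le1$, or there exists $x\in B_X$ with $\|A_{s_p}x-A_{s_{p+1}}x\|>\varepsilon$ for all $1\le p<|s|$. A tree on $\mathbb N$ is a set of finite sequences in $\mathbb N$ closed under initial segments; it is well founded if it has no infinite branch. Height of a tree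 $\mathcal T$: put $\mathcal T^{(0)}=\mathcal T$, $\mathcal T^{(\alpha+1)}=\{s:\ s \text{ has a proper extension in }\mathcal T^{(\alpha)}\}$, $\mathcal T^{(\lambda)}=\bigcap_{\alpha<\lambda}\mathcal T^{(\alpha)}$ for limit $\lambda$; $h(\mathcal T)$ is the least $\alpha$ with $\mathcal T^{(\alpha)}=\emptyset$ if such an $\alpha$ exists (i.e. if $\mathcal T$ is well founded; then $h(\mathcal T)<\omega_1$), and $h(\mathcal T)=\omega_1$ otherwise. For $X$ separable, $L(X)$ with the $\sigma$-algebra $\sigma(S_{op})$ generated by the strong operator topology is a standard Borel space; Borel, analytic and coanalytic subsets of $L(X)$ (and of $L(X)\times L(X)$) are understood with respect to this standard Borel structure (analytic: corresponds, under a Borel isomorphism with a Borel subset of a Polish space, to a continuous image of a Polish space; coanalytic: complement of an analytic set). A coanalytic rank on a coanalytic subset $C$ of a Polish (or standard Borel) space $P$ is a map $\delta$ from $C$ to the countable ordinals for which there are a coanalytic relation $\le_{\Pi}$ and an analytic relation $\le_{\Sigma}$ on $P$ such that for every $y\in C$ and every $x\in P$: $(x\in C \text{ and }\delta(x)\le\delta(y))\iff x\le_{\Pi}y\iff x\le_{\Sigma}y$. *)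

theory Defs
  imports "HOL-Analysis.Analysis" "HOL-Library.Sublist"
begin

unbundle cardinal_syntax

section \<open>The ordinals up to $\omega_1$\<close>

text \<open>
  An ordinal is an order type of a (reflexive) well-order in the sense of
  \<^const>\<open>Well_order\<close>.  The well-order \<^term>\<open>cardSuc natLeq\<close> on the type \<^typ>\<open>nat set\<close> has order
  type $\omega_1$, so the type below has exactly one element for each ordinal $\le \omega_1$.
\<close>

lemma Well_order_omega1: "Well_order (cardSuc natLeq)"
  by (rule card_order_on_well_order_on[OF cardSuc_Card_order[OF natLeq_Card_order]])

quotient_type ordinal = "nat set rel" / partial: "\<lambda>r s. (r, s) \<in> ordIso \<and> r \<le>o cardSuc natLeq"
proof (rule part_equivpI)
  show "\<exists>r :: nat set rel. (r, r) \<in> ordIso \<and> r \<le>o cardSuc natLeq"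
    by (intro exI[of _ "cardSuc natLeq"] conjI ordIso_reflexive ordLeq_reflexive Well_order_omega1)
  show "symp (\<lambda>(r :: nat set rel) s. (r, s) \<in> ordIso \<and> r \<le>o cardSuc natLeq)"
    by (intro sympI conjI; elim conjE)
      (erule ordIso_symmetric, erule ordIso_ordLeq_trans[OF ordIso_symmetric])
  show "transp (\<lambda>(r :: nat set rel) s. (r, s) \<in> ordIso \<and> r \<le>o cardSuc natLeq)"
    by (intro transpI conjI; elim conjE) (erule (1) ordIso_transitive)
qed

lift_definition omega1 :: ordinal ("\<omega>\<^sub>1") is "cardSuc natLeq"
  by (intro conjI ordIso_reflexive ordLeq_reflexive Well_order_omega1)

instantiation ordinal :: linorder
begin

lift_definition less_eq_ordinal :: "ordinal \<Rightarrow> ordinal \<Rightarrow> bool" is "\<lambda>r s. r \<le>o s"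
proof -
  fix r r' s s' :: "nat set rel"
  assume "(r, r') \<in> ordIso \<and> r \<le>o cardSuc natLeq" "(s, s') \<in> ordIso \<and> s \<le>o cardSuc natLeq"
  then have r: "(r, r') \<in> ordIso" and s: "(s, s') \<in> ordIso" by simp_all
  show "r \<le>o s \<longleftrightarrow> r' \<le>o s'"
  proof
    assume "r \<le>o s"
    then show "r' \<le>o s'" by (rule ordIso_ordLeq_trans[OF ordIso_symmetric[OF r] ordLeq_ordIso_trans[OF _ s]])
  next
    assume "r' \<le>o s'"
    then show "r \<le>o s" by (rule ordIso_ordLeq_trans[OF r ordLeq_ordIso_trans[OF _ ordIso_symmetric[OF s]]])
  qed
qed

lift_definition less_ordinal :: "ordinal \<Rightarrow> ordinal \<Rightarrow> bool" is "\<lambda>r s. r <o s"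
proof -
  fix r r' s s' :: "nat set rel"
  assume "(r, r') \<in> ordIso \<and> r \<le>o cardSuc natLeq" "(s, s') \<in> ordIso \<and> s \<le>o cardSuc natLeq"
  then have r: "(r, r') \<in> ordIso" and s: "(s, s') \<in> ordIso" by simp_all
  show "r <o s \<longleftrightarrow> r' <o s'"
  proof
    assume "r <o s"
    then show "r' <o s'" by (rule ordIso_ordLess_trans[OF ordIso_symmetric[OF r] ordLess_ordIso_trans[OF _ s]])
  next
    assume "r' <o s'"
    then show "r <o s" by (rule ordIso_ordLess_trans[OF r ordLess_ordIso_trans[OF _ ordIso_symmetric[OF s]]])
  qed
qed

instance
proof
  fix x y z :: ordinal
  show "(x < y) = (x \<le> y \<and> \<not> y \<le> x)"
  proof transfer
    fix r s :: "nat set rel"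
    assume "(r, r) \<in> ordIso \<and> r \<le>o cardSuc natLeq" "(s, s) \<in> ordIso \<and> s \<le>o cardSuc natLeq"
    then have "Well_order r" "Well_order s"
      by (auto dest: ordLeq_Well_order_simp)
    then show "r <o s \<longleftrightarrow> r \<le>o s \<and> \<not> s \<le>o r"
      using not_ordLeq_iff_ordLess ordLess_imp_ordLeq by blast
  qed
  show "x \<le> x"
    by transfer (simp add: ordIso_iff_ordLeq)
  show "x \<le> y \<Longrightarrow> y \<le> z \<Longrightarrow> x \<le> z"
    by transfer (rule ordLeq_transitive)
  show "x \<le> y \<Longrightarrow> y \<le> x \<Longrightarrow> x = y"
    by transfer (simp add: ordIso_iff_ordLeq)
  show "x \<le> y \<or> y \<le> x"
  proof transfer
    fix r s :: "nat set rel"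
    assume "(r, r) \<in> ordIso \<and> r \<le>o cardSuc natLeq" "(s, s) \<in> ordIso \<and> s \<le>o cardSuc natLeq"
    then have "Well_order r" "Well_order s"
      by (auto dest: ordLeq_Well_order_simp)
    then show "r \<le>o s \<or> s \<le>o r"
      by (rule ordLeq_total)
  qed
qed

end

instance ordinal :: wellorder
proof
  fix P :: "ordinal \<Rightarrow> bool" and a
  assume step: "\<And>x. (\<And>y. y < x \<Longrightarrow> P y) \<Longrightarrow> P x"
  have "wf (inv_image ordLess rep_ordinal)"
    by (intro wf_inv_image wf_ordLess)
  moreover have "(y, x) \<in> inv_image ordLess rep_ordinal" if "y < x" for x y
    using that by (simp add: less_ordinal.rep_eq)
  ultimately show "P a"
    using step by (induct rule: wf_induct_rule) blast
qed

lemma ordinal_le_omega1: "x \<le> \<omega>\<^sub>1" for x :: ordinal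
  by transfer simp

instantiation ordinal :: complete_linorder
begin

definition top_ordinal :: ordinal where "top_ordinal = \<omega>\<^sub>1"
definition bot_ordinal :: ordinal where "bot_ordinal = (LEAST x. True)"
definition inf_ordinal :: "ordinal \<Rightarrow> ordinal \<Rightarrow> ordinal" where "inf_ordinal = min"
definition sup_ordinal :: "ordinal \<Rightarrow> ordinal \<Rightarrow> ordinal" where "sup_ordinal = max"
definition Sup_ordinal :: "ordinal set \<Rightarrow> ordinal" where
  "Sup_ordinal A = (LEAST x. \<forall>a\<in>A. a \<le> x)"
definition Inf_ordinal :: "ordinal set \<Rightarrow> ordinal" where
  "Inf_ordinal A = (if A = {} then \<omega>\<^sub>1 else LEAST x. x \<in> A)"

instance
proof
  fix x z :: ordinal and A :: "ordinal set"
  have *: "\<forall>a\<in>A. a \<le> Sup A"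
    unfolding Sup_ordinal_def by (rule LeastI[of _ "\<omega>\<^sub>1"]) (simp add: ordinal_le_omega1)
  show "x \<in> A \<Longrightarrow> x \<le> Sup A"
    using * by blast
  show "Sup A \<le> z" if "\<And>x. x \<in> A \<Longrightarrow> x \<le> z"
    unfolding Sup_ordinal_def using that by (blast intro: Least_le)
  show "x \<in> A \<Longrightarrow> Inf A \<le> x"
    unfolding Inf_ordinal_def by (auto intro: Least_le)
  show "z \<le> Inf A" if "\<And>x. x \<in> A \<Longrightarrow> z \<le> x"
    unfolding Inf_ordinal_def using that by (auto simp: ordinal_le_omega1 intro: LeastI2)
  show "Inf ({} :: ordinal set) = top"
    by (simp add: Inf_ordinal_def top_ordinal_def)
  show "Sup ({} :: ordinal set) = bot"
    by (simp add: Sup_ordinal_def bot_ordinal_def)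
qed (auto simp: inf_ordinal_def sup_ordinal_def)

end

text \<open>Not meaningful at \<^term>\<open>\<omega>\<^sub>1\<close>, which has no successor in the type.\<close>

definition osucc :: "ordinal \<Rightarrow> ordinal" where
  "osucc \<alpha> = (LEAST \<beta>. \<alpha> < \<beta>)"

lemma less_osucc: "\<alpha> < \<omega>\<^sub>1 \<Longrightarrow> \<alpha> < osucc \<alpha>"
  unfolding osucc_def by (rule LeastI)

lemma osucc_le: "\<alpha> < \<beta> \<Longrightarrow> osucc \<alpha> \<le> \<beta>"
  unfolding osucc_def by (rule Least_le)

lemma less_osucc_unique:
  assumes "\<beta> < \<alpha>" "\<alpha> = osucc \<beta>" "\<gamma> < \<alpha>" "\<alpha> = osucc \<gamma>"
  shows "\<beta> = \<gamma>"
  using assms by (metis linorder_neqE not_le osucc_le)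


section \<open>Trees and their height\<close>

definition is_tree :: "'b list set \<Rightarrow> bool" where
  "is_tree \<T> \<longleftrightarrow> (\<forall>t\<in>\<T>. \<forall>s. prefix s t \<longrightarrow> s \<in> \<T>)"

function derived_tree :: "'b list set \<Rightarrow> ordinal \<Rightarrow> 'b list set" where
  "derived_tree \<T> \<alpha> =
    (if \<alpha> = bot then \<T>
     else if \<exists>\<beta><\<alpha>. \<alpha> = osucc \<beta>
     then {s. \<exists>t \<in> derived_tree \<T> (THE \<beta>. \<beta> < \<alpha> \<and> \<alpha> = osucc \<beta>). strict_prefix s t}
     else (\<Inter>\<beta>\<in>{..<\<alpha>}. derived_tree \<T> \<beta>))"
  by auto
termination
proof (relation "inv_image {(x, y). x < y} snd", goal_cases)
  case 1
  then show ?case by (simp add: wf)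
next
  case (2 \<T> \<alpha>)
  then obtain \<beta> where \<beta>: "\<beta> < \<alpha>" "\<alpha> = osucc \<beta>" by blast
  then have "(THE \<beta>. \<beta> < \<alpha> \<and> \<alpha> = osucc \<beta>) = \<beta>"
    using less_osucc_unique by (intro the_equality) blast+
  then show ?case using \<beta> by simp
next
  case (3 \<T> \<alpha> \<beta>)
  then show ?case by simp
qed

declare derived_tree.simps [simp del]

lemma derived_tree_0: "derived_tree \<T> bot = \<T>"
  by (simp add: derived_tree.simps)

lemma derived_tree_osucc:
  assumes "\<alpha> < \<omega>\<^sub>1"
  shows "derived_tree \<T> (osucc \<alpha>) = {s. \<exists>t \<in> derived_tree \<T> \<alpha>. strict_prefix s t}"
proof -
  have lt: "\<alpha> < osucc \<alpha>" by (rule less_osucc[OF assms])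
  then have "(THE \<beta>. \<beta> < osucc \<alpha> \<and> osucc \<alpha> = osucc \<beta>) = \<alpha>"
    using less_osucc_unique by (intro the_equality) blast+
  moreover have "osucc \<alpha> \<noteq> bot" using lt by auto
  ultimately show ?thesis
    using lt by (subst derived_tree.simps) auto
qed

lemma derived_tree_limit:
  assumes "\<alpha> \<noteq> bot" "\<And>\<beta>. \<beta> < \<alpha> \<Longrightarrow> \<alpha> \<noteq> osucc \<beta>"
  shows "derived_tree \<T> \<alpha> = (\<Inter>\<beta>\<in>{..<\<alpha>}. derived_tree \<T> \<beta>)"
  using assms by (subst derived_tree.simps) auto

definition tree_height :: "'b list set \<Rightarrow> ordinal" where
  "tree_height \<T> =
    (if \<exists>\<alpha><\<omega>\<^sub>1. derived_tree \<T> \<alpha> = {} then LEAST \<alpha>. derived_tree \<T> \<alpha> = {} else \<omega>\<^sub>1)"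


section \<open>Banach spaces over the real or complex numbers\<close>

text \<open>
  By the Gelfand--Mazur theorem, the instances of \<^class>\<open>real_normed_field\<close> are, up to isometric
  isomorphism, the fields of real and of complex numbers, so both scalar fields are treated at
  once.  For real scalars, \<^term>\<open>smul\<close> is necessarily \<^const>\<open>scaleR\<close>.
\<close>

locale banach_over = vector_space smul
  for smul :: "'k::real_normed_field \<Rightarrow> 'a::banach \<Rightarrow> 'a" +
  assumes norm_scale: "norm (smul c x) = norm c * norm x"
    and scale_of_real: "smul (of_real r) x = r *\<^sub>R x"

text \<open>$L(X)$: the bounded operators that are linear over the scalar field.\<close>

definition ops :: "('k \<Rightarrow> 'a::banach \<Rightarrow> 'a) \<Rightarrow> ('a \<Rightarrow>\<^sub>L 'a) set" where
  "ops smul = {T :: 'a \<Rightarrow>\<^sub>L 'a. \<forall>c x. T (smul c x) = smul c (T x)}"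

definition cesaro :: "('a::banach \<Rightarrow>\<^sub>L 'a) \<Rightarrow> nat \<Rightarrow> ('a \<Rightarrow>\<^sub>L 'a)" where
  "cesaro T n = (1 / real n) *\<^sub>R (\<Sum>k<n. ((o\<^sub>L) T ^^ k) id_blinfun)"

definition uniformly_ergodic :: "('k \<Rightarrow> 'a::banach \<Rightarrow> 'a) \<Rightarrow> ('a \<Rightarrow>\<^sub>L 'a) \<Rightarrow> bool" where
  "uniformly_ergodic smul T \<longleftrightarrow> (\<exists>P\<in>ops smul. cesaro T \<longlonglongrightarrow> P)"


section \<open>Ultrapowers\<close>

definition ultrafilter :: "'i filter \<Rightarrow> bool" where
  "ultrafilter \<U> \<longleftrightarrow> \<U> \<noteq> bot \<and> (\<forall>P. eventually P \<U> \<or> eventually (\<lambda>i. \<not> P i) \<U>)"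

text \<open>
  Since \<^typ>\<open>nat\<close> is discrete, \<^typ>\<open>nat \<Rightarrow>\<^sub>C 'a\<close> with its sup norm is the Banach space
  $\ell^\infty(X)$.  The ultrapower depends on the ultrafilter, so its elements are represented
  by the cosets themselves and its operations are functions on cosets.
\<close>

definition ultra_null :: "nat filter \<Rightarrow> (nat \<Rightarrow>\<^sub>C 'a::banach) set" where
  "ultra_null \<U> = {f :: nat \<Rightarrow>\<^sub>C 'a. ((\<lambda>n. norm (f n)) \<longlongrightarrow> 0) \<U>}"

definition ultra_coset :: "nat filter \<Rightarrow> (nat \<Rightarrow>\<^sub>C 'a::banach) \<Rightarrow> (nat \<Rightarrow>\<^sub>C 'a) set" where
  "ultra_coset \<U> f = (\<lambda>h. f + h) ` ultra_null \<U>"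

definition ultrapower :: "nat filter \<Rightarrow> (nat \<Rightarrow>\<^sub>C 'a::banach) set set" where
  "ultrapower \<U> = range (ultra_coset \<U>)"

text \<open>The quotient norm.\<close>

definition ultra_norm :: "(nat \<Rightarrow>\<^sub>C 'a::banach) set \<Rightarrow> real" where
  "ultra_norm \<xi> = (INF f\<in>\<xi>. norm f)"

definition ultra_add :: "(nat \<Rightarrow>\<^sub>C 'a::banach) set \<Rightarrow> (nat \<Rightarrow>\<^sub>C 'a) set \<Rightarrow> (nat \<Rightarrow>\<^sub>C 'a) set" where
  "ultra_add \<xi> \<zeta> = {f + g | f g. f \<in> \<xi> \<and> g \<in> \<zeta>}"

definition ultra_diff :: "(nat \<Rightarrow>\<^sub>C 'a::banach) set \<Rightarrow> (nat \<Rightarrow>\<^sub>C 'a) set \<Rightarrow> (nat \<Rightarrow>\<^sub>C 'a) set" where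
  "ultra_diff \<xi> \<zeta> = {f - g | f g. f \<in> \<xi> \<and> g \<in> \<zeta>}"

text \<open>
  The map $(x_n)_n + \mathcal{C}_{\mathcal{U}}(X) \mapsto (\varphi(x_n))_n + \mathcal{C}_{\mathcal{U}}(X)$
  induced by a bounded linear map $\varphi$ on $X$.  All representatives give the same coset, so
  the union is that coset.  It yields the ultrapower of an operator and, for
  $\varphi(x) = c x$, scalar multiplication by $c$ in the ultrapower.
\<close>

definition ultra_map ::
    "nat filter \<Rightarrow> ('a::banach \<Rightarrow> 'a) \<Rightarrow> (nat \<Rightarrow>\<^sub>C 'a) set \<Rightarrow> (nat \<Rightarrow>\<^sub>C 'a) set" where
  "ultra_map \<U> \<phi> \<xi> = (\<Union>f\<in>\<xi>. ultra_coset \<U> (Bcontfun (\<lambda>n. \<phi> (apply_bcontfun f n))))"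

definition ultra_scale ::
    "nat filter \<Rightarrow> ('k \<Rightarrow> 'a::banach \<Rightarrow> 'a) \<Rightarrow> 'k \<Rightarrow> (nat \<Rightarrow>\<^sub>C 'a) set \<Rightarrow> (nat \<Rightarrow>\<^sub>C 'a) set" where
  "ultra_scale \<U> smul c = ultra_map \<U> (smul c)"

definition ultra_op ::
    "nat filter \<Rightarrow> ('a::banach \<Rightarrow>\<^sub>L 'a) \<Rightarrow> (nat \<Rightarrow>\<^sub>C 'a) set \<Rightarrow> (nat \<Rightarrow>\<^sub>C 'a) set" where
  "ultra_op \<U> T = ultra_map \<U> (blinfun_apply T)"

definition ultra_bounded_linear ::
    "nat filter \<Rightarrow> ('k \<Rightarrow> 'a::banach \<Rightarrow> 'a) \<Rightarrow> ((nat \<Rightarrow>\<^sub>C 'a) set \<Rightarrow> (nat \<Rightarrow>\<^sub>C 'a) set) \<Rightarrow> bool" where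
  "ultra_bounded_linear \<U> smul P \<longleftrightarrow>
     P ` ultrapower \<U> \<subseteq> ultrapower \<U> \<and>
     (\<forall>\<xi>\<in>ultrapower \<U>. \<forall>\<zeta>\<in>ultrapower \<U>. P (ultra_add \<xi> \<zeta>) = ultra_add (P \<xi>) (P \<zeta>)) \<and>
     (\<forall>c. \<forall>\<xi>\<in>ultrapower \<U>. P (ultra_scale \<U> smul c \<xi>) = ultra_scale \<U> smul c (P \<xi>)) \<and>
     (\<exists>B. \<forall>\<xi>\<in>ultrapower \<U>. ultra_norm (P \<xi>) \<le> B * ultra_norm \<xi>)"

text \<open>The zero of the ultrapower is the coset \<^term>\<open>ultra_null \<U>\<close>.\<close>

definition ultra_cesaro ::
    "nat filter \<Rightarrow> ((nat \<Rightarrow>\<^sub>C 'a::banach) set \<Rightarrow> (nat \<Rightarrow>\<^sub>C 'a) set) \<Rightarrow> nat \<Rightarrow>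
     (nat \<Rightarrow>\<^sub>C 'a) set \<Rightarrow> (nat \<Rightarrow>\<^sub>C 'a) set" where
  "ultra_cesaro \<U> S n \<xi> =
     ultra_scale \<U> scaleR (1 / real n)
       (foldr ultra_add (map (\<lambda>k. (S ^^ k) \<xi>) [0..<n]) (ultra_null \<U>))"

definition ultra_ergodic ::
    "nat filter \<Rightarrow> ('k \<Rightarrow> 'a::banach \<Rightarrow> 'a) \<Rightarrow> ((nat \<Rightarrow>\<^sub>C 'a) set \<Rightarrow> (nat \<Rightarrow>\<^sub>C 'a) set) \<Rightarrow> bool" where
  "ultra_ergodic \<U> smul S \<longleftrightarrow>
     (\<exists>P. ultra_bounded_linear \<U> smul P \<and>
        (\<forall>\<xi>\<in>ultrapower \<U>. (\<lambda>n. ultra_norm (ultra_diff (ultra_cesaro \<U> S n \<xi>) (P \<xi>))) \<longlonglongrightarrow> 0))"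

definition super_ergodic :: "('k \<Rightarrow> 'a::banach \<Rightarrow> 'a) \<Rightarrow> ('a \<Rightarrow>\<^sub>L 'a) \<Rightarrow> bool" where
  "super_ergodic smul T \<longleftrightarrow> (\<forall>\<U>. ultrafilter \<U> \<longrightarrow> ultra_ergodic \<U> smul (ultra_op \<U> T))"


section \<open>The index\<close>

text \<open>Lists are indexed from 0, so \<^term>\<open>s ! p\<close> is the element usually written $s_{p+1}$.\<close>

definition ergodic_tree :: "('a::banach \<Rightarrow>\<^sub>L 'a) \<Rightarrow> real \<Rightarrow> nat list set" where
  "ergodic_tree T \<epsilon> =
    {s. sorted_wrt (<) s \<and> (\<forall>n\<in>set s. n \<ge> 1) \<and>
        (length s \<le> 1 \<or>
         (\<exists>x\<in>cball 0 1. \<forall>p. Suc p < length s \<longrightarrow>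
            norm (cesaro T (s ! p) x - cesaro T (s ! Suc p) x) > \<epsilon>))}"

lemma is_tree_ergodic_tree: "is_tree (ergodic_tree T \<epsilon>)"
  unfolding is_tree_def
proof (intro ballI allI impI)
  fix t s assume t: "t \<in> ergodic_tree T \<epsilon>" and "prefix s t"
  then obtain u where u: "t = s @ u" by (auto simp: prefix_def)
  show "s \<in> ergodic_tree T \<epsilon>"
  proof (cases "length s \<le> 1")
    case True
    then show ?thesis using t unfolding u ergodic_tree_def by (simp add: sorted_wrt_append)
  next
    case False
    then have "\<not> length t \<le> 1" by (simp add: u)
    then obtain x where x: "x \<in> cball 0 1" and
      *: "\<And>p. Suc p < length t \<Longrightarrow> norm (cesaro T (t ! p) x - cesaro T (t ! Suc p) x) > \<epsilon>"
      using t unfolding ergodic_tree_def by blast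
    have "norm (cesaro T (s ! p) x - cesaro T (s ! Suc p) x) > \<epsilon>" if "Suc p < length s" for p
      using *[of p] that by (simp add: u nth_append)
    then have "\<exists>x\<in>cball 0 1. \<forall>p. Suc p < length s \<longrightarrow>
        norm (cesaro T (s ! p) x - cesaro T (s ! Suc p) x) > \<epsilon>"
      using x by blast
    then show ?thesis using t unfolding u ergodic_tree_def by (simp add: sorted_wrt_append)
  qed
qed

definition eta_e :: "('k \<Rightarrow> 'a::banach \<Rightarrow> 'a) \<Rightarrow> ('a \<Rightarrow>\<^sub>L 'a) \<Rightarrow> ordinal" where
  "eta_e smul T =
    (if super_ergodic smul T then SUP \<epsilon>\<in>{0<..}. tree_height (ergodic_tree T \<epsilon>) else \<omega>\<^sub>1)"

definition SE :: "('k \<Rightarrow> 'a::banach \<Rightarrow> 'a) \<Rightarrow> ('a \<Rightarrow>\<^sub>L 'a) set" where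
  "SE smul = {T \<in> ops smul. super_ergodic smul T}"

definition UE :: "('k \<Rightarrow> 'a::banach \<Rightarrow> 'a) \<Rightarrow> ('a \<Rightarrow>\<^sub>L 'a) set" where
  "UE smul = {T \<in> ops smul. uniformly_ergodic smul T}"


section \<open>Analytic and coanalytic sets, coanalytic ranks\<close>

definition polish :: "'b topology \<Rightarrow> bool" where
  "polish X \<longleftrightarrow> completely_metrizable_space X \<and> separable_space X"

definition borel_of :: "'b topology \<Rightarrow> 'b measure" where
  "borel_of X = sigma (topspace X) {U. openin X U}"

text \<open>
  A Polish space has at most continuum many points, so up to homeomorphism all Polish spaces
  (including the empty one) occur among the abstract topologies, with arbitrary
  \<^const>\<open>topspace\<close>, on the type \<^typ>\<open>nat \<Rightarrow> real\<close>.  These are not required to be related to the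
  product topology.
\<close>

definition analytic_in :: "'b measure \<Rightarrow> 'b set \<Rightarrow> bool" where
  "analytic_in M A \<longleftrightarrow> A \<subseteq> space M \<and>
    (\<exists>(Y :: (nat \<Rightarrow> real) topology) B \<phi> \<psi>.
       polish Y \<and> B \<in> sets (borel_of Y) \<and>
       \<phi> \<in> measurable M (restrict_space (borel_of Y) B) \<and>
       \<psi> \<in> measurable (restrict_space (borel_of Y) B) M \<and>
       (\<forall>x\<in>space M. \<psi> (\<phi> x) = x) \<and> (\<forall>y\<in>B. \<phi> (\<psi> y) = y) \<and>
       (\<exists>(Z :: (nat \<Rightarrow> real) topology) g.
          polish Z \<and> continuous_map Z Y g \<and> g ` topspace Z = \<phi> ` A))"

definition coanalytic_in :: "'b measure \<Rightarrow> 'b set \<Rightarrow> bool" where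
  "coanalytic_in M C \<longleftrightarrow> C \<subseteq> space M \<and> analytic_in M (space M - C)"

text \<open>A relation \<^term>\<open>R\<close> is identified with the set of pairs \<^term>\<open>(x, y)\<close> such that $x$ is below $y$.\<close>

definition coanalytic_rank :: "'b measure \<Rightarrow> 'b set \<Rightarrow> ('b \<Rightarrow> ordinal) \<Rightarrow> bool" where
  "coanalytic_rank M C \<delta> \<longleftrightarrow>
     coanalytic_in M C \<and> (\<forall>x\<in>C. \<delta> x < \<omega>\<^sub>1) \<and>
     (\<exists>R\<^sub>\<Pi> R\<^sub>\<Sigma>. coanalytic_in (M \<Otimes>\<^sub>M M) R\<^sub>\<Pi> \<and> analytic_in (M \<Otimes>\<^sub>M M) R\<^sub>\<Sigma> \<and>
        (\<forall>y\<in>C. \<forall>x\<in>space M.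
           ((x \<in> C \<and> \<delta> x \<le> \<delta> y) \<longleftrightarrow> (x, y) \<in> R\<^sub>\<Pi>) \<and>
           ((x \<in> C \<and> \<delta> x \<le> \<delta> y) \<longleftrightarrow> (x, y) \<in> R\<^sub>\<Sigma>)))"

text \<open>$L(X)$ with the $\sigma$-algebra generated by the strong operator topology.\<close>

definition sop_borel :: "('k \<Rightarrow> 'a::banach \<Rightarrow> 'a) \<Rightarrow> ('a \<Rightarrow>\<^sub>L 'a) measure" where
  "sop_borel smul = borel_of (subtopology strong_operator_topology (ops smul))"

end

theory Submission
  imports Defs "HOL-Library.Countable_Set_Type"
begin

text \<open>
  An operator is super-ergodic iff none of its trees has an infinite branch: non-Cauchy Cesaro
  means of a coset yield a branch of witnesses, and conversely the witnesses along a branch form a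
  coset with non-Cauchy means for any free ultrafilter.

  Membership of a fixed node in a tree is a Borel condition on the operator, and the operators form
  a standard Borel space.  For such a family of trees, well-foundedness is coanalytic, and heights
  of well-founded trees are compared by the existence of extension-preserving maps between
  nodes, which is an analytic condition; this gives the coanalytic rank.  If the rank is bounded by
  \<open>\<alpha> < \<omega>\<^sub>1\<close>, well-foundedness says that the \<open>\<alpha>\<close>-th derivatives are empty, which is Borel by
  induction on \<open>\<alpha>\<close>.  If the well-founded operators form a Borel set, parametrize them by a
  closed subset of Baire space on which membership of nodes is clopen: the tree of pairs (initial
  segment of a parameter, node of its tree) is again well founded and dominates all heights.
  For a uniformly ergodic operator the trees have bounded length, hence finite height.
\<close>

section \<open>Countable ordinals and heights of trees\<close>

text \<open>The ultrapower enters only through estimates on representatives along the ultrafilter. A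
  free ultrafilter is used only to pass from a branch to non-ergodicity; the other direction must
  serve every ultrafilter, and there a uniform bound on the Cesaro means makes the limit well
  defined on cosets and bounded. The strong operator topology causes the measure-theoretic work.
  Composition is not jointly continuous for it, so \<open>T ^^ k\<close> applied to \<open>x\<close>
  is treated as a Borel function of \<open>T\<close>, and nodes are Borel conditions. Nor is the
  topology second countable in general, so an operator is coded by the 0-1 sequence that records
  which rational balls around a dense sequence contain its values on that sequence. The dense
  sequence enumerates a subgroup: linearity is then expressed by differences alone, and homogeneity
  is recovered from continuity. Replacing the thresholds \<epsilon> by
  \<open>1 / real (Suc n)\<close> makes the supremum in \<open>eta_e\<close> countable, and
  countable suprema of countable ordinals stay below \<open>\<omega>\<^sub>1\<close>.\<close>

lemma Well_order_rep_ordinal: "Well_order (rep_ordinal x)"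
proof -
  have "rep_ordinal x =o rep_ordinal x \<and> rep_ordinal x \<le>o cardSuc natLeq"
    using Quotient3_rep_reflp[OF Quotient3_ordinal] by simp
  then show ?thesis by (auto dest: ordLeq_Well_order_simp)
qed

lemma rep_ordinal_le: "rep_ordinal x \<le>o cardSuc natLeq"
  using Quotient3_rep_reflp[OF Quotient3_ordinal, of x] by simp

lemma rep_abs_ordinal: "r \<le>o cardSuc natLeq \<Longrightarrow> rep_ordinal (abs_ordinal r) =o r"
  using rep_abs_rsp_left[OF Quotient3_ordinal, of r r] 
  by (simp add: ordIso_reflexive ordLeq_Well_order_simp)

lemma ordinal_eqI: "rep_ordinal x =o rep_ordinal y \<Longrightarrow> x = y"
  using Quotient3_rel_rep[OF Quotient3_ordinal, of x y] rep_ordinal_le by simp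

lemma Restr_underS_le:
  "a \<in> Field r \<Longrightarrow> r \<le>o cardSuc natLeq \<Longrightarrow> Restr r (underS r a) \<le>o cardSuc natLeq"
  by (metis ordLeq_Well_order_simp ordLess_imp_ordLeq ordLess_ordLeq_trans underS_Restr_ordLess
      empty_iff)

lemma rep_omega1: "rep_ordinal \<omega>\<^sub>1 =o cardSuc natLeq"
  unfolding omega1_def map_fun_def
  by (simp add: rep_abs_ordinal ordLeq_reflexive Well_order_omega1)

text \<open>Below \<open>\<omega>\<^sub>1\<close> the field of a representative is countable, and
  every smaller ordinal is the order type of the initial segment strictly below one of its elements,
  so the field indexes all smaller ordinals.\<close>

lemma countable_lessThan_ordinal: assumes "\<alpha> < \<omega>\<^sub>1" shows "countable {..<\<alpha>::ordinal}"
proof -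
  let ?r = "rep_ordinal \<alpha>"
  have "?r <o rep_ordinal \<omega>\<^sub>1"
    using assms by (simp add: less_ordinal.rep_eq)
  also note rep_omega1
  finally have "?r <o cardSuc natLeq" .
  moreover have "|Field ?r| \<le>o ?r"
    using Well_order_rep_ordinal by (intro card_of_least) 
  ultimately have "|Field ?r| <o cardSuc natLeq"
    by (rule ordLeq_ordLess_trans[rotated])
  then have "|Field ?r| \<le>o natLeq"
    by (simp add: cardSuc_ordLeq_ordLess[OF natLeq_Card_order card_of_Card_order])
  then have "countable (Field ?r)" by (simp add: countable_card_le_natLeq)
  moreover have "{..<\<alpha>} \<subseteq> (\<lambda>a. abs_ordinal (Restr ?r (underS ?r a))) ` Field ?r"
  proof
    fix \<beta> assume "\<beta> \<in> {..<\<alpha>}"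
    then have "rep_ordinal \<beta> <o ?r" by (simp add: less_ordinal.rep_eq)
    then obtain a where a: "a \<in> Field ?r" "rep_ordinal \<beta> =o Restr ?r (underS ?r a)"
      using ordLess_iff_ordIso_Restr[OF Well_order_rep_ordinal Well_order_rep_ordinal] by blast
    have "\<beta> = abs_ordinal (Restr ?r (underS ?r a))"
      using a Restr_underS_le[OF a(1) rep_ordinal_le]
      by (intro ordinal_eqI) (meson ordIso_symmetric ordIso_transitive rep_abs_ordinal)
    then show "\<beta> \<in> (\<lambda>a. abs_ordinal (Restr ?r (underS ?r a))) ` Field ?r" using a by blast
  qed
  ultimately show ?thesis by (meson countable_image countable_subset)
qed

text \<open>Distinct elements of \<open>cardSuc natLeq\<close> determine initial segments of
  distinct order type, so its uncountable field injects into the ordinals below it.\<close>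

lemma uncountable_lessThan_omega1: "uncountable {..<\<omega>\<^sub>1}"
proof
  assume cnt: "countable {..<\<omega>\<^sub>1}"
  let ?r = "cardSuc natLeq"
  let ?f = "\<lambda>a. abs_ordinal (Restr ?r (underS ?r a))"
  have rep: "rep_ordinal (?f a) =o Restr ?r (underS ?r a)" if "a \<in> Field ?r" for a
    using that by (intro rep_abs_ordinal Restr_underS_le ordLeq_reflexive Well_order_omega1)
  have "?f a < \<omega>\<^sub>1" if "a \<in> Field ?r" for a
  proof -
    have "Restr ?r (underS ?r a) <o ?r"
      using that by (intro underS_Restr_ordLess Well_order_omega1) auto
    then show ?thesis
      unfolding less_ordinal.rep_eq
      by (rule ordIso_ordLess_trans[OF rep[OF that] ordLess_ordIso_trans[OF _ ordIso_symmetric[OF rep_omega1]]])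
  qed
  moreover have "inj_on ?f (Field ?r)"
  proof -
    have *: "?f a < ?f b" if "a \<in> Field ?r" "b \<in> Field ?r" "a \<in> underS ?r b" for a b
    proof -
      have wo: "wo_rel ?r" using Well_order_omega1 by (simp add: wo_rel_def)
      have "underS ?r a \<subset> underS ?r b"
        using that wo_rel.ANTISYM[OF wo] wo_rel.TRANS[OF wo]
        by (metis psubsetI underS_incr underS_notIn underS_E)
      then have "Restr ?r (underS ?r a) <o Restr ?r (underS ?r b)"
        using ofilter_subset_ordLess[OF Well_order_omega1] wo_rel.underS_ofilter[OF wo] by blast
      then show ?thesis unfolding less_ordinal.rep_eq
        by (rule ordIso_ordLess_trans[OF rep[OF that(1)]
              ordLess_ordIso_trans[OF _ ordIso_symmetric[OF rep[OF that(2)]]]])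
    qed
    show ?thesis
    proof (rule inj_onI, rule ccontr)
      fix a b assume ab: "a \<in> Field ?r" "b \<in> Field ?r" "?f a = ?f b" "a \<noteq> b"
      have "(a, b) \<in> ?r \<or> (b, a) \<in> ?r"
        using wo_rel.TOTALS[of ?r] Well_order_omega1 ab by (auto simp: wo_rel_def)
      then have "a \<in> underS ?r b \<or> b \<in> underS ?r a"
        using ab by (auto simp: underS_def)
      then show False using * ab by (metis less_irrefl)
    qed
  qed
  ultimately have "countable (Field ?r)"
    using cnt by (intro countable_image_inj_on[of ?f]) (auto intro: countable_subset[rotated])
  then have "|Field ?r| \<le>o natLeq" by (simp add: countable_card_le_natLeq)
  moreover have "|Field ?r| =o ?r"
    by (intro card_of_Field_ordIso cardSuc_Card_order natLeq_Card_order)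
  ultimately have "?r \<le>o natLeq" by (meson ordIso_ordLeq_trans ordIso_symmetric)
  then show False
    using cardSuc_greater[OF natLeq_Card_order] not_ordLess_ordLeq by blast
qed

text \<open>Otherwise the ordinals below \<open>\<omega>\<^sub>1\<close> would be \<alpha> and those
  below \<alpha>, a countable set.\<close>

lemma osucc_less_omega1: assumes "\<alpha> < \<omega>\<^sub>1" shows "osucc \<alpha> < \<omega>\<^sub>1"
proof (rule ccontr)
  assume "\<not> osucc \<alpha> < \<omega>\<^sub>1"
  then have "{..<\<omega>\<^sub>1} \<subseteq> insert \<alpha> {..<\<alpha>}"
    using osucc_le[of \<alpha>] by (auto simp: not_less) (meson order.strict_trans2 not_less_iff_gr_or_eq)
  then show False
    using countable_lessThan_ordinal[OF assms] uncountable_lessThan_omega1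
    by (meson countable_insert countable_subset)
qed

lemma less_osucc_iff: "\<alpha> < \<omega>\<^sub>1 \<Longrightarrow> \<beta> < osucc \<alpha> \<longleftrightarrow> \<beta> \<le> \<alpha>"
  by (metis less_osucc not_le osucc_le order_le_less_trans)

text \<open>Regularity of \<open>\<omega>\<^sub>1\<close>: a countable union of countable initial
  segments cannot exhaust it.\<close>

lemma Sup_less_omega1:
  assumes "countable A" "\<And>a. a \<in> A \<Longrightarrow> a < \<omega>\<^sub>1"
  shows "Sup A < \<omega>\<^sub>1"
proof (rule ccontr)
  assume "\<not> Sup A < \<omega>\<^sub>1"
  then have "{..<\<omega>\<^sub>1} \<subseteq> (\<Union>a\<in>A. {..<a})"
    by (auto simp: less_Sup_iff not_less dest: order_less_le_trans)
  moreover have "countable (\<Union>a\<in>A. {..<a})"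
    using assms countable_lessThan_ordinal by blast
  ultimately show False
    using uncountable_lessThan_omega1 countable_subset by blast
qed

lemma ordinal_cases [case_names zero succ limit]:
  fixes \<alpha> :: ordinal
  obtains "\<alpha> = bot" | \<beta> where "\<beta> < \<alpha>" "\<beta> < \<omega>\<^sub>1" "\<alpha> = osucc \<beta>"
  | "\<alpha> \<noteq> bot" "\<And>\<beta>. \<beta> < \<alpha> \<Longrightarrow> \<alpha> \<noteq> osucc \<beta>"
  using order_less_le_trans[OF _ ordinal_le_omega1] by metis

section \<open>Derivatives, branches and ranks of nodes\<close>

lemma is_treeD: "is_tree \<T> \<Longrightarrow> t \<in> \<T> \<Longrightarrow> prefix s t \<Longrightarrow> s \<in> \<T>"
  by (auto simp: is_tree_def)

lemma is_tree_derived_tree: assumes "is_tree \<T>" shows "is_tree (derived_tree \<T> \<alpha>)"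
proof (induction \<alpha> rule: less_induct)
  case (less \<alpha>)
  show ?case
  proof (cases \<alpha> rule: ordinal_cases)
    case zero then show ?thesis by (simp add: derived_tree_0 assms)
  next
    case (succ \<beta>)
    then show ?thesis
      by (auto simp: is_tree_def derived_tree_osucc intro: prefix_order.le_less_trans)
  next
    case limit
    then show ?thesis using less
      by (auto simp: is_tree_def derived_tree_limit)
  qed
qed

lemma derived_tree_antimono:
  assumes "is_tree \<T>" "\<alpha> \<le> \<beta>" shows "derived_tree \<T> \<beta> \<subseteq> derived_tree \<T> \<alpha>"
  using assms(2)
proof (induction \<beta> rule: less_induct)
  case (less \<beta>)
  show ?case
  proof (cases \<beta> rule: ordinal_cases)
    case zero then show ?thesis using less by (simp add: bot_unique)
  next
    case (succ \<gamma>)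
    have "derived_tree \<T> \<beta> \<subseteq> derived_tree \<T> \<gamma>"
      using is_treeD[OF is_tree_derived_tree[OF assms(1)]] succ
      by (fastforce simp: derived_tree_osucc strict_prefix_def)
    then show ?thesis
      using less succ by (metis less_osucc_iff order_le_less subset_trans order_refl)
  next
    case limit
    then show ?thesis using less by (auto simp: derived_tree_limit order_le_less)
  qed
qed

lemma tree_height_le_iff:
  assumes "is_tree \<T>" "\<alpha> < \<omega>\<^sub>1"
  shows "tree_height \<T> \<le> \<alpha> \<longleftrightarrow> derived_tree \<T> \<alpha> = {}"
proof
  assume le: "tree_height \<T> \<le> \<alpha>"
  then have ex: "\<exists>\<alpha><\<omega>\<^sub>1. derived_tree \<T> \<alpha> = {}"
    using assms(2) unfolding tree_height_def by (auto split: if_splits)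
  then have "derived_tree \<T> (LEAST \<alpha>. derived_tree \<T> \<alpha> = {}) = {}"
    by (metis (mono_tags, lifting) LeastI)
  then have "derived_tree \<T> (tree_height \<T>) = {}"
    using ex unfolding tree_height_def by simp
  then show "derived_tree \<T> \<alpha> = {}"
    using derived_tree_antimono[OF assms(1) le] by simp
next
  assume "derived_tree \<T> \<alpha> = {}"
  then show "tree_height \<T> \<le> \<alpha>"
    using assms(2) unfolding tree_height_def by (auto intro: Least_le)
qed

text \<open>A derivative is itself closed under initial segments, so it is nonempty exactly when it
  contains the root.\<close>

lemma less_tree_height_iff:
  assumes "is_tree \<T>" "\<alpha> < \<omega>\<^sub>1"
  shows "\<alpha> < tree_height \<T> \<longleftrightarrow> [] \<in> derived_tree \<T> \<alpha>"
  using tree_height_le_iff[OF assms] is_treeD[OF is_tree_derived_tree[OF assms(1)], of _ _ "[]"]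
  by (auto simp flip: not_le)

definition has_branch :: "'b list set \<Rightarrow> bool" where
  "has_branch \<T> \<longleftrightarrow> (\<exists>z. \<forall>k. map z [0..<k] \<in> \<T>)"

text \<open>A chosen extension may skip levels, so the chain only guarantees that its
  \<open>n\<close>-th node has length at least \<open>n\<close>; the branch is read off on the
  diagonal, where later nodes no longer change an entry.\<close>

lemma has_branchI_extensions:
  assumes "is_tree \<T>" "s \<in> \<T>" "\<And>s. s \<in> \<T> \<Longrightarrow> \<exists>t\<in>\<T>. strict_prefix s t"
  shows "has_branch \<T>"
proof -
  have "\<exists>f :: nat \<Rightarrow> 'a list. \<forall>n. (f n \<in> \<T> \<and> length (f n) \<ge> n) \<and> prefix (f n) (f (Suc n))"
  proof (rule dependent_nat_choice)
    show "\<exists>x. x \<in> \<T> \<and> 0 \<le> length x" using assms by auto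
    fix x n assume "x \<in> \<T> \<and> n \<le> length x"
    moreover then obtain t where "t \<in> \<T>" "strict_prefix x t" using assms by blast
    ultimately show "\<exists>y. (y \<in> \<T> \<and> Suc n \<le> length y) \<and> prefix x y"
      using prefix_length_less[of x t] by (intro exI[of _ t]) (auto simp: strict_prefix_def)
  qed
  then obtain f where f: "\<And>n. f n \<in> \<T>" "\<And>n. n \<le> length (f n)" "\<And>n. prefix (f n) (f (Suc n))"
    by blast
  have mono: "prefix (f m) (f n)" if "m \<le> n" for m n
    using that by (induction n rule: dec_induct) (auto intro: f prefix_order.trans)
  have nth: "f (Suc i) ! i = f n ! i" if "i < n" for i n
    using mono[of "Suc i" n] that f(2)[of "Suc i"] by (auto simp: prefix_def nth_append)
  have "map (\<lambda>i. f (Suc i) ! i) [0..<k] = take k (f k)" for k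
    using nth[of _ k] f(2)[of k] by (intro nth_equalityI) auto
  then have "map (\<lambda>i. f (Suc i) ! i) [0..<k] \<in> \<T>" for k
    using is_treeD[OF assms(1) f(1)[of k] take_is_prefix[of k]] by simp
  then show ?thesis unfolding has_branch_def by blast
qed

text \<open>Segments of a branch survive every derivative. Conversely, without a branch no nonempty
  derivative can reproduce itself, so height \<open>\<omega>\<^sub>1\<close> would make every step
  lose a node; different steps lose different nodes, which injects an uncountable set into a
  countable set of nodes.\<close>

lemma tree_height_less_omega1_iff:
  fixes \<T> :: "'b::countable list set"
  assumes "is_tree \<T>"
  shows "tree_height \<T> < \<omega>\<^sub>1 \<longleftrightarrow> \<not> has_branch \<T>"
proof
  assume lt: "tree_height \<T> < \<omega>\<^sub>1"
  show "\<not> has_branch \<T>"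
  proof
    assume "has_branch \<T>"
    then obtain z where z: "\<And>k. map z [0..<k] \<in> \<T>" unfolding has_branch_def by blast
    have "map z [0..<k] \<in> derived_tree \<T> \<alpha>" for k \<alpha>
    proof (induction \<alpha> arbitrary: k rule: less_induct)
      case (less \<alpha>)
      show ?case
      proof (cases \<alpha> rule: ordinal_cases)
        case zero then show ?thesis by (simp add: derived_tree_0 z)
      next
        case (succ \<beta>)
        have "strict_prefix (map z [0..<k]) (map z [0..<Suc k])" by (simp add: strict_prefix_def)
        then show ?thesis
          using less[OF succ(1), of "Suc k"] succ by (auto simp: derived_tree_osucc simp del: upt_Suc)
      next
        case limit
        then show ?thesis using less by (auto simp: derived_tree_limit)
      qed
    qed
    then show False using tree_height_le_iff[OF assms lt] by blast
  qed
next
  assume nb: "\<not> has_branch \<T>"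
  show "tree_height \<T> < \<omega>\<^sub>1"
  proof (rule ccontr)
    assume "\<not> tree_height \<T> < \<omega>\<^sub>1"
    then have ne: "derived_tree \<T> \<alpha> \<noteq> {}" if "\<alpha> < \<omega>\<^sub>1" for \<alpha>
      using tree_height_le_iff[OF assms that] that by auto
    have "\<exists>s. s \<in> derived_tree \<T> \<alpha> \<and> s \<notin> derived_tree \<T> (osucc \<alpha>)" if "\<alpha> < \<omega>\<^sub>1" for \<alpha>
    proof (rule ccontr)
      assume *: "\<nexists>s. s \<in> derived_tree \<T> \<alpha> \<and> s \<notin> derived_tree \<T> (osucc \<alpha>)"
      have "derived_tree \<T> \<alpha> \<noteq> {}" by (rule ne[OF that])
      then obtain s where "s \<in> derived_tree \<T> \<alpha>" by blast
      then have "has_branch (derived_tree \<T> \<alpha>)"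
        using * by (intro has_branchI_extensions[OF is_tree_derived_tree[OF assms], of s])
          (auto simp: derived_tree_osucc[OF that])
      then show False
        using nb derived_tree_antimono[OF assms bot_least, of \<alpha>]
        unfolding has_branch_def derived_tree_0 by blast
    qed
    then obtain f where f: "\<And>\<alpha>. \<alpha> < \<omega>\<^sub>1 \<Longrightarrow> f \<alpha> \<in> derived_tree \<T> \<alpha> \<and> f \<alpha> \<notin> derived_tree \<T> (osucc \<alpha>)"
      by metis
    have "f \<alpha> \<noteq> f \<beta>" if "\<alpha> < \<beta>" "\<beta> < \<omega>\<^sub>1" for \<alpha> \<beta>
      using f[OF order_less_trans[OF that]] f[OF that(2)]
        derived_tree_antimono[OF assms osucc_le[OF that(1)]] by auto
    then have "inj_on f {..<\<omega>\<^sub>1}"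
      by (intro linorder_inj_onI) auto
    then have "countable {..<\<omega>\<^sub>1}"
      by (rule countableI')
    then show False using uncountable_lessThan_omega1 by blast
  qed
qed

section \<open>Extension-preserving maps and comparison of heights\<close>

definition tree_map :: "'b list set \<Rightarrow> 'c list set \<Rightarrow> ('b list \<Rightarrow> 'c list) \<Rightarrow> bool" where
  "tree_map \<T> \<S> f \<longleftrightarrow>
     (\<forall>s\<in>\<T>. f s \<in> \<S> \<and> (\<forall>t\<in>\<T>. strict_prefix s t \<longrightarrow> strict_prefix (f s) (f t)))"

text \<open>Preservation of strict extension is all that the successor step uses; lengths of nodes
  may change.\<close>

lemma tree_map_derived_tree:
  assumes "tree_map \<T> \<S> f" "is_tree \<T>" "s \<in> derived_tree \<T> \<alpha>"
  shows "f s \<in> derived_tree \<S> \<alpha>"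
  using assms(3)
proof (induction \<alpha> arbitrary: s rule: less_induct)
  case (less \<alpha>)
  have *: "t \<in> \<T>" if "t \<in> derived_tree \<T> \<beta>" for t \<beta>
    using derived_tree_antimono[OF assms(2) bot_least, of \<beta>] that by (auto simp: derived_tree_0)
  show ?case
  proof (cases \<alpha> rule: ordinal_cases)
    case zero then show ?thesis using less assms by (auto simp: derived_tree_0 tree_map_def)
  next
    case (succ \<beta>)
    then obtain t where t: "t \<in> derived_tree \<T> \<beta>" "strict_prefix s t"
      using less by (auto simp: derived_tree_osucc)
    then have "strict_prefix (f s) (f t)"
      using *[OF t(1)] *[OF less(2)] assms(1) by (auto simp: tree_map_def)
    then show ?thesis using less(1)[OF succ(1) t(1)] succ by (auto simp: derived_tree_osucc)
  next
    case limit
    then show ?thesis using less by (auto simp: derived_tree_limit)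
  qed
qed

lemma tree_map_height_le:
  assumes "tree_map \<T> \<S> f" "is_tree \<T>" "is_tree \<S>"
  shows "tree_height \<T> \<le> tree_height \<S>"
proof (rule ccontr)
  assume "\<not> ?thesis"
  then have *: "tree_height \<S> < tree_height \<T>" by simp
  then have 1: "tree_height \<S> < \<omega>\<^sub>1"
    using ordinal_le_omega1 order_less_le_trans by blast
  have "[] \<in> derived_tree \<T> (tree_height \<S>)"
    using * less_tree_height_iff[OF assms(2) 1] by blast
  then have "f [] \<in> derived_tree \<S> (tree_height \<S>)"
    using tree_map_derived_tree assms by blast
  then show False using tree_height_le_iff[OF assms(3) 1] by blast
qed

text \<open>The first derivative missing \<open>s\<close> has neither index \<open>bot\<close>,
  since \<open>s\<close> is in the tree, nor a limit index, since there derivatives are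
  intersections; the predecessor of its index is the rank of \<open>s\<close>.\<close>

lemma ex_rank_of_node:
  assumes "is_tree \<T>" "tree_height \<T> < \<omega>\<^sub>1" "s \<in> \<T>"
  obtains \<alpha> where "\<alpha> < tree_height \<T>" "s \<in> derived_tree \<T> \<alpha>" "s \<notin> derived_tree \<T> (osucc \<alpha>)"
proof -
  let ?P = "\<lambda>\<alpha>. s \<notin> derived_tree \<T> \<alpha>"
  define \<beta> where "\<beta> = (LEAST \<alpha>. ?P \<alpha>)"
  have P: "?P (tree_height \<T>)"
    using tree_height_le_iff[OF assms(1,2)] by blast
  then have \<beta>: "?P \<beta>" "\<beta> \<le> tree_height \<T>"
    unfolding \<beta>_def by (rule LeastI[of ?P], rule Least_le[of ?P])
  have less: "s \<in> derived_tree \<T> \<gamma>" if "\<gamma> < \<beta>" for \<gamma>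
    using not_less_Least[of \<gamma> ?P] that unfolding \<beta>_def by blast
  show ?thesis
  proof (cases \<beta> rule: ordinal_cases)
    case zero then show ?thesis using \<beta> assms by (simp add: derived_tree_0)
  next
    case (succ \<gamma>)
    then show ?thesis using that[of \<gamma>] less[of \<gamma>] \<beta> by auto
  next
    case limit
    then show ?thesis using \<beta> less by (auto simp: derived_tree_limit)
  qed
qed

text \<open>The map is built node by node, keeping the image in every countable derivative that
  contains the node. A child of rank \<alpha> puts its parent, hence the image of the parent, into
  the derivative at \<open>osucc \<alpha>\<close>, which supplies a strict extension of that image
  in the derivative at \<alpha>. The freedom in \<open>r\<close> serves the strict comparison of
  heights.\<close>

lemma ex_tree_map:
  assumes T: "is_tree \<T>" "tree_height \<T> < \<omega>\<^sub>1" and S: "is_tree \<S>"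
    and root: "\<And>\<alpha>. [] \<in> derived_tree \<T> \<alpha> \<Longrightarrow> \<alpha> < \<omega>\<^sub>1 \<Longrightarrow> r \<in> derived_tree \<S> \<alpha>"
  obtains f where "tree_map \<T> \<S> f" "f [] = r"
proof -
  define ok where "ok s t \<longleftrightarrow> (\<forall>\<alpha><\<omega>\<^sub>1. s \<in> derived_tree \<T> \<alpha> \<longrightarrow> t \<in> derived_tree \<S> \<alpha>)" for s t
  have step: "\<exists>t'. ok (s @ [a]) t' \<and> strict_prefix t t'" if "ok s t" "s @ [a] \<in> \<T>" for s t a
  proof -
    obtain \<alpha> where \<alpha>: "\<alpha> < tree_height \<T>" "s @ [a] \<in> derived_tree \<T> \<alpha>"
        "s @ [a] \<notin> derived_tree \<T> (osucc \<alpha>)"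
      using ex_rank_of_node[OF T \<open>s @ [a] \<in> \<T>\<close>] .
    have lt: "\<alpha> < \<omega>\<^sub>1" using \<alpha> T by simp
    have "strict_prefix s (s @ [a])" by (simp add: strict_prefix_def)
    then have "s \<in> derived_tree \<T> (osucc \<alpha>)" using \<alpha> lt by (auto simp: derived_tree_osucc)
    then have "t \<in> derived_tree \<S> (osucc \<alpha>)"
      using \<open>ok s t\<close> osucc_less_omega1[OF lt] by (auto simp: ok_def)
    then obtain t' where t': "t' \<in> derived_tree \<S> \<alpha>" "strict_prefix t t'"
      using lt by (auto simp: derived_tree_osucc)
    have "ok (s @ [a]) t'" unfolding ok_def
    proof (intro allI impI)
      fix \<beta> assume "\<beta> < \<omega>\<^sub>1" "s @ [a] \<in> derived_tree \<T> \<beta>"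
      then have "\<beta> \<le> \<alpha>"
        using \<alpha>(3) derived_tree_antimono[OF T(1) osucc_le[of \<alpha> \<beta>]] by force
      then show "t' \<in> derived_tree \<S> \<beta>"
        using t'(1) derived_tree_antimono[OF S] by blast
    qed
    then show ?thesis using t' by blast
  qed
  \<comment> \<open>Nodes grow at their right end while \<open>rec_list\<close> peels entries off
    the left end, hence the recursion on \<open>rev s\<close>.\<close>
  define f where "f s = rec_list r (\<lambda>a s' t. SOME t'. ok (rev s' @ [a]) t' \<and> strict_prefix t t') (rev s)" for s
  have f_Nil: "f [] = r" by (simp add: f_def)
  have f_snoc: "f (s @ [a]) = (SOME t'. ok (s @ [a]) t' \<and> strict_prefix (f s) t')" for s a
    by (simp add: f_def)
  have ok: "ok s (f s)" if "s \<in> \<T>" for s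
    using that
  proof (induction s rule: rev_induct)
    case Nil then show ?case using root by (auto simp: f_Nil ok_def)
  next
    case (snoc a s)
    then have "ok s (f s)" using is_treeD[OF T(1) snoc(2)] by simp
    from someI_ex[OF step[OF this snoc(2)]] show ?case unfolding f_snoc by simp
  qed
  have sp: "strict_prefix (f s) (f (s @ [a]))" if "s @ [a] \<in> \<T>" for s a
    using someI_ex[OF step[OF ok that]] is_treeD[OF T(1) that, of s] unfolding f_snoc by simp
  have "strict_prefix (f s) (f (s @ u))" if "s @ u \<in> \<T>" "u \<noteq> []" for s u
    using that
  proof (induction u rule: rev_induct)
    case (snoc a u)
    have "s @ u \<in> \<T>" using is_treeD[OF T(1) snoc(2), of "s @ u"] by simp
    then have "prefix (f s) (f (s @ u))" using snoc by (cases "u = []") auto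
    then show ?case using sp[of "s @ u" a] snoc by (simp add: prefix_order.le_less_trans)
  qed simp
  then have "strict_prefix (f s) (f t)" if "t \<in> \<T>" "strict_prefix s t" for s t
    using that by (auto simp: strict_prefix_def prefix_def)
  moreover have "f s \<in> \<S>" if "s \<in> \<T>" for s
  proof -
    have "bot < \<omega>\<^sub>1" using T(2) bot_least le_less_trans by blast
    then show ?thesis using ok[OF that] that by (auto simp: ok_def derived_tree_0 dest: spec[of _ bot])
  qed
  ultimately have "tree_map \<T> \<S> f" by (auto simp: tree_map_def)
  then show ?thesis using f_Nil that by blast
qed

lemma tree_height_le_iff_tree_map:
  assumes "is_tree \<T>" "is_tree \<S>" "tree_height \<T> < \<omega>\<^sub>1"
  shows "tree_height \<T> \<le> tree_height \<S> \<longleftrightarrow> (\<exists>f. tree_map \<T> \<S> f)"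
proof
  assume le: "tree_height \<T> \<le> tree_height \<S>"
  show "\<exists>f. tree_map \<T> \<S> f"
  proof -
    have "[] \<in> derived_tree \<S> \<alpha>" if "[] \<in> derived_tree \<T> \<alpha>" "\<alpha> < \<omega>\<^sub>1" for \<alpha>
      using le that less_tree_height_iff[OF assms(1)] less_tree_height_iff[OF assms(2)]
      by (metis order_less_le_trans)
    from ex_tree_map[OF assms(1,3,2) this] show ?thesis by blast
  qed
qed (use tree_map_height_le assms in blast)

text \<open>The height of \<open>\<T>\<close> is \<open>osucc \<alpha>\<close> for the rank \<alpha>
  of its root. It is smaller than the height of \<open>\<S>\<close> iff some node of
  \<open>\<S>\<close> other than the root lies in the derivative at \<alpha>, and such a node is
  what the root can be sent to.\<close>

lemma tree_height_less_iff_tree_map: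
  assumes "is_tree \<T>" "is_tree \<S>" "tree_height \<T> < \<omega>\<^sub>1" "[] \<in> \<T>"
  shows "tree_height \<T> < tree_height \<S> \<longleftrightarrow> (\<exists>f. tree_map \<T> \<S> f \<and> f [] \<noteq> [])"
proof -
  obtain \<alpha> where \<alpha>: "\<alpha> < tree_height \<T>" "[] \<in> derived_tree \<T> \<alpha>"
        "[] \<notin> derived_tree \<T> (osucc \<alpha>)"
    using ex_rank_of_node[OF assms(1,3,4)] .
  have lt: "\<alpha> < \<omega>\<^sub>1" using \<alpha> assms by simp
  show ?thesis
  proof
    assume less: "tree_height \<T> < tree_height \<S>"
    have "osucc \<alpha> < tree_height \<S>"
      using osucc_le[OF \<alpha>(1)] less by simp
    then have "[] \<in> derived_tree \<S> (osucc \<alpha>)"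
      using less_tree_height_iff[OF assms(2) osucc_less_omega1[OF lt]] by blast
    then obtain r where r: "r \<in> derived_tree \<S> \<alpha>" "strict_prefix [] r"
      using lt by (auto simp: derived_tree_osucc)
    have "r \<in> derived_tree \<S> \<beta>" if "[] \<in> derived_tree \<T> \<beta>" for \<beta>
    proof -
      have "\<beta> \<le> \<alpha>"
        using \<alpha>(3) that derived_tree_antimono[OF assms(1) osucc_le[of \<alpha> \<beta>]] by force
      then show ?thesis using r derived_tree_antimono[OF assms(2)] by blast
    qed
    then show "\<exists>f. tree_map \<T> \<S> f \<and> f [] \<noteq> []"
      using ex_tree_map[OF assms(1,3,2), of r] r by (metis prefix_order.less_irrefl)
  next
    assume "\<exists>f. tree_map \<T> \<S> f \<and> f [] \<noteq> []"
    then obtain f where f: "tree_map \<T> \<S> f" "f [] \<noteq> []" by blast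
    have "f [] \<in> derived_tree \<S> \<alpha>" using tree_map_derived_tree[OF f(1) assms(1) \<alpha>(2)] .
    then have "[] \<in> derived_tree \<S> (osucc \<alpha>)"
      using f(2) lt by (auto simp: derived_tree_osucc strict_prefix_def)
    then have "osucc \<alpha> < tree_height \<S>"
      using less_tree_height_iff[OF assms(2) osucc_less_omega1[OF lt]] by blast
    moreover have "tree_height \<T> \<le> osucc \<alpha>"
      using \<alpha>(3) less_tree_height_iff[OF assms(1) osucc_less_omega1[OF lt]] by (simp flip: not_less)
    ultimately show "tree_height \<T> < tree_height \<S>" by simp
  qed
qed

section \<open>Standard Borel spaces and analytic sets\<close>

text \<open>These are the analytic subsets of Baire space. Closed domains cover the empty set and
  can absorb equations between continuous functions.\<close>

definition closed_image :: "(nat \<Rightarrow> nat) set \<Rightarrow> bool" where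
  "closed_image A \<longleftrightarrow> (\<exists>Z (g :: (nat \<Rightarrow> nat) \<Rightarrow> nat \<Rightarrow> nat). closed Z \<and> continuous_on Z g \<and> A = g ` Z)"

lemma closed_image_closed: "closed A \<Longrightarrow> closed_image A"
  unfolding closed_image_def by (intro exI[of _ A] exI[of _ id]) auto

lemma continuous_on_reindex [continuous_intros]:
  "continuous_on S (\<lambda>(w :: 'i \<Rightarrow> 'b::topological_space) j. w (p j))"
  by (intro continuous_on_coordinatewise_then_product)
    (auto intro: continuous_on_product_coordinates continuous_on_subset)

lemma closed_image_choice:
  assumes "\<And>n :: nat. closed_image (A n)"
  obtains Z and g :: "nat \<Rightarrow> (nat \<Rightarrow> nat) \<Rightarrow> nat \<Rightarrow> nat"
  where "\<forall>n. closed (Z n) \<and> continuous_on (Z n) (g n) \<and> A n = g n ` Z n"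
proof -
  have "\<forall>n. \<exists>Z (g :: (nat \<Rightarrow> nat) \<Rightarrow> nat \<Rightarrow> nat). closed Z \<and> continuous_on Z g \<and> A n = g ` Z"
    using assms unfolding closed_image_def by blast
  from choice[OF this] obtain Z :: "nat \<Rightarrow> (nat \<Rightarrow> nat) set"
    where "\<forall>n. \<exists>g :: (nat \<Rightarrow> nat) \<Rightarrow> nat \<Rightarrow> nat. closed (Z n) \<and> continuous_on (Z n) g \<and> A n = g ` Z n"
    by blast
  from choice[OF this] show ?thesis using that by blast
qed

text \<open>Coordinate 0 of the new parameter selects the set and the shifted sequence parametrizes
  it; fixing a coordinate is a clopen condition, so closed domains and continuous maps can be
  glued.\<close>

lemma closed_image_UN:
  assumes "\<And>n :: nat. closed_image (A n)"
  shows "closed_image (\<Union>n. A n)"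
proof -
  obtain Z and g :: "nat \<Rightarrow> (nat \<Rightarrow> nat) \<Rightarrow> nat \<Rightarrow> nat"
    where "\<forall>n. closed (Z n) \<and> continuous_on (Z n) (g n) \<and> A n = g n ` Z n"
    by (rule closed_image_choice[OF assms])
  then have Zg: "\<And>n. closed (Z n)" "\<And>n. continuous_on (Z n) (g n)" "\<And>n. A n = g n ` Z n"
    by blast+
  let ?t = "\<lambda>(w :: nat \<Rightarrow> nat) i. w (Suc i)"
  define Z' where "Z' = {w :: nat \<Rightarrow> nat. ?t w \<in> Z (w 0)}"
  define g' where "g' w = g (w 0) (?t w)" for w :: "nat \<Rightarrow> nat"
  have cont_t: "continuous_on UNIV ?t" by (intro continuous_on_reindex)
  have cyl: "closed {w :: nat \<Rightarrow> nat. w 0 \<in> N}" "open {w :: nat \<Rightarrow> nat. w 0 \<in> N}" for N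
    using continuous_on_product_coordinates[of 0, where ?'b = nat]
    by (auto intro!: closed_vimage[of N "\<lambda>w. w 0", unfolded vimage_def]
        open_vimage[of N "\<lambda>w. w 0", unfolded vimage_def] open_discrete
        simp: closed_def open_discrete)
  have "Z' = (\<Inter>n. {w. w 0 \<in> - {n}} \<union> ?t -` Z n)"
    by (auto simp: Z'_def)
  moreover have "closed (\<Inter>n. {w. w 0 \<in> - {n}} \<union> ?t -` Z n)"
    by (intro closed_INT ballI closed_Un cyl closed_vimage Zg cont_t)
  ultimately have "closed Z'" by simp
  moreover have "continuous_on Z' g'"
    unfolding continuous_on_open_invariant
  proof (intro allI impI)
    fix U :: "(nat \<Rightarrow> nat) set" assume "open U"
    then have "\<forall>n. \<exists>V. open V \<and> V \<inter> Z n = g n -` U \<inter> Z n"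
      using Zg(2) unfolding continuous_on_open_invariant by blast
    from choice[OF this] obtain V where V: "\<And>n. open (V n)" "\<And>n. V n \<inter> Z n = g n -` U \<inter> Z n"
      by blast
    have "open (\<Union>n. {w. w 0 \<in> {n}} \<inter> ?t -` V n)"
      by (intro open_UN ballI open_Int cyl open_vimage V cont_t)
    moreover have "(\<Union>n. {w. w 0 \<in> {n}} \<inter> ?t -` V n) \<inter> Z' = g' -` U \<inter> Z'"
      using V(2)[of "w 0" for w :: "nat \<Rightarrow> nat"] unfolding Z'_def g'_def by fastforce
    ultimately show "\<exists>V. open V \<and> V \<inter> Z' = g' -` U \<inter> Z'" by blast
  qed
  moreover have "(\<Union>n. A n) = g' ` Z'"
  proof (intro subset_antisym subsetI)
    fix x assume "x \<in> (\<Union>n. A n)"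
    then obtain n w where "x = g n w" "w \<in> Z n" using Zg(3) by auto
    then show "x \<in> g' ` Z'"
      by (intro image_eqI[of _ _ "case_nat n w"]) (auto simp: g'_def Z'_def)
  qed (auto simp: Zg(3) g'_def Z'_def)
  ultimately show ?thesis unfolding closed_image_def by blast
qed

text \<open>One sequence encodes a parameter for every \<open>A n\<close>; the domain demands that
  all of them have the same image, a closed condition because it equates continuous
  functions.\<close>

lemma closed_image_INT:
  assumes "\<And>n :: nat. closed_image (A n)"
  shows "closed_image (\<Inter>n. A n)"
proof -
  obtain Z and g :: "nat \<Rightarrow> (nat \<Rightarrow> nat) \<Rightarrow> nat \<Rightarrow> nat"
    where "\<forall>n. closed (Z n) \<and> continuous_on (Z n) (g n) \<and> A n = g n ` Z n"
    by (rule closed_image_choice[OF assms])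
  then have Zg: "\<And>n. closed (Z n)" "\<And>n. continuous_on (Z n) (g n)" "\<And>n. A n = g n ` Z n"
    by blast+
  let ?c = "\<lambda>n (w :: nat \<Rightarrow> nat) i. w (prod_encode (n, i))"
  define W where "W = (\<Inter>n. ?c n -` Z n)"
  have cont_c: "continuous_on S (?c n)" for n S by (rule continuous_on_reindex)
  have "closed W" unfolding W_def
    by (intro closed_INT ballI closed_vimage Zg cont_c)
  have cont_g: "continuous_on W (\<lambda>w. g n (?c n w))" for n
    by (rule continuous_on_compose2[OF Zg(2) cont_c]) (auto simp: W_def)
  have cont_i: "continuous_on W (\<lambda>w. g n (?c n w) i)" for n i
    by (rule continuous_on_product_then_coordinatewise[OF cont_g])
  \<comment> \<open>The composed maps are known to be continuous only on \<open>W\<close>, so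
    equality of images is imposed relative to \<open>W\<close>, one coordinate at a time.\<close>
  define Z' where
    "Z' = (\<Inter>n. \<Inter>i. W \<inter> (\<lambda>w. (g n (?c n w) i, g 0 (?c 0 w) i)) -` {p. fst p = snd p})"
  have "closed {p :: nat \<times> nat. fst p = snd p}"
    by (intro closed_Collect_eq continuous_on_fst continuous_on_snd continuous_on_id)
  then have "closed Z'" unfolding Z'_def
    by (intro closed_INT ballI continuous_closed_preimage continuous_on_Pair cont_i \<open>closed W\<close>)
  moreover have "continuous_on Z' (\<lambda>w. g 0 (?c 0 w))"
    by (rule continuous_on_subset[OF cont_g]) (auto simp: Z'_def)
  moreover have "(\<Inter>n. A n) = (\<lambda>w. g 0 (?c 0 w)) ` Z'"
  proof (intro subset_antisym subsetI)
    fix x assume "x \<in> (\<Inter>n. A n)"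
    then have "\<forall>n. \<exists>w. x = g n w \<and> w \<in> Z n" using Zg(3) by auto
    then obtain w where w: "\<And>n. x = g n (w n)" "\<And>n. w n \<in> Z n" by metis
    define v where "v i = w (fst (prod_decode i)) (snd (prod_decode i))" for i
    have "?c n v = w n" for n by (auto simp: v_def)
    then show "x \<in> (\<lambda>w. g 0 (?c 0 w)) ` Z'"
      using w by (intro image_eqI[of _ _ v]) (auto simp: Z'_def W_def)
  next
    fix x assume "x \<in> (\<lambda>w. g 0 (?c 0 w)) ` Z'"
    then obtain w where "w \<in> Z'" "x = g 0 (?c 0 w)" by blast
    then have "x = g n (?c n w) \<and> ?c n w \<in> Z n" for n by (auto simp: Z'_def W_def intro!: ext) metis
    then show "x \<in> (\<Inter>n. A n)" unfolding Zg(3) by blast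
  qed
  ultimately show ?thesis unfolding closed_image_def by blast
qed

lemma closed_image_Union:
  assumes "countable \<A>" "\<And>A. A \<in> \<A> \<Longrightarrow> closed_image A"
  shows "closed_image (\<Union>\<A>)"
proof (cases "\<A> = {}")
  case True then show ?thesis by (simp add: closed_image_closed)
next
  case False
  then have "\<Union>\<A> = (\<Union>n. from_nat_into \<A> n)"
    using assms(1) by (simp add: range_from_nat_into)
  then show ?thesis
    using closed_image_UN[of "from_nat_into \<A>"] assms(2) from_nat_into[OF False] by simp
qed

text \<open>A basic open set restricts coordinates to sets of naturals, each of them clopen, and is
  therefore also closed; an open set is a countable union of such sets.\<close>

lemma closed_image_open: assumes "open (U :: (nat \<Rightarrow> nat) set)" shows "closed_image U"
proof -
  obtain K :: "(nat \<Rightarrow> nat) set set" where K: "topological_basis K" "countable K"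
    "\<And>k. k \<in> K \<Longrightarrow> \<exists>X. (k = Pi\<^sub>E UNIV X) \<and> (\<forall>i. open (X i)) \<and> finite {i. X i \<noteq> UNIV}"
    using product_topology_countable_basis by metis
  have "closed_image k" if "k \<in> K" for k
  proof -
    have "k \<in> K" by fact
    then obtain X where "k = Pi\<^sub>E UNIV X" using K(3) by blast
    then have "k = (\<Inter>i. (\<lambda>w. w i) -` X i)" by auto
    moreover have "closed (\<Inter>i. (\<lambda>w. w i) -` X i)"
      by (intro closed_INT ballI closed_vimage continuous_on_product_coordinates)
        (simp add: closed_def open_discrete)
    ultimately show ?thesis by (simp add: closed_image_closed)
  qed
  moreover obtain K' where "K' \<subseteq> K" "\<Union>K' = U"
    using K(1) assms unfolding topological_basis_def by blast
  ultimately show ?thesis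
    using closed_image_Union[of K'] K(2) countable_subset by blast
qed

text \<open>The complement of a closed image need not be one, so the induction carries a set
  together with its complement; unions and intersections then exchange roles.\<close>

lemma closed_image_borel: assumes "A \<in> sets borel" shows "closed_image A"
proof -
  have "A \<in> sigma_sets UNIV {U. open U}" using assms by (simp add: borel_def)
  then have "closed_image A \<and> closed_image (- A)"
  proof (induction rule: sigma_sets.induct)
    case (Basic a) then show ?case by (simp add: closed_image_open closed_image_closed closed_Compl)
  next
    case Empty then show ?case by (simp add: closed_image_closed)
  next
    case (Compl a) then show ?case by (simp add: Compl_eq_Diff_UNIV Diff_Diff_Int)
  next
    case (Union a)
    then show ?case by (auto intro!: closed_image_UN closed_image_INT)
  qed
  then show ?thesis by blast
qed

section \<open>Borel isomorphisms with subsets of Baire space\<close>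

lemma space_borel_of: "space (borel_of X) = topspace X"
  unfolding borel_of_def by (intro space_measure_of) (auto dest: openin_subset)

lemma sets_borel_of: "sets (borel_of X) = sigma_sets (topspace X) {U. openin X U}"
  unfolding borel_of_def by (intro sets_measure_of) (auto dest: openin_subset)

lemma sets_borel_of_euclidean: "sets (borel_of euclidean) = sets borel"
  by (simp add: sets_borel_of borel_def)

lemma measurable_borel_of:
  assumes "continuous_map X Y f" shows "f \<in> borel_of X \<rightarrow>\<^sub>M borel_of Y"
  unfolding borel_of_def[of Y]
proof (rule measurable_measure_of)
  show "{U. openin Y U} \<subseteq> Pow (topspace Y)" by (auto dest: openin_subset)
  show "f \<in> space (borel_of X) \<rightarrow> topspace Y"
    using continuous_map_image_subset_topspace[OF assms] by (auto simp: space_borel_of)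
  fix U assume "U \<in> {U. openin Y U}"
  then have "openin X {x \<in> topspace X. f x \<in> U}"
    using assms by (auto simp: continuous_map_def)
  then show "f -` U \<inter> space (borel_of X) \<in> sets (borel_of X)"
    by (auto simp: sets_borel_of space_borel_of vimage_def Int_def conj_commute intro: sigma_sets.Basic)
qed

text \<open>Baire space serves as the only coding space, since that is where
  \<open>closed_image\<close> lives; the passage to the type used by \<open>analytic_in\<close> is
  made once, through \<open>real_seq\<close>.\<close>

definition borel_code :: "'b measure \<Rightarrow> (nat \<Rightarrow> nat) set \<Rightarrow> ('b \<Rightarrow> nat \<Rightarrow> nat) \<Rightarrow> ((nat \<Rightarrow> nat) \<Rightarrow> 'b) \<Rightarrow> bool" where
  "borel_code M B \<phi> \<psi> \<longleftrightarrow> B \<in> sets borel \<and>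
     \<phi> \<in> M \<rightarrow>\<^sub>M restrict_space borel B \<and> \<psi> \<in> restrict_space borel B \<rightarrow>\<^sub>M M \<and>
     (\<forall>x\<in>space M. \<psi> (\<phi> x) = x) \<and> (\<forall>y\<in>B. \<phi> (\<psi> y) = y)"

lemma borel_codeD:
  assumes "borel_code M B \<phi> \<psi>"
  shows "B \<in> sets borel" "\<phi> \<in> M \<rightarrow>\<^sub>M restrict_space borel B" "\<psi> \<in> restrict_space borel B \<rightarrow>\<^sub>M M"
    "\<And>x. x \<in> space M \<Longrightarrow> \<psi> (\<phi> x) = x" "\<And>y. y \<in> B \<Longrightarrow> \<phi> (\<psi> y) = y"
    "\<And>x. x \<in> space M \<Longrightarrow> \<phi> x \<in> B" "\<And>y. y \<in> B \<Longrightarrow> \<psi> y \<in> space M"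
proof -
  show \<phi>: "\<phi> \<in> M \<rightarrow>\<^sub>M restrict_space borel B" and \<psi>: "\<psi> \<in> restrict_space borel B \<rightarrow>\<^sub>M M"
    using assms unfolding borel_code_def by auto
  show "\<And>x. x \<in> space M \<Longrightarrow> \<phi> x \<in> B" "\<And>y. y \<in> B \<Longrightarrow> \<psi> y \<in> space M"
    using measurable_space[OF \<phi>] measurable_space[OF \<psi>] by (auto simp: space_restrict_space)
qed (use assms in \<open>auto simp: borel_code_def\<close>)

definition standard :: "'b measure \<Rightarrow> bool" where
  "standard M \<longleftrightarrow> (\<exists>B \<phi> \<psi>. borel_code M B \<phi> \<psi>)"

lemma standard_cong_sets: assumes "sets M = sets N" shows "standard M \<longleftrightarrow> standard N"
proof -
  have "measurable M K = measurable N K" "measurable K M = measurable K N" for K :: "(nat \<Rightarrow> nat) measure"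
    using assms by (intro measurable_cong_sets refl; simp)+
  then show ?thesis
    using sets_eq_imp_space_eq[OF assms] by (simp add: standard_def borel_code_def)
qed

text \<open>With \<open>od\<close> and \<open>join\<close>, this interleaves pairs of sequences,
  which identifies Baire space with its square.\<close>

definition ev :: "(nat \<Rightarrow> 'b) \<Rightarrow> nat \<Rightarrow> 'b" where "ev w = (\<lambda>i. w (2 * i))"
definition od :: "(nat \<Rightarrow> 'b) \<Rightarrow> nat \<Rightarrow> 'b" where "od w = (\<lambda>i. w (2 * i + 1))"
definition join :: "(nat \<Rightarrow> 'b) \<Rightarrow> (nat \<Rightarrow> 'b) \<Rightarrow> nat \<Rightarrow> 'b" where
  "join x y = (\<lambda>i. if even i then x (i div 2) else y (i div 2))"

lemma ev_join [simp]: "ev (join x y) = x" and od_join [simp]: "od (join x y) = y"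
  by (auto simp: ev_def od_def join_def)

lemma join_ev_od [simp]: "join (ev w) (od w) = w"
  by (rule ext) (auto simp: ev_def od_def join_def elim: oddE)

lemma continuous_on_ev: "continuous_on S (ev :: (nat \<Rightarrow> 'b::topological_space) \<Rightarrow> _)"
  and continuous_on_od: "continuous_on S (od :: (nat \<Rightarrow> 'b::topological_space) \<Rightarrow> _)"
  unfolding ev_def[abs_def] od_def[abs_def] by (intro continuous_on_reindex)+

lemma measurable_ev [measurable]: "(ev :: (nat \<Rightarrow> 'b::topological_space) \<Rightarrow> _) \<in> borel \<rightarrow>\<^sub>M borel"
  and measurable_od [measurable]: "(od :: (nat \<Rightarrow> 'b) \<Rightarrow> _) \<in> borel \<rightarrow>\<^sub>M borel"
  by (intro borel_measurable_continuous_onI continuous_on_ev continuous_on_od)+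

lemma measurable_join [measurable (raw)]:
  fixes f g :: "'x \<Rightarrow> nat \<Rightarrow> nat"
  assumes "f \<in> borel_measurable M" "g \<in> borel_measurable M"
  shows "(\<lambda>x. join (f x) (g x)) \<in> borel_measurable M"
proof (rule measurable_coordinatewise_then_product)
  fix i show "(\<lambda>x. join (f x) (g x) i) \<in> borel_measurable M"
    using assms by (cases "even i") (auto simp: join_def intro: measurable_product_then_coordinatewise)
qed

text \<open>The map \<open>f\<close> is measurable only on the trace of \<open>B\<close>, so
  measurability is obtained on the Borel set of \<open>w\<close> with \<open>ev w\<close> in
  \<open>B\<close> and then lifted to the whole space.\<close>

lemma sets_ev_pullback:
  assumes "B \<in> sets borel" "f \<in> restrict_space borel B \<rightarrow>\<^sub>M M" "Q \<in> sets (M \<Otimes>\<^sub>M borel)"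
  shows "{w :: nat \<Rightarrow> nat. ev w \<in> B \<and> (f (ev w), od w) \<in> Q} \<in> sets borel"
proof -
  let ?E = "{w :: nat \<Rightarrow> nat. ev w \<in> B}"
  have E: "?E \<in> sets borel"
    using measurable_sets[OF measurable_ev assms(1)] by (simp add: vimage_def)
  have 1: "ev \<in> restrict_space borel ?E \<rightarrow>\<^sub>M restrict_space borel B"
    by (intro measurable_restrict_space3 measurable_ev) auto
  have "(\<lambda>w. (f (ev w), od w)) \<in> restrict_space borel ?E \<rightarrow>\<^sub>M M \<Otimes>\<^sub>M borel"
    by (intro measurable_Pair measurable_compose[OF 1 assms(2)] measurable_restrict_space1 measurable_od)
  from measurable_sets[OF this assms(3)]
  have "(\<lambda>w. (f (ev w), od w)) -` Q \<inter> ?E \<in> sets (restrict_space borel ?E)"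
    by (simp add: space_restrict_space)
  then have "(\<lambda>w. (f (ev w), od w)) -` Q \<inter> ?E \<in> sets borel"
    using E by (simp add: sets_restrict_space_iff)
  moreover have "(\<lambda>w. (f (ev w), od w)) -` Q \<inter> ?E = {w. ev w \<in> B \<and> (f (ev w), od w) \<in> Q}"
    by auto
  ultimately show ?thesis by simp
qed

text \<open>\<open>analytic_in\<close> asks for topologies on real sequences;
  \<open>real_seq\<close> embeds Baire space there as a closed set, with \<open>nat_seq\<close> as
  continuous inverse on its range.\<close>

definition real_seq :: "(nat \<Rightarrow> nat) \<Rightarrow> nat \<Rightarrow> real" where "real_seq x = (\<lambda>i. real (x i))"
definition nat_seq :: "(nat \<Rightarrow> real) \<Rightarrow> nat \<Rightarrow> nat" where "nat_seq y = (\<lambda>i. nat \<lfloor>y i\<rfloor>)"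

lemma nat_seq_real_seq [simp]: "nat_seq (real_seq x) = x"
  by (simp add: nat_seq_def real_seq_def)

lemma continuous_real_seq: "continuous_on S real_seq"
proof -
  have "continuous_on S (\<lambda>w :: nat \<Rightarrow> nat. real (w i))" for i
    using continuous_on_of_nat[OF continuous_on_subset[OF continuous_on_product_coordinates[of i]], of S]
    by simp
  then show ?thesis
    unfolding real_seq_def[abs_def] by (rule continuous_on_coordinatewise_then_product)
qed

lemma closed_real_seq_image: assumes "closed Z" shows "closed (real_seq ` Z)"
  and continuous_nat_seq: "continuous_on (range real_seq) nat_seq"
proof -
  have range: "range real_seq = (\<Inter>i. (\<lambda>w. w i) -` \<nat>)"
  proof (intro subset_antisym subsetI)
    fix w :: "nat \<Rightarrow> real" assume "w \<in> (\<Inter>i. (\<lambda>w. w i) -` \<nat>)"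
    then have "w i \<in> \<nat>" for i by simp
    then have "w i = real_seq (nat_seq w) i" for i
      unfolding real_seq_def nat_seq_def by (metis Nats_cases nat_int floor_of_nat)
    then have "w = real_seq (nat_seq w)" by blast
    then show "w \<in> range real_seq" by blast
  qed (auto simp: real_seq_def)
  have closed_range: "closed (range real_seq)"
    unfolding range
    by (intro closed_INT ballI closed_vimage continuous_on_product_coordinates closed_Nats)
  have cont: "continuous_on \<nat> (\<lambda>x :: real. nat \<lfloor>x\<rfloor>)"
    unfolding continuous_on_open_invariant
  proof (intro allI impI)
    fix B :: "nat set" assume "open B"
    \<comment> \<open>A ball of radius \<open>1/2\<close> around a natural number contains no other
      one, so every set of naturals is the trace of an open set.\<close>
    have "open (\<Union>n\<in>B. ball (real n) (1/2))" by auto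
    moreover have "(\<Union>n\<in>B. ball (real n) (1/2)) \<inter> \<nat> = (\<lambda>x. nat \<lfloor>x\<rfloor>) -` B \<inter> \<nat>"
    proof -
      have "real m \<in> ball (real n) (1/2) \<longleftrightarrow> m = n" for m n
        by (cases m n rule: linorder_cases) (auto simp: dist_real_def abs_if)
      then show ?thesis by (auto simp: Nats_def)
    qed
    ultimately show "\<exists>A. open A \<and> A \<inter> \<nat> = (\<lambda>x :: real. nat \<lfloor>x\<rfloor>) -` B \<inter> \<nat>" by blast
  qed
  show *: "continuous_on (range real_seq) nat_seq"
    unfolding nat_seq_def[abs_def]
    by (intro continuous_on_coordinatewise_then_product continuous_on_compose2[OF cont]
      continuous_on_subset[OF continuous_on_product_coordinates]) (auto simp: real_seq_def)
  have "real_seq ` Z = range real_seq \<inter> nat_seq -` Z" by auto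
  then show "closed (real_seq ` Z)"
    using continuous_closed_preimage[OF * closed_range assms] by simp
qed

lemma polish_closed: assumes "closed (S :: (nat \<Rightarrow> real) set)" shows "polish (top_of_set S)"
  unfolding polish_def
proof
  show "completely_metrizable_space (top_of_set S)"
    using assms by (intro completely_metrizable_space_closedin completely_metrizable_space_euclidean) auto
  obtain K :: "(nat \<Rightarrow> real) set set" where K: "countable K" "topological_basis K"
    using ex_countable_basis by blast
  then have "second_countable (euclidean :: (nat \<Rightarrow> real) topology)"
    unfolding second_countable_def using topological_basis_open[OF K(2)] topological_basisE[OF K(2)]
    by (intro exI[of _ K] conjI allI impI) (simp, simp, metis open_openin)
  then show "separable_space (top_of_set S)"
    by (intro second_countable_imp_separable_space second_countable_subtopology)
qed

text \<open>
  A Borel isomorphism turns a measurable set into a Borel subset of Baire space, which is a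
  continuous image of a closed set.
\<close>

theorem analytic_in_projection:
  assumes "standard M" "Q \<in> sets (M \<Otimes>\<^sub>M (borel :: (nat \<Rightarrow> nat) measure))"
  shows "analytic_in M (fst ` Q)"
proof -
  obtain B \<phi> \<psi> where code: "borel_code M B \<phi> \<psi>" using assms(1) unfolding standard_def by blast
  note B = borel_codeD(1)[OF code] and \<phi> = borel_codeD(2)[OF code] and \<psi> = borel_codeD(3)[OF code]
    and inv = borel_codeD(4,5)[OF code] and spc = borel_codeD(6,7)[OF code]
  have Q: "Q \<subseteq> space M \<times> UNIV"
    using sets.sets_into_space[OF assms(2)] by (simp add: space_pair_measure)
  \<comment> \<open>In a member of \<open>R\<close> the even part codes the point of
    \<open>M\<close> and the odd part is the witness, so projection becomes the continuous map
    \<open>ev\<close>.\<close>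
  define R where "R = {w. ev w \<in> B \<and> (\<psi> (ev w), od w) \<in> Q}"
  have "R \<in> sets borel" unfolding R_def by (rule sets_ev_pullback[OF B \<psi> assms(2)])
  from closed_image_borel[OF this]
  obtain Z :: "(nat \<Rightarrow> nat) set" and g :: "(nat \<Rightarrow> nat) \<Rightarrow> nat \<Rightarrow> nat"
    where Z: "closed Z" "continuous_on Z g" "R = g ` Z"
    unfolding closed_image_def by auto
  have img: "\<phi> ` fst ` Q = ev ` R"
  proof (intro subset_antisym subsetI)
    fix y assume "y \<in> \<phi> ` fst ` Q"
    then obtain x z where "(x, z) \<in> Q" "y = \<phi> x" by auto
    then have "join y z \<in> R" using Q spc inv by (auto simp: R_def)
    then show "y \<in> ev ` R" by (intro image_eqI[of _ _ "join y z"]) simp_all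
  next
    fix y assume "y \<in> ev ` R"
    then obtain w where "w \<in> R" "y = ev w" by blast
    then have "y = \<phi> (fst (\<psi> (ev w), od w))" "(\<psi> (ev w), od w) \<in> Q" using inv by (auto simp: R_def)
    then show "y \<in> \<phi> ` fst ` Q" by blast
  qed
  let ?Y = "top_of_set (range real_seq)" and ?Z = "top_of_set (real_seq ` Z)"
  have cm: "continuous_map euclidean ?Y real_seq" "continuous_map ?Y euclidean nat_seq"
    using continuous_real_seq continuous_nat_seq by (auto simp: continuous_map_in_subtopology)
  have m: "real_seq \<in> borel \<rightarrow>\<^sub>M borel_of ?Y" "nat_seq \<in> borel_of ?Y \<rightarrow>\<^sub>M borel"
    using cm[THEN measurable_borel_of]
      measurable_cong_sets[OF sets_borel_of_euclidean refl, of "borel_of ?Y"]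
      measurable_cong_sets[OF refl sets_borel_of_euclidean, of "borel_of ?Y"] by blast+
  define B' where "B' = real_seq ` B"
  have "B' = nat_seq -` B \<inter> space (borel_of ?Y)"
    by (auto simp: B'_def space_borel_of)
  then have "B' \<in> sets (borel_of ?Y)" using measurable_sets[OF m(2) B] by simp
  moreover have "real_seq \<circ> \<phi> \<in> M \<rightarrow>\<^sub>M restrict_space (borel_of ?Y) B'"
    by (intro measurable_comp[OF \<phi>] measurable_restrict_space3 m) (auto simp: B'_def)
  moreover have "\<psi> \<circ> nat_seq \<in> restrict_space (borel_of ?Y) B' \<rightarrow>\<^sub>M M"
    by (intro measurable_comp[OF _ \<psi>] measurable_restrict_space3 m) (auto simp: B'_def)
  moreover have "continuous_map ?Z ?Y (real_seq \<circ> ev \<circ> g \<circ> nat_seq)"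
  proof -
    have "continuous_on (real_seq ` Z) nat_seq"
      by (rule continuous_on_subset[OF continuous_nat_seq]) auto
    then have "continuous_on (real_seq ` Z) (\<lambda>y. g (nat_seq y))"
      by (rule continuous_on_compose2[OF Z(2)]) auto
    then have "continuous_on (real_seq ` Z) (\<lambda>y. real_seq (ev (g (nat_seq y))))"
      by (intro continuous_on_compose2[OF continuous_real_seq[of UNIV]]
          continuous_on_compose2[OF continuous_on_ev[of UNIV]]) auto
    then show ?thesis by (auto simp: continuous_map_in_subtopology comp_def)
  qed
  moreover have "(real_seq \<circ> ev \<circ> g \<circ> nat_seq) ` topspace ?Z = (real_seq \<circ> \<phi>) ` fst ` Q"
    using arg_cong[OF img, of "image real_seq"] by (simp add: Z(3) image_image)
  moreover have "polish ?Y" "polish ?Z"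
    using polish_closed closed_real_seq_image Z(1) by (auto intro: closed_UNIV)
  moreover have "fst ` Q \<subseteq> space M" using Q by auto
  ultimately show ?thesis
    unfolding analytic_in_def using inv
    by (intro conjI exI[of _ ?Y] exI[of _ B'] exI[of _ "real_seq \<circ> \<phi>"] exI[of _ "\<psi> \<circ> nat_seq"]
      exI[of _ ?Z] exI[of _ "real_seq \<circ> ev \<circ> g \<circ> nat_seq"]) (auto simp: B'_def)
qed

lemma standard_restrict_space:
  assumes "standard M" "A \<in> sets M" shows "standard (restrict_space M A)"
proof -
  obtain B \<phi> \<psi> where code: "borel_code M B \<phi> \<psi>" using assms(1) unfolding standard_def by blast
  note B = borel_codeD(1)[OF code] and \<phi> = borel_codeD(2)[OF code] and \<psi> = borel_codeD(3)[OF code]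
    and inv = borel_codeD(4,5)[OF code] and spc = borel_codeD(6,7)[OF code]
  define C where "C = \<psi> -` A \<inter> B"
  have "C \<in> sets (restrict_space borel B)"
    using measurable_sets[OF \<psi> assms(2)] by (simp add: C_def space_restrict_space)
  then have C: "C \<in> sets borel" using B by (simp add: sets_restrict_space_iff)
  have "\<phi> \<in> restrict_space M A \<rightarrow>\<^sub>M restrict_space borel C"
    using \<phi> sets.sets_into_space[OF assms(2)] inv spc
    by (intro measurable_restrict_space3) (auto simp: measurable_restrict_space2_iff C_def)
  moreover have "\<psi> \<in> restrict_space borel C \<rightarrow>\<^sub>M restrict_space M A"
  proof -
    have "\<psi> \<in> restrict_space (restrict_space borel B) C \<rightarrow>\<^sub>M restrict_space M A"
      by (rule measurable_restrict_space3[OF \<psi>]) (auto simp: C_def)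
    moreover have "sets (restrict_space (restrict_space borel B) C) = sets (restrict_space borel C)"
      by (simp add: sets_restrict_restrict_space Int_absorb1 C_def)
    ultimately show ?thesis by (simp cong: measurable_cong_sets)
  qed
  ultimately show ?thesis
    unfolding standard_def borel_code_def using C inv
    by (intro exI[of _ C] exI[of _ \<phi>] exI[of _ \<psi>]) (auto simp: C_def space_restrict_space)
qed

lemma standard_pair:
  assumes "standard M" "standard N" shows "standard (M \<Otimes>\<^sub>M N)"
proof -
  obtain B \<phi> \<psi> where code: "borel_code M B \<phi> \<psi>" using assms(1) unfolding standard_def by blast
  note B = borel_codeD(1)[OF code] and \<phi> = borel_codeD(2)[OF code] and \<psi> = borel_codeD(3)[OF code]
    and inv = borel_codeD(4,5)[OF code] and spc = borel_codeD(6,7)[OF code]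
  obtain B' \<phi>' \<psi>' where code': "borel_code N B' \<phi>' \<psi>'" using assms(2) unfolding standard_def by blast
  note B' = borel_codeD(1)[OF code'] and \<phi>' = borel_codeD(2)[OF code'] and \<psi>' = borel_codeD(3)[OF code']
    and inv' = borel_codeD(4,5)[OF code'] and spc' = borel_codeD(6,7)[OF code']
  define C where "C = {w :: nat \<Rightarrow> nat. ev w \<in> B \<and> od w \<in> B'}"
  have "C = (ev -` B \<inter> space borel) \<inter> (od -` B' \<inter> space borel)"
    by (auto simp: C_def)
  then have C: "C \<in> sets borel"
    using measurable_sets[OF measurable_ev B] measurable_sets[OF measurable_od B'] by simp
  have \<phi>2: "(\<lambda>p. join (\<phi> (fst p)) (\<phi>' (snd p))) \<in> M \<Otimes>\<^sub>M N \<rightarrow>\<^sub>M restrict_space borel C"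
  proof (rule measurable_restrict_space2)
    have "\<phi> \<in> borel_measurable M" "\<phi>' \<in> borel_measurable N"
      using \<phi> \<phi>' by (auto simp: measurable_restrict_space2_iff)
    then show "(\<lambda>p. join (\<phi> (fst p)) (\<phi>' (snd p))) \<in> M \<Otimes>\<^sub>M N \<rightarrow>\<^sub>M borel"
      by measurable
  qed (auto simp: C_def space_pair_measure spc spc')
  have \<psi>2: "(\<lambda>w. (\<psi> (ev w), \<psi>' (od w))) \<in> restrict_space borel C \<rightarrow>\<^sub>M M \<Otimes>\<^sub>M N"
  proof (rule measurable_Pair)
    have "ev \<in> restrict_space borel C \<rightarrow>\<^sub>M restrict_space borel B"
      by (intro measurable_restrict_space3 measurable_ev) (auto simp: C_def)
    then show "(\<lambda>w. \<psi> (ev w)) \<in> restrict_space borel C \<rightarrow>\<^sub>M M"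
      by (rule measurable_compose[OF _ \<psi>])
    have "od \<in> restrict_space borel C \<rightarrow>\<^sub>M restrict_space borel B'"
      by (intro measurable_restrict_space3 measurable_od) (auto simp: C_def)
    then show "(\<lambda>w. \<psi>' (od w)) \<in> restrict_space borel C \<rightarrow>\<^sub>M N"
      by (rule measurable_compose[OF _ \<psi>'])
  qed
  show ?thesis
    unfolding standard_def borel_code_def using C \<phi>2 \<psi>2 inv inv'
    by (intro exI[of _ C] exI[of _ "\<lambda>p. join (\<phi> (fst p)) (\<phi>' (snd p))"]
        exI[of _ "\<lambda>w. (\<psi> (ev w), \<psi>' (od w))"]) (auto simp: C_def space_pair_measure)
qed

section \<open>Borel families of trees\<close>

lemma measurable_seq_coordinate [measurable]:
  "(\<lambda>z :: nat \<Rightarrow> nat. z i) \<in> borel \<rightarrow>\<^sub>M count_space UNIV"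
  using measurable_product_coordinates[of i, where ?'b = nat]
  by (simp add: measurable_cong_sets[OF refl sets_borel_eq_count_space])

lemma pred_countable_relation:
  fixes f :: "'x \<Rightarrow> 'b::countable" and g :: "'x \<Rightarrow> 'c::countable"
  assumes "f \<in> N \<rightarrow>\<^sub>M count_space UNIV" "g \<in> N \<rightarrow>\<^sub>M count_space UNIV"
  shows "Measurable.pred N (\<lambda>x. P (f x) (g x))"
  by (rule measurable_compose_countable[OF measurable_compose_countable[OF _ assms(2)] assms(1)]) simp

lemma measurable_seq_segment:
  "(\<lambda>z :: nat \<Rightarrow> nat. map (\<lambda>i. z (p i)) [0..<k]) \<in> borel \<rightarrow>\<^sub>M count_space UNIV"
proof (induction k)
  case (Suc k)
  have "(\<lambda>z :: nat \<Rightarrow> nat. s @ [n]) \<in> borel \<rightarrow>\<^sub>M count_space UNIV" for s n by simp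
  then have "(\<lambda>z :: nat \<Rightarrow> nat. map (\<lambda>i. z (p i)) [0..<k] @ [z (p k)]) \<in> borel \<rightarrow>\<^sub>M count_space UNIV"
    by (rule measurable_compose_countable[OF measurable_compose_countable[OF _ measurable_seq_coordinate] Suc])
  then show ?case by simp
qed simp

text \<open>Countably many trees are attached to one point; for operators they belong to the
  thresholds \<open>1 / real (Suc n)\<close>. Measurability of single nodes is the only link between
  the trees and \<open>M\<close>.\<close>

locale tree_family =
  fixes M :: "'x measure" and tr :: "'x \<Rightarrow> nat \<Rightarrow> nat list set"
  assumes standard: "standard M"
    and tree: "x \<in> space M \<Longrightarrow> is_tree (tr x n)"
    and root: "x \<in> space M \<Longrightarrow> [] \<in> tr x n"
    and sets_node: "{x \<in> space M. s \<in> tr x n} \<in> sets M"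
begin

definition wf_set :: "'x set" where
  "wf_set = {x \<in> space M. \<forall>n. \<not> has_branch (tr x n)}"

definition rank :: "'x \<Rightarrow> ordinal" where
  "rank x = (SUP n. tree_height (tr x n))"

text \<open>Tree index and node may themselves depend on \<open>w\<close>: they take countably many
  values, so the condition splits into countably many instances of \<open>sets_node\<close>.\<close>

lemma pred_node:
  assumes "X \<in> N \<rightarrow>\<^sub>M M" "n \<in> N \<rightarrow>\<^sub>M count_space UNIV" "s \<in> N \<rightarrow>\<^sub>M count_space UNIV"
  shows "Measurable.pred N (\<lambda>w. s w \<in> tr (X w) (n w))"
proof -
  have "Measurable.pred N (\<lambda>w. s' \<in> tr (X w) n')" for s' n'
    using measurable_compose[OF assms(1), of "\<lambda>x. s' \<in> tr x n'" "count_space UNIV"] sets_node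
    by (simp add: pred_def)
  then show ?thesis
    by (rule measurable_compose_countable[OF measurable_compose_countable[OF _ assms(2)] assms(3)])
qed

lemma pred_tree_map:
  assumes "X \<in> N \<rightarrow>\<^sub>M M" "Y \<in> N \<rightarrow>\<^sub>M M" "m \<in> N \<rightarrow>\<^sub>M count_space UNIV" "n \<in> N \<rightarrow>\<^sub>M count_space UNIV"
    "\<And>s. (\<lambda>w. f w s) \<in> N \<rightarrow>\<^sub>M count_space UNIV"
  shows "Measurable.pred N (\<lambda>w. tree_map (tr (X w) (m w)) (tr (Y w) (n w)) (f w))"
  unfolding tree_map_def Ball_def
  by (intro pred_intros_logic pred_intros_countable pred_node assms measurable_const UNIV_I
      pred_countable_relation[where P = strict_prefix]) simp_all

section \<open>Well-foundedness and comparison of ranks as projections\<close>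

definition branches :: "('x \<times> (nat \<Rightarrow> nat)) set" where
  "branches = {w \<in> space (M \<Otimes>\<^sub>M borel). \<forall>k. map (\<lambda>i. snd w (Suc i)) [0..<k] \<in> tr (fst w) (snd w 0)}"

lemma fst_branches: "fst ` branches = space M - wf_set"
proof (intro subset_antisym subsetI)
  fix x assume "x \<in> fst ` branches"
  then show "x \<in> space M - wf_set"
    by (auto simp: branches_def wf_set_def has_branch_def space_pair_measure)
next
  fix x assume "x \<in> space M - wf_set"
  then obtain n z where "x \<in> space M" "\<forall>k. map z [0..<k] \<in> tr x n"
    by (auto simp: wf_set_def has_branch_def)
  then have "(x, case_nat n z) \<in> branches" by (auto simp: branches_def space_pair_measure)
  then show "x \<in> fst ` branches" by force
qed

lemma measurable_snd_coordinate: "(\<lambda>w. snd w (i :: nat)) \<in> N \<Otimes>\<^sub>M borel \<rightarrow>\<^sub>M count_space (UNIV :: nat set)"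
  by (rule measurable_compose[OF measurable_snd measurable_seq_coordinate])

lemma sets_branches: "branches \<in> sets (M \<Otimes>\<^sub>M borel)"
proof -
  have "Measurable.pred (M \<Otimes>\<^sub>M borel)
      (\<lambda>w. \<forall>k. map (\<lambda>i. snd w (Suc i)) [0..<k] \<in> tr (fst w) (snd w 0))"
    by (intro pred_intros_countable pred_node measurable_fst measurable_snd_coordinate
        measurable_compose[OF measurable_snd measurable_seq_segment])
  then show ?thesis by (simp add: pred_def branches_def)
qed

lemma coanalytic_wf_set: "coanalytic_in M wf_set"
  unfolding coanalytic_in_def
  using analytic_in_projection[OF standard sets_branches] by (auto simp: fst_branches wf_set_def)

lemma height_less_omega1: "x \<in> wf_set \<Longrightarrow> tree_height (tr x n) < \<omega>\<^sub>1"
  using tree_height_less_omega1_iff[OF tree] by (auto simp: wf_set_def)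

lemma rank_less_omega1: "x \<in> wf_set \<Longrightarrow> rank x < \<omega>\<^sub>1"
  unfolding rank_def by (rule Sup_less_omega1) (auto simp: height_less_omega1)

text \<open>
  The height of a well-founded tree with a root is a successor, so it is below a supremum of
  heights only if it is below one of them.
\<close>

lemma rank_le_iff:
  assumes "x \<in> space M" "y \<in> wf_set"
  shows "x \<in> wf_set \<and> rank x \<le> rank y \<longleftrightarrow> (\<forall>n. \<exists>m. tree_height (tr x n) \<le> tree_height (tr y m))"
proof
  assume *: "x \<in> wf_set \<and> rank x \<le> rank y"
  show "\<forall>n. \<exists>m. tree_height (tr x n) \<le> tree_height (tr y m)"
  proof
    fix n
    obtain \<alpha> where \<alpha>: "\<alpha> < tree_height (tr x n)" "[] \<notin> derived_tree (tr x n) (osucc \<alpha>)"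
      using ex_rank_of_node[OF tree[OF assms(1)] _ root[OF assms(1)], of n] height_less_omega1 *
      by blast
    have lt: "\<alpha> < \<omega>\<^sub>1" using \<alpha>(1) height_less_omega1 * order_less_trans by blast
    have le: "tree_height (tr x n) \<le> osucc \<alpha>"
      using \<alpha>(2) less_tree_height_iff[OF tree[OF assms(1)] osucc_less_omega1[OF lt]]
      by (simp flip: not_less)
    have "tree_height (tr x n) \<le> rank x" unfolding rank_def by (rule SUP_upper) simp
    then have "\<alpha> < rank y" using \<alpha>(1) * by (meson order_less_le_trans)
    then obtain m where "\<alpha> < tree_height (tr y m)" unfolding rank_def less_SUP_iff by blast
    then show "\<exists>m. tree_height (tr x n) \<le> tree_height (tr y m)"
      using le osucc_le order_trans by blast
  qed
next
  assume *: "\<forall>n. \<exists>m. tree_height (tr x n) \<le> tree_height (tr y m)"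
  then have "tree_height (tr x n) < \<omega>\<^sub>1" for n
    using height_less_omega1[OF assms(2)] order_le_less_trans by blast
  then have "x \<in> wf_set"
    using tree_height_less_omega1_iff[OF tree[OF assms(1)]] assms(1) by (auto simp: wf_set_def)
  moreover have "rank x \<le> rank y" unfolding rank_def using * by (meson SUP_mono UNIV_I)
  ultimately show "x \<in> wf_set \<and> rank x \<le> rank y" by blast
qed

text \<open>
  A sequence of natural numbers encodes, for each \<open>n\<close>, an index \<open>snd_index z n\<close> and a map
  \<open>node_map z n\<close> between nodes.
\<close>

definition snd_index :: "(nat \<Rightarrow> nat) \<Rightarrow> nat \<Rightarrow> nat" where
  "snd_index z n = z (to_nat (Inl n :: nat + nat \<times> nat list))"

definition node_map :: "(nat \<Rightarrow> nat) \<Rightarrow> nat \<Rightarrow> nat list \<Rightarrow> nat list" where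
  "node_map z n s = from_nat (z (to_nat (Inr (n, s) :: nat + nat \<times> nat list)))"

lemma ex_code: "\<exists>z. snd_index z = m \<and> node_map z = f"
proof (intro exI conjI)
  let ?z = "\<lambda>i. case from_nat i :: nat + nat \<times> nat list of
      Inl n \<Rightarrow> m n | Inr p \<Rightarrow> to_nat (f (fst p) (snd p))"
  show "snd_index ?z = m" by (simp add: snd_index_def[abs_def])
  show "node_map ?z = f" by (simp add: node_map_def[abs_def])
qed

lemma measurable_snd_index: "(\<lambda>w. snd_index (snd w) n) \<in> N \<Otimes>\<^sub>M borel \<rightarrow>\<^sub>M count_space UNIV"
  unfolding snd_index_def by (rule measurable_snd_coordinate)

lemma measurable_node_map: "(\<lambda>w. node_map (snd w) n s) \<in> N \<Otimes>\<^sub>M borel \<rightarrow>\<^sub>M count_space UNIV"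
  unfolding node_map_def
  by (rule measurable_compose[OF measurable_snd_coordinate]) simp

definition le_codes :: "(('x \<times> 'x) \<times> (nat \<Rightarrow> nat)) set" where
  "le_codes = {w \<in> space ((M \<Otimes>\<^sub>M M) \<Otimes>\<^sub>M borel). \<forall>n.
     tree_map (tr (fst (fst w)) n) (tr (snd (fst w)) (snd_index (snd w) n)) (node_map (snd w) n)}"

text \<open>Negating the criterion in \<open>rank_le_iff\<close> gives one tree of the first point
  that is strictly higher than every tree of the second. Its index is stored at position 0 of
  \<open>snd_index\<close>, and moving the root off the root expresses strictness.\<close>

definition gt_codes :: "(('x \<times> 'x) \<times> (nat \<Rightarrow> nat)) set" where
  "gt_codes = {w \<in> space ((M \<Otimes>\<^sub>M M) \<Otimes>\<^sub>M borel). \<forall>m.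
     tree_map (tr (snd (fst w)) m) (tr (fst (fst w)) (snd_index (snd w) 0)) (node_map (snd w) m) \<and>
     node_map (snd w) m [] \<noteq> []}"

definition branch_codes :: "(('x \<times> 'x) \<times> (nat \<Rightarrow> nat)) set" where
  "branch_codes = {w \<in> space ((M \<Otimes>\<^sub>M M) \<Otimes>\<^sub>M borel). (fst (fst w), snd w) \<in> branches}"

lemma sets_codes:
  "le_codes \<in> sets ((M \<Otimes>\<^sub>M M) \<Otimes>\<^sub>M borel)" "gt_codes \<in> sets ((M \<Otimes>\<^sub>M M) \<Otimes>\<^sub>M borel)"
  "branch_codes \<in> sets ((M \<Otimes>\<^sub>M M) \<Otimes>\<^sub>M borel)"
proof -
  let ?N = "(M \<Otimes>\<^sub>M M) \<Otimes>\<^sub>M (borel :: (nat \<Rightarrow> nat) measure)"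
  have m: "(\<lambda>w. fst (fst w)) \<in> ?N \<rightarrow>\<^sub>M M" "(\<lambda>w. snd (fst w)) \<in> ?N \<rightarrow>\<^sub>M M" by measurable
  have "Measurable.pred ?N (\<lambda>w. \<forall>n. tree_map (tr (fst (fst w)) n)
      (tr (snd (fst w)) (snd_index (snd w) n)) (node_map (snd w) n))"
    by (intro pred_intros_countable pred_tree_map m measurable_snd_index measurable_node_map
        measurable_const) simp
  then show "le_codes \<in> sets ?N" by (simp add: le_codes_def pred_def)
  have 1: "Measurable.pred ?N (\<lambda>w. node_map (snd w) n [] = [])" for n
    by (rule measurable_compose[OF measurable_node_map]) simp
  have "Measurable.pred ?N (\<lambda>w. \<forall>m. tree_map (tr (snd (fst w)) m)
      (tr (fst (fst w)) (snd_index (snd w) 0)) (node_map (snd w) m) \<and> node_map (snd w) m [] \<noteq> [])"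
    by (intro pred_intros_countable pred_intros_logic pred_tree_map m measurable_snd_index
        measurable_node_map measurable_const 1) simp_all
  then show "gt_codes \<in> sets ?N" by (simp add: gt_codes_def pred_def)
  have "(\<lambda>w. (fst (fst w), snd w)) \<in> ?N \<rightarrow>\<^sub>M M \<Otimes>\<^sub>M borel" by measurable
  from measurable_sets[OF this sets_branches] show "branch_codes \<in> sets ?N"
    by (simp add: branch_codes_def vimage_def Int_def conj_commute)
qed

text \<open>A map into a tree of \<open>y\<close> keeps the height below
  \<open>\<omega>\<^sub>1\<close>, so the existence of maps already forces \<open>x\<close> to be
  well founded.\<close>

lemma mem_fst_le_codes:
  assumes "x \<in> space M" "y \<in> wf_set"
  shows "(x, y) \<in> fst ` le_codes \<longleftrightarrow> x \<in> wf_set \<and> rank x \<le> rank y"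
proof -
  have y: "y \<in> space M" using assms(2) by (simp add: wf_set_def)
  have "(x, y) \<in> fst ` le_codes \<longleftrightarrow>
      (\<exists>z. \<forall>n. tree_map (tr x n) (tr y (snd_index z n)) (node_map z n))"
    using assms(1) y by (force simp: le_codes_def space_pair_measure image_iff)
  also have "\<dots> \<longleftrightarrow> (\<exists>m f. \<forall>n. tree_map (tr x n) (tr y (m n)) (f n))"
    using ex_code by metis
  also have "\<dots> \<longleftrightarrow> (\<forall>n. \<exists>m f. tree_map (tr x n) (tr y m) f)"
    by metis
  also have "\<dots> \<longleftrightarrow> (\<forall>n. \<exists>m. tree_height (tr x n) \<le> tree_height (tr y m))"
    using tree_height_le_iff_tree_map[OF tree[OF assms(1)] tree[OF y]]
      tree_map_height_le[OF _ tree[OF assms(1)] tree[OF y]] height_less_omega1[OF assms(2)]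
    by (meson order_le_less_trans)
  also have "\<dots> \<longleftrightarrow> x \<in> wf_set \<and> rank x \<le> rank y"
    using rank_le_iff[OF assms] by blast
  finally show ?thesis .
qed

text \<open>The strict comparison by maps asks for a well-founded source, here the trees of
  \<open>y\<close>; the trees of \<open>x\<close> are arbitrary.\<close>

lemma mem_fst_gt_codes:
  assumes "x \<in> space M" "y \<in> wf_set"
  shows "(x, y) \<in> fst ` gt_codes \<longleftrightarrow> \<not> (\<forall>n. \<exists>m. tree_height (tr x n) \<le> tree_height (tr y m))"
proof -
  have y: "y \<in> space M" using assms(2) by (simp add: wf_set_def)
  have "(x, y) \<in> fst ` gt_codes \<longleftrightarrow>
      (\<exists>z. \<forall>m. tree_map (tr y m) (tr x (snd_index z 0)) (node_map z m) \<and> node_map z m [] \<noteq> [])"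
    using assms(1) y by (force simp: gt_codes_def space_pair_measure image_iff)
  also have "\<dots> \<longleftrightarrow> (\<exists>n f. \<forall>m. tree_map (tr y m) (tr x n) (f m) \<and> f m [] \<noteq> [])"
    using ex_code[of "\<lambda>_. n" f for n f] by metis
  also have "\<dots> \<longleftrightarrow> (\<exists>n. \<forall>m. \<exists>f. tree_map (tr y m) (tr x n) f \<and> f [] \<noteq> [])"
    by metis
  also have "\<dots> \<longleftrightarrow> (\<exists>n. \<forall>m. tree_height (tr y m) < tree_height (tr x n))"
    using tree_height_less_iff_tree_map[OF tree[OF y] tree[OF assms(1)] height_less_omega1[OF assms(2)]
        root[OF y]] by simp
  finally show ?thesis by (simp add: not_le)
qed

text \<open>Two descriptions of the same comparison: the analytic one asserts maps from the trees of
  \<open>x\<close> to those of \<open>y\<close>, the coanalytic one denies both a branch through a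
  tree of \<open>x\<close> and a tree of \<open>x\<close> strictly higher than all those of
  \<open>y\<close>. They agree when \<open>y\<close> is well founded.\<close>

theorem coanalytic_rank_wf_set: "coanalytic_rank M wf_set rank"
proof -
  let ?P = "space (M \<Otimes>\<^sub>M M) - fst ` (branch_codes \<union> gt_codes)"
  have std: "standard (M \<Otimes>\<^sub>M M)" by (rule standard_pair[OF standard standard])
  have "fst ` (branch_codes \<union> gt_codes) \<subseteq> space (M \<Otimes>\<^sub>M M)"
    by (auto simp: branch_codes_def gt_codes_def space_pair_measure)
  moreover have "branch_codes \<union> gt_codes \<in> sets ((M \<Otimes>\<^sub>M M) \<Otimes>\<^sub>M borel)" using sets_codes by blast
  ultimately have P: "coanalytic_in (M \<Otimes>\<^sub>M M) ?P"
    using analytic_in_projection[OF std] by (simp add: coanalytic_in_def double_diff)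
  have "x \<in> wf_set \<and> rank x \<le> rank y \<longleftrightarrow> (x, y) \<in> ?P" if "y \<in> wf_set" "x \<in> space M" for x y
  proof -
    have y: "y \<in> space M" using that by (simp add: wf_set_def)
    have "(x, y) \<in> fst ` branch_codes \<longleftrightarrow> x \<in> fst ` branches"
      using that y by (force simp: branch_codes_def space_pair_measure image_iff branches_def)
    then have "(x, y) \<in> fst ` branch_codes \<longleftrightarrow> x \<notin> wf_set"
      using that by (simp add: fst_branches)
    then show ?thesis
      using rank_le_iff[OF that(2,1)] mem_fst_gt_codes[OF that(2,1)] that y
      by (auto simp: space_pair_measure image_Un)
  qed
  then show ?thesis
    unfolding coanalytic_rank_def
    using coanalytic_wf_set rank_less_omega1 P analytic_in_projection[OF std sets_codes(1)]
      mem_fst_le_codes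
    by (intro conjI exI[of _ ?P] exI[of _ "fst ` le_codes"]) auto
qed

section \<open>Bounded ranks and Borel sets of well-founded points\<close>

lemma sets_derived_tree:
  assumes "\<alpha> < \<omega>\<^sub>1"
  shows "{x \<in> space M. s \<in> derived_tree (tr x n) \<alpha>} \<in> sets M"
  using assms
proof (induction \<alpha> arbitrary: s rule: less_induct)
  case (less \<alpha>)
  show ?case
  proof (cases \<alpha> rule: ordinal_cases)
    case zero then show ?thesis using sets_node by (simp add: derived_tree_0)
  next
    case (succ \<beta>)
    have "{x \<in> space M. s \<in> derived_tree (tr x n) \<alpha>} =
        (\<Union>t\<in>{t. strict_prefix s t}. {x \<in> space M. t \<in> derived_tree (tr x n) \<beta>})"
      using succ by (auto simp: derived_tree_osucc)
    also have "\<dots> \<in> sets M" using less succ by (intro sets.countable_UN') auto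
    finally show ?thesis .
  next
    case limit
    have "bot \<in> {..<\<alpha>}" using limit(1) bot_less[of \<alpha>] by simp
    then have ne: "{..<\<alpha>} \<noteq> {}" by blast
    then have "{x \<in> space M. s \<in> derived_tree (tr x n) \<alpha>} =
        (\<Inter>\<beta>\<in>{..<\<alpha>}. {x \<in> space M. s \<in> derived_tree (tr x n) \<beta>})"
      by (auto simp: derived_tree_limit[OF limit(1)] limit(2))
    also have "\<dots> \<in> sets M"
    proof (rule sets.countable_INT')
      \<comment> \<open>Here the bound \<open>\<alpha> < \<omega>\<^sub>1\<close> matters: the
        intersection is countable.\<close>
      show "countable {..<\<alpha>}" by (rule countable_lessThan_ordinal[OF less(2)])
      show "(\<lambda>\<beta>. {x \<in> space M. s \<in> derived_tree (tr x n) \<beta>}) ` {..<\<alpha>} \<subseteq> sets M"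
        using less.IH order_less_trans[OF _ less(2)] by auto
    qed (rule ne)
    finally show ?thesis .
  qed
qed

text \<open>At the supremum of the ranks the derivatives of well-founded points are empty, while an
  ill-founded tree keeps its root in every countable derivative.\<close>

lemma sets_wf_set_if_bounded:
  assumes "(SUP x\<in>wf_set. rank x) < \<omega>\<^sub>1"
  shows "wf_set \<in> sets M"
proof -
  let ?\<alpha> = "SUP x\<in>wf_set. rank x"
  have "wf_set = {x \<in> space M. \<forall>n. [] \<notin> derived_tree (tr x n) ?\<alpha>}"
  proof (intro subset_antisym subsetI)
    fix x assume x: "x \<in> wf_set"
    have "tree_height (tr x n) \<le> ?\<alpha>" for n
      using SUP_upper[of n UNIV "\<lambda>n. tree_height (tr x n)"] SUP_upper[OF x, of rank]
      unfolding rank_def by simp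
    then show "x \<in> {x \<in> space M. \<forall>n. [] \<notin> derived_tree (tr x n) ?\<alpha>}"
      using x tree_height_le_iff[OF tree assms] by (auto simp: wf_set_def)
  next
    fix x assume "x \<in> {x \<in> space M. \<forall>n. [] \<notin> derived_tree (tr x n) ?\<alpha>}"
    then have x: "x \<in> space M" "\<And>n. tree_height (tr x n) \<le> ?\<alpha>"
      using less_tree_height_iff[OF tree assms] by (auto simp flip: not_less)
    then have "tree_height (tr x n) < \<omega>\<^sub>1" for n using assms order_le_less_trans by blast
    then show "x \<in> wf_set"
      using tree_height_less_omega1_iff[OF tree[OF x(1)]] x(1) by (auto simp: wf_set_def)
  qed
  also have "\<dots> = (\<Inter>n. space M - {x \<in> space M. [] \<in> derived_tree (tr x n) ?\<alpha>})" by auto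
  also have "\<dots> \<in> sets M"
    using sets_derived_tree[OF assms] by (intro sets.countable_INT' sets.compl_sets) auto
  finally show ?thesis .
qed

definition node_code :: "'x \<Rightarrow> nat \<Rightarrow> nat" where
  "node_code x i = (case from_nat i :: nat \<times> nat list of (n, s) \<Rightarrow> if s \<in> tr x n then 1 else 0)"

lemma measurable_node_code: "node_code \<in> M \<rightarrow>\<^sub>M borel"
proof (rule measurable_coordinatewise_then_product)
  fix i
  obtain n :: nat and s :: "nat list" where "from_nat i = (n, s)" by fastforce
  moreover have "(\<lambda>x. if s \<in> tr x n then 1 else 0 :: nat) \<in> borel_measurable M"
    using sets_node by (intro measurable_If) auto
  ultimately show "(\<lambda>x. node_code x i) \<in> borel_measurable M" by (simp add: node_code_def)
qed

lemma node_code_eq_1: "node_code x (to_nat (n, s)) = 1 \<longleftrightarrow> s \<in> tr x n"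
  by (simp add: node_code_def)

text \<open>
  Recording the trees in the code makes membership of a node a clopen condition on parameters.
\<close>

lemma ex_clopen_parametrization:
  assumes "wf_set \<in> sets M"
  obtains Z :: "(nat \<Rightarrow> nat) set" and X where "closed Z" "X ` Z = wf_set"
    "continuous_on Z (\<lambda>z. node_code (X z))"
proof -
  obtain B \<phi> \<psi> where code: "borel_code M B \<phi> \<psi>" using standard unfolding standard_def by blast
  note B = borel_codeD(1)[OF code] and \<phi> = borel_codeD(2)[OF code] and \<psi> = borel_codeD(3)[OF code]
    and inv = borel_codeD(4,5)[OF code] and spc = borel_codeD(6,7)[OF code]
  \<comment> \<open>The graph of \<open>node_code\<close> over \<open>wf_set\<close>: once it is
    parametrized continuously, the code of the trees, being its second component, is a continuous
    function of the parameter.\<close>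
  define Q where "Q = {w \<in> space (M \<Otimes>\<^sub>M borel). fst w \<in> wf_set \<and> (\<forall>i. snd w i = node_code (fst w) i)}"
  have "Q \<in> sets (M \<Otimes>\<^sub>M borel)"
  proof -
    have "(\<lambda>x. node_code x i) \<in> M \<rightarrow>\<^sub>M count_space UNIV" for i
      by (rule measurable_compose[OF measurable_node_code measurable_seq_coordinate])
    then have "(\<lambda>w. node_code (fst w) i) \<in> M \<Otimes>\<^sub>M borel \<rightarrow>\<^sub>M count_space UNIV" for i
      by (rule measurable_compose[OF measurable_fst])
    then have "Measurable.pred (M \<Otimes>\<^sub>M borel) (\<lambda>w. \<forall>i. snd w i = node_code (fst w) i)"
      by (intro pred_intros_countable pred_countable_relation[where P = "(=)"] measurable_snd_coordinate)
    moreover have "Measurable.pred (M \<Otimes>\<^sub>M borel) (\<lambda>w. fst w \<in> wf_set)"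
      using assms by measurable
    ultimately show ?thesis unfolding Q_def by measurable
  qed
  define R where "R = {w. ev w \<in> B \<and> (\<psi> (ev w), od w) \<in> Q}"
  have "R \<in> sets borel" unfolding R_def by (rule sets_ev_pullback[OF B \<psi> \<open>Q \<in> _\<close>])
  from closed_image_borel[OF this]
  obtain Z :: "(nat \<Rightarrow> nat) set" and g :: "(nat \<Rightarrow> nat) \<Rightarrow> nat \<Rightarrow> nat"
    where Z: "closed Z" "continuous_on Z g" "R = g ` Z"
    unfolding closed_image_def by auto
  define X where "X z = \<psi> (ev (g z))" for z
  have *: "X z \<in> wf_set \<and> node_code (X z) = od (g z)" if "z \<in> Z" for z
  proof -
    have "g z \<in> R" using that Z by blast
    then show ?thesis by (auto simp: R_def Q_def X_def)
  qed
  have "continuous_on Z (\<lambda>z. od (g z))"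
    by (rule continuous_on_compose2[OF continuous_on_od[of UNIV] Z(2)]) auto
  then have "continuous_on Z (\<lambda>z. node_code (X z))"
    using * by (simp cong: continuous_on_cong)
  moreover have "X ` Z = wf_set"
  proof (intro subset_antisym subsetI)
    fix x assume x: "x \<in> wf_set"
    then have xs: "x \<in> space M" by (simp add: wf_set_def)
    have "join (\<phi> x) (node_code x) \<in> R"
      using x xs inv spc by (auto simp: R_def Q_def space_pair_measure)
    then obtain z where "z \<in> Z" "g z = join (\<phi> x) (node_code x)" using Z(3) by auto
    then have "X z = x" "z \<in> Z" using inv xs by (simp_all add: X_def)
    then show "x \<in> X ` Z" by blast
  qed (use * in auto)
  ultimately show ?thesis using that Z(1) by blast
qed

text \<open>Boundedness for an analytic set of well-founded trees. A branch through
  \<open>S n\<close> would yield parameters converging to a point of the closed set \<open>Z\<close>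
  and, by continuity of \<open>node_code\<close>, a branch through the tree at that limit.\<close>

lemma bounded_if_sets_wf_set:
  assumes "wf_set \<in> sets M"
  shows "(SUP x\<in>wf_set. rank x) < \<omega>\<^sub>1"
proof -
  obtain Z :: "(nat \<Rightarrow> nat) set" and X where Z: "closed Z" "X ` Z = wf_set"
    and cont: "continuous_on Z (\<lambda>z. node_code (X z))"
    using ex_clopen_parametrization[OF assms] by metis
  have XZ: "X z \<in> wf_set" "X z \<in> space M" if "z \<in> Z" for z
    using Z(2) that by (auto simp: wf_set_def)
  \<comment> \<open>The parameter \<open>z\<close> may change from node to node; a node keeps only
    as many of its values as it has entries.\<close>
  define S where "S n = {u :: (nat \<times> nat) list.
      \<exists>z\<in>Z. map fst u = map z [0..<length u] \<and> map snd u \<in> tr (X z) n}" for n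
  have tree_S: "is_tree (S n)" for n
    unfolding is_tree_def
  proof (intro ballI allI impI)
    fix u v assume "u \<in> S n" "prefix v u"
    then obtain z t where z: "z \<in> Z" "map fst u = map z [0..<length u]" "map snd u \<in> tr (X z) n"
      and u: "u = v @ t" by (auto simp: S_def prefix_def)
    have "map fst v = take (length v) (map fst u)" by (simp add: u)
    also have "\<dots> = map z [0..<length v]" unfolding z(2) by (simp add: take_map u)
    finally have "map fst v = map z [0..<length v]" .
    moreover have "map snd v \<in> tr (X z) n"
      using is_treeD[OF tree[OF XZ(2)[OF z(1)]] z(3)] by (simp add: u)
    ultimately show "v \<in> S n" using z(1) by (auto simp: S_def)
  qed
  have "\<not> has_branch (S n)" for n
  proof
    assume "has_branch (S n)"
    then obtain b where b: "\<And>k. map b [0..<k] \<in> S n" unfolding has_branch_def by blast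
    let ?z = "\<lambda>i. fst (b i)" and ?s = "\<lambda>i. snd (b i)"
    have "\<forall>k. \<exists>z. z \<in> Z \<and> map ?z [0..<k] = map z [0..<k] \<and> map ?s [0..<k] \<in> tr (X z) n"
      using b by (auto simp: S_def comp_def)
    then obtain y where y: "\<And>k. y k \<in> Z" "\<And>k. map ?z [0..<k] = map (y k) [0..<k]"
        "\<And>k. map ?s [0..<k] \<in> tr (X (y k)) n"
      by metis
    have "(\<lambda>k. y k i) \<longlonglongrightarrow> ?z i" for i
    proof -
      have "eventually (\<lambda>k. y k i = ?z i) sequentially"
        using eventually_gt_at_top[of i]
      proof eventually_elim
        case (elim k) then show ?case using y(2)[of k] by (auto simp: map_eq_conv)
      qed
      then show ?thesis by (rule tendsto_eventually)
    qed
    then have "limitin (product_topology (\<lambda>_. euclidean) UNIV) y ?z sequentially"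
      unfolding limitin_componentwise by simp
    then have lim: "y \<longlonglongrightarrow> ?z" by (simp add: euclidean_product_topology)
    have zZ: "?z \<in> Z" using closed_sequentially[OF Z(1) y(1) lim] .
    have "(\<lambda>k. node_code (X (y k)) i) \<longlonglongrightarrow> node_code (X ?z) i" for i
      using continuous_on_tendsto_compose[OF continuous_on_product_then_coordinatewise[OF cont] lim zZ]
        y(1) by simp
    then have ev: "eventually (\<lambda>k. node_code (X (y k)) i = node_code (X ?z) i) sequentially" for i
      by (simp add: tendsto_discrete)
    have "map ?s [0..<j] \<in> tr (X ?z) n" for j
    proof -
      have "eventually (\<lambda>k. node_code (X (y k)) (to_nat (n, map ?s [0..<j])) = 1) sequentially"
        using eventually_ge_at_top[of j]
      proof eventually_elim
        case (elim k)
        have "prefix (map ?s [0..<j]) (map ?s [0..<k])"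
          using elim by (metis le_add_diff_inverse map_append prefixI upt_add_eq_append zero_le)
        then have "map ?s [0..<j] \<in> tr (X (y k)) n"
          using is_treeD[OF tree[OF XZ(2)[OF y(1)]] y(3)] by blast
        then show ?case by (simp only: node_code_eq_1)
      qed
      with ev[of "to_nat (n, map ?s [0..<j])"]
      have "eventually (\<lambda>k. node_code (X ?z) (to_nat (n, map ?s [0..<j])) = 1) sequentially"
        by eventually_elim simp
      then show ?thesis by (simp only: node_code_eq_1 eventually_const sequentially_bot not_False_eq_True)
    qed
    then have "has_branch (tr (X ?z) n)" unfolding has_branch_def by blast
    then show False using XZ(1)[OF zZ] by (simp add: wf_set_def)
  qed
  then have S: "tree_height (S n) < \<omega>\<^sub>1" for n
    using tree_height_less_omega1_iff[OF tree_S] by blast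
  have "rank x \<le> (SUP n. tree_height (S n))" if "x \<in> wf_set" for x
  proof -
    obtain z where z: "z \<in> Z" "X z = x" using Z(2) \<open>x \<in> wf_set\<close> by (metis imageE)
    \<comment> \<open>Fixing one parameter \<open>z\<close> of \<open>x\<close> and attaching its
      values to the nodes maps every tree of \<open>x\<close> into the common tree.\<close>
    have "tree_map (tr x n) (S n) (\<lambda>s. zip (map z [0..<length s]) s)" for n
      unfolding tree_map_def
    proof (intro ballI conjI impI)
      fix s assume s: "s \<in> tr x n"
      show "zip (map z [0..<length s]) s \<in> S n"
        using s z by (auto simp: S_def intro!: bexI[of _ z])
      fix t assume "strict_prefix s t"
      then obtain u where "t = s @ u" "u \<noteq> []" by (auto simp: strict_prefix_def prefix_def)
      then show "strict_prefix (zip (map z [0..<length s]) s) (zip (map z [0..<length t]) t)"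
        by (auto simp: strict_prefix_def prefix_def upt_add_eq_append[of 0, simplified] zip_append
            dest: arg_cong[of _ _ length])
    qed
    then have "tree_height (tr x n) \<le> tree_height (S n)" for n
      using tree_map_height_le[OF _ tree[OF XZ(2)[OF z(1)]] tree_S] z(2) by blast
    then show ?thesis unfolding rank_def by (intro SUP_mono) blast
  qed
  then have "(SUP x\<in>wf_set. rank x) \<le> (SUP n. tree_height (S n))" by (rule SUP_least)
  also have "\<dots> < \<omega>\<^sub>1" by (rule Sup_less_omega1) (auto simp: S)
  finally show ?thesis .
qed

end

section \<open>Ultrapowers and Cesaro means\<close>

lemma blinfun_funpow_apply:
  fixes T :: "'a::real_normed_vector \<Rightarrow>\<^sub>L 'a"
  shows "blinfun_apply (((o\<^sub>L) T ^^ k) id_blinfun) x = (blinfun_apply T ^^ k) x"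
  by (induction k) (simp_all add: id_blinfun.rep_eq)

lemma cesaro_apply: "cesaro T n x = (1 / real n) *\<^sub>R (\<Sum>k<n. (blinfun_apply T ^^ k) x)"
  by (simp add: cesaro_def blinfun.scaleR_left blinfun.sum_left blinfun_funpow_apply)

text \<open>Membership in the tree is witnessed node by node, so the point \<open>x\<close> may
  depend on \<open>k\<close>.\<close>

lemma has_branch_ergodic_treeI:
  assumes "strict_mono z" "\<And>i. z i \<ge> 1"
    "\<And>k. \<exists>x\<in>cball 0 1. \<forall>p<k. norm (cesaro T (z p) x - cesaro T (z (Suc p)) x) > \<epsilon>"
  shows "has_branch (ergodic_tree T \<epsilon>)"
proof -
  have "map z [0..<k] \<in> ergodic_tree T \<epsilon>" for k
  proof -
    obtain x where x: "x \<in> cball 0 1" "\<And>p. p < k \<Longrightarrow> norm (cesaro T (z p) x - cesaro T (z (Suc p)) x) > \<epsilon>"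
      using assms(3)[of k] by blast
    have "sorted_wrt (<) (map z [0..<k])"
      using assms(1) by (auto simp: sorted_wrt_iff_nth_less strict_mono_def)
    then show ?thesis
      using x assms(2) by (auto simp: ergodic_tree_def intro!: bexI[of _ x])
  qed
  then show ?thesis unfolding has_branch_def by blast
qed

lemma has_branch_ergodic_treeE:
  assumes "has_branch (ergodic_tree T \<epsilon>)"
  obtains z x where "strict_mono z" "\<forall>k. x k \<in> cball 0 1"
    "\<forall>k. \<forall>p<k. norm (cesaro T (z p) (x k) - cesaro T (z (Suc p)) (x k)) > \<epsilon>"
proof -
  obtain z where z: "\<And>k. map z [0..<k] \<in> ergodic_tree T \<epsilon>"
    using assms unfolding has_branch_def by blast
  have "z i < z (Suc i)" for i
    using z[of "Suc (Suc i)"] by (auto simp: ergodic_tree_def sorted_wrt_append)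
  then have "strict_mono z" by (simp add: strict_mono_Suc_iff)
  \<comment> \<open>A node of length \<open>Suc k\<close> carries \<open>k\<close> gaps; at
    \<open>k = 0\<close> there is none, and any point of the ball will do.\<close>
  have "\<exists>x. x \<in> cball 0 1 \<and> (\<forall>p<k. norm (cesaro T (z p) x - cesaro T (z (Suc p)) x) > \<epsilon>)" for k
  proof (cases "k = 0")
    case True then show ?thesis by (intro exI[of _ 0]) simp
  next
    case False
    then obtain x where x: "x \<in> cball 0 1" "\<And>p. Suc p < length (map z [0..<Suc k]) \<Longrightarrow>
        norm (cesaro T (map z [0..<Suc k] ! p) x - cesaro T (map z [0..<Suc k] ! Suc p) x) > \<epsilon>"
      using z[of "Suc k"] unfolding ergodic_tree_def by (auto simp del: upt_Suc)
    have "norm (cesaro T (z p) x - cesaro T (z (Suc p)) x) > \<epsilon>" if "p < k" for p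
      using x(2)[of p] that by (simp add: nth_append del: upt_Suc)
    then show ?thesis using x(1) by blast
  qed
  then obtain x where "\<forall>k. x k \<in> cball 0 1"
      "\<forall>k. \<forall>p<k. norm (cesaro T (z p) (x k) - cesaro T (z (Suc p)) (x k)) > \<epsilon>"
    by metis
  then show ?thesis using that \<open>strict_mono z\<close> by blast
qed

text \<open>A gliding hump argument in place of the uniform boundedness principle.\<close>

lemma bounded_cesaro:
  fixes T :: "'a::banach \<Rightarrow>\<^sub>L 'a"
  assumes "\<not> has_branch (ergodic_tree T 1)"
  obtains M where "M > 0" "\<And>n. norm (cesaro T n) \<le> M"
proof (rule ccontr)
  note bounded = that
  assume not: "\<not> thesis"
  have unbdd: "\<exists>n. norm (cesaro T n) > M" if "M > 0" for M
    using bounded[OF that] not by (metis not_le)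
  have large: "\<exists>n'>n. norm (cesaro T n - cesaro T n') > M" for n M
  proof -
    \<comment> \<open>The sum bounds the norms of all means up to \<open>n\<close>: exceeding it
      forces \<open>n' > n\<close>, and subtracting \<open>cesaro T n\<close> still leaves more than
      \<open>M\<close>.\<close>
    let ?K = "\<bar>M\<bar> + 1 + 2 * (\<Sum>i\<le>n. norm (cesaro T i))"
    have s: "(\<Sum>i\<le>n. norm (cesaro T i)) \<ge> 0" by (intro sum_nonneg) simp
    have le: "norm (cesaro T i) \<le> (\<Sum>i\<le>n. norm (cesaro T i))" if "i \<le> n" for i
      using that by (intro member_le_sum) auto
    obtain n' where n': "norm (cesaro T n') > ?K"
      using unbdd[of ?K] s by force
    then have "n' > n" using le[of n'] s by (intro not_le_imp_less notI) simp
    moreover have "norm (cesaro T n - cesaro T n') > M"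
      using n' le[of n] s norm_triangle_ineq2[of "cesaro T n'" "cesaro T n"]
      by (simp add: norm_minus_commute)
    ultimately show ?thesis by blast
  qed
  \<comment> \<open>A state is an index together with a ball inside the unit ball; each step passes
    to a subball on which the new gap exceeds 1 at every point.\<close>
  define ok where "ok \<sigma> \<longleftrightarrow> (case \<sigma> of (n, y, r) \<Rightarrow> n \<ge> 1 \<and> r > 0 \<and> cball y r \<subseteq> cball (0::'a) 1)"
    for \<sigma> :: "nat \<times> 'a \<times> real"
  define step where "step \<sigma> \<tau> \<longleftrightarrow> (case \<sigma> of (n, y, r) \<Rightarrow> case \<tau> of (n', y', r') \<Rightarrow>
      n < n' \<and> cball y' r' \<subseteq> cball y r \<and> (\<forall>v\<in>cball y' r'. norm (cesaro T n v - cesaro T n' v) > 1))"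
    for \<sigma> \<tau> :: "nat \<times> 'a \<times> real"
  have "\<exists>f. \<forall>k. ok (f k) \<and> step (f k) (f (Suc k))"
  proof (rule dependent_nat_choice)
    show "\<exists>\<sigma>. ok \<sigma>" by (rule exI[of _ "(1, 0, 1)"]) (simp add: ok_def)
    fix \<sigma> and k :: nat assume "ok \<sigma>"
    then obtain n y r where \<sigma>: "\<sigma> = (n, y, r)" "n \<ge> 1" "r > 0" "cball y r \<subseteq> cball 0 1"
      by (cases \<sigma>) (auto simp: ok_def)
    \<comment> \<open>The factor 4 yields \<open>w\<close> of norm \<open>r / 2\<close> with image
      of norm above 2; of this, 1 is given up for the radius of the new ball and a gap above 1
      remains.\<close>
    obtain n' where n': "n < n'" "norm (cesaro T n - cesaro T n') > 4 / r" using large by blast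
    define S where "S = cesaro T n - cesaro T n'"
    have "\<exists>u. norm (S u) > 4 / r * norm u"
    proof (rule ccontr)
      assume "\<nexists>u. norm (S u) > 4 / r * norm u"
      then have "norm S \<le> 4 / r" using \<sigma>(3) by (intro norm_blinfun_bound) (auto simp: not_less)
      then show False using n'(2) by (simp add: S_def)
    qed
    then obtain u where u: "norm (S u) > 4 / r * norm u" by blast
    then have "u \<noteq> 0" by auto
    define w where "w = (r / (2 * norm u)) *\<^sub>R u"
    have w: "norm w = r / 2" using \<open>u \<noteq> 0\<close> \<sigma>(3) by (simp add: w_def)
    have Sw: "norm (S w) > 2"
    proof -
      have "norm (S w) = r / (2 * norm u) * norm (S u)"
        using \<sigma>(3) by (simp add: w_def blinfun.scaleR_right)
      also have "\<dots> > r / (2 * norm u) * (4 / r * norm u)"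
        using u \<open>u \<noteq> 0\<close> \<sigma>(3) by (intro mult_strict_left_mono) auto
      also have "r / (2 * norm u) * (4 / r * norm u) = 2" using \<open>u \<noteq> 0\<close> \<sigma>(3) by simp
      finally show ?thesis .
    qed
    \<comment> \<open>The images of \<open>y + w\<close> and \<open>y - w\<close> differ by
      \<open>2 *\<^sub>R S w\<close>, so one of them has norm above 2.\<close>
    obtain y' where y': "norm (y' - y) = r / 2" "norm (S y') > 2"
    proof -
      have "2 *\<^sub>R S w = S (y + w) - S (y - w)"
        by (simp add: blinfun.add_right blinfun.diff_right scaleR_2)
      then have "2 * norm (S w) \<le> norm (S (y + w)) + norm (S (y - w))"
        using norm_triangle_ineq4[of "S (y + w)" "S (y - w)"]
        by (metis abs_numeral norm_scaleR)
      then have "norm (S (y + w)) > 2 \<or> norm (S (y - w)) > 2"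
        using Sw by linarith
      then show ?thesis using that[of "y + w"] that[of "y - w"] w by auto
    qed
    define r' where "r' = min (r / 2) (1 / (norm S + 1))"
    have r': "r' > 0" "r' \<le> r / 2" "norm S * r' \<le> 1"
    proof -
      have pos: "norm S + 1 > 0" using norm_ge_zero[of S] by linarith
      then show "r' > 0" using \<sigma>(3) by (simp add: r'_def)
      have "norm S * r' \<le> norm S * (1 / (norm S + 1))" by (intro mult_left_mono) (auto simp: r'_def)
      also have "\<dots> \<le> 1" using pos by (simp add: divide_le_eq)
      finally show "norm S * r' \<le> 1" .
    qed (simp add: r'_def)
    have sub: "cball y' r' \<subseteq> cball y r"
    proof
      fix v assume "v \<in> cball y' r'"
      then show "v \<in> cball y r"
        using y'(1) r'(2) dist_triangle[of y v y'] by (simp add: dist_norm norm_minus_commute)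
    qed
    have "norm (cesaro T n v - cesaro T n' v) > 1" if "v \<in> cball y' r'" for v
    proof -
      have "norm (S (y' - v)) \<le> norm S * norm (y' - v)" by (rule norm_blinfun)
      also have "\<dots> \<le> norm S * r'" using that by (intro mult_left_mono) (auto simp: dist_norm)
      finally have "norm (S y' - S v) \<le> 1"
        using r'(3) by (simp add: blinfun.diff_right)
      then have "norm (S v) > 1"
        using y'(2) norm_triangle_ineq2[of "S y'" "S v"] by linarith
      then show ?thesis by (simp add: S_def blinfun.diff_left)
    qed
    then have "ok (n', y', r') \<and> step \<sigma> (n', y', r')"
      using \<sigma> n'(1) r'(1) sub by (auto simp: ok_def step_def)
    then show "\<exists>\<tau>. ok \<tau> \<and> step \<sigma> \<tau>" by blast
  qed
  then obtain f where f: "\<And>k. ok (f k)" "\<And>k. step (f k) (f (Suc k))" by blast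
  define z y r where "z k = fst (f k)" and "y k = fst (snd (f k))" and "r k = snd (snd (f k))" for k
  have ok: "z k \<ge> 1" "r k > 0" "cball (y k) (r k) \<subseteq> cball 0 1" for k
    using f(1)[of k] by (auto simp: ok_def z_def y_def r_def split: prod.splits)
  have step: "z k < z (Suc k)" "cball (y (Suc k)) (r (Suc k)) \<subseteq> cball (y k) (r k)"
    "\<And>v. v \<in> cball (y (Suc k)) (r (Suc k)) \<Longrightarrow> norm (cesaro T (z k) v - cesaro T (z (Suc k)) v) > 1" for k
    using f(2)[of k] by (auto simp: step_def z_def y_def r_def split: prod.splits)
  have mono: "cball (y k) (r k) \<subseteq> cball (y j) (r j)" if "j \<le> k" for j k
    using that by (induction k rule: dec_induct) (use step(2) in blast)+
  have "has_branch (ergodic_tree T 1)"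
  proof (rule has_branch_ergodic_treeI)
    show "strict_mono z" by (simp add: strict_mono_Suc_iff step)
    show "z i \<ge> 1" for i by (rule ok)
    fix k
    \<comment> \<open>The nested balls make the centre \<open>y k\<close> a common witness of the
      first \<open>k\<close> gaps.\<close>
    have yk: "y k \<in> cball (y k) (r k)" using ok(2)[of k] by simp
    have "norm (cesaro T (z p) (y k) - cesaro T (z (Suc p)) (y k)) > 1" if "p < k" for p
      by (rule step(3)) (use yk mono[of "Suc p" k] that in \<open>simp del: mem_cball; blast\<close>)
    moreover have "y k \<in> cball 0 1" using ok(3)[of k] yk by blast
    ultimately show "\<exists>x\<in>cball 0 1. \<forall>p<k. norm (cesaro T (z p) x - cesaro T (z (Suc p)) x) > 1"
      by blast
  qed
  then show False using assms by blast
qed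

text \<open>Zorn's lemma yields a minimal proper filter below \<open>sequentially\<close>. If the
  negation of \<open>P\<close> is not eventual, the meet with the principal filter of
  \<open>P\<close> stays proper, and minimality makes \<open>P\<close> eventual.\<close>

lemma ex_free_ultrafilter: "\<exists>\<U>. ultrafilter \<U> \<and> \<U> \<le> (sequentially :: nat filter)"
proof -
  let ?S = "{F :: nat filter. F \<noteq> bot \<and> F \<le> sequentially}"
  let ?r = "{(F, G). F \<in> ?S \<and> G \<in> ?S \<and> G \<le> F}"
  have Field: "Field ?r = ?S" by (auto simp: Field_def)
  have "\<exists>U\<in>Field ?r. \<forall>F\<in>Field ?r. (U, F) \<in> ?r \<longrightarrow> F = U"
  proof (rule Zorns_po_lemma)
    show "Partial_order ?r"
      unfolding order_on_defs Field
      by (auto simp: refl_on_def trans_def antisym_def Field intro: order_trans)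
    fix \<C> assume chain: "\<C> \<in> Chains ?r"
    show "\<exists>u\<in>Field ?r. \<forall>F\<in>\<C>. (F, u) \<in> ?r"
    proof (cases "\<C> = {}")
      case True
      have "sequentially \<in> ?S" by simp
      then show ?thesis using True Field by blast
    next
      case False
      have sub: "\<C> \<subseteq> ?S" using chain by (auto simp: Chains_def)
      have "Inf \<C> \<noteq> bot"
      proof (rule Inf_filter_not_bot)
        fix X assume X: "X \<subseteq> \<C>" "finite X"
        show "Inf X \<noteq> bot"
        proof (cases "X = {}")
          case True
          have "(top :: nat filter) \<noteq> bot" by (metis sequentially_bot bot_unique top_greatest)
          then show ?thesis using True by simp
        next
          case False
          have "\<exists>F\<in>X. \<forall>G\<in>X. F \<le> G"
            using X(2) False X(1)
          proof (induction X rule: finite_ne_induct)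
            case (insert F X)
            then obtain G where G: "G \<in> X" "\<forall>H\<in>X. G \<le> H" by auto
            have "(F, G) \<in> ?r \<or> (G, F) \<in> ?r" using insert(5) G(1) chain by (auto simp: Chains_def)
            then have "F \<le> G \<or> G \<le> F" by blast
            then show ?case using G by (auto intro: order_trans)
          qed simp
          then obtain F where "F \<in> X" "\<forall>G\<in>X. F \<le> G" by blast
          then have "Inf X = F" by (simp add: Inf_eqI)
          then show ?thesis using \<open>F \<in> X\<close> X sub by auto
        qed
      qed
      moreover have "Inf \<C> \<le> sequentially"
        using False sub by (auto intro: Inf_lower2)
      ultimately have "Inf \<C> \<in> Field ?r" unfolding Field by simp
      then show ?thesis using sub unfolding Field by (auto intro!: bexI[of _ "Inf \<C>"] Inf_lower)
    qed
  qed
  then obtain U where U: "U \<noteq> bot" "U \<le> sequentially"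
    and min: "\<And>F. F \<noteq> bot \<Longrightarrow> F \<le> U \<Longrightarrow> F = U"
    unfolding Field by (auto intro: order_trans)
  have "eventually P U \<or> eventually (\<lambda>i. \<not> P i) U" for P
  proof (rule disjCI)
    assume n: "\<not> eventually (\<lambda>i. \<not> P i) U"
    let ?F = "inf U (principal {i. P i})"
    have "?F \<noteq> bot"
      using n by (auto simp: trivial_limit_def eventually_inf_principal)
    then have "?F = U" by (intro min) auto
    moreover have "eventually P ?F" by (simp add: eventually_inf_principal)
    ultimately show "eventually P U" by simp
  qed
  then show ?thesis using U unfolding ultrafilter_def by blast
qed

section \<open>Calculus of cosets in an ultrapower\<close>

definition bmap :: "('a::banach \<Rightarrow> 'a) \<Rightarrow> (nat \<Rightarrow>\<^sub>C 'a) \<Rightarrow> nat \<Rightarrow>\<^sub>C 'a" where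
  "bmap \<phi> f = Bcontfun (\<lambda>n. \<phi> (apply_bcontfun f n))"

lemma apply_Bcontfun:
  fixes g :: "nat \<Rightarrow> 'a::real_normed_vector"
  assumes "\<And>k. norm (g k) \<le> C"
  shows "apply_bcontfun (Bcontfun g) k = g k"
proof -
  have "g \<in> bcontfun"
    using assms by (auto simp: bcontfun_def bounded_iff continuous_on_open_invariant open_discrete)
  then show ?thesis by (simp add: Bcontfun_inverse)
qed

lemma bmap_apply [simp]: assumes "bounded_linear \<phi>" shows "apply_bcontfun (bmap \<phi> f) k = \<phi> (apply_bcontfun f k)"
proof -
  obtain C where C: "\<And>x. norm (\<phi> x) \<le> norm x * C" "C > 0"
    using bounded_linear.pos_bounded[OF assms] by blast
  have "norm (\<phi> (apply_bcontfun f k)) \<le> norm f * C" for k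
    by (rule order_trans[OF C(1)]) (use C(2) norm_bounded in \<open>intro mult_right_mono; simp\<close>)
  then show ?thesis unfolding bmap_def by (rule apply_Bcontfun)
qed

lemma ultra_null_iff:
  "f \<in> ultra_null \<U> \<longleftrightarrow> (\<forall>e>0. eventually (\<lambda>k. norm (f k) < e) \<U>)"
  by (simp add: ultra_null_def tendsto_iff dist_norm)

lemma ultra_null_le_iff:
  "f \<in> ultra_null \<U> \<longleftrightarrow> (\<forall>e>0. eventually (\<lambda>k. norm (f k) \<le> e) \<U>)"
  unfolding ultra_null_iff
proof (intro iffI allI impI)
  fix e :: real assume *: "\<forall>e>0. eventually (\<lambda>k. norm (f k) \<le> e) \<U>" and "e > 0"
  then have "eventually (\<lambda>k. norm (f k) \<le> e / 2) \<U>" using *[rule_format, of "e / 2"] by simp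
  then show "eventually (\<lambda>k. norm (f k) < e) \<U>"
    by eventually_elim (use \<open>e > 0\<close> in linarith)
qed (auto elim!: eventually_mono intro: less_imp_le)

lemma subspace_ultra_null: "subspace (ultra_null \<U> :: (nat \<Rightarrow>\<^sub>C 'a::banach) set)"
  unfolding subspace_def
proof (intro conjI ballI allI)
  show "0 \<in> ultra_null \<U>" by (simp add: ultra_null_def)
  fix f g :: "nat \<Rightarrow>\<^sub>C 'a" assume "f \<in> ultra_null \<U>" "g \<in> ultra_null \<U>"
  then have f: "((\<lambda>k. f k) \<longlongrightarrow> 0) \<U>" and g: "((\<lambda>k. g k) \<longlongrightarrow> 0) \<U>"
    by (auto simp: ultra_null_def tendsto_norm_zero_iff)
  show "f + g \<in> ultra_null \<U>"
    using tendsto_add_zero[OF f g] by (simp add: ultra_null_def tendsto_norm_zero_iff)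
  show "c *\<^sub>R f \<in> ultra_null \<U>" for c
    using tendsto_scaleR[OF tendsto_const f, of c] by (simp add: ultra_null_def tendsto_norm_zero_iff)
qed

lemmas ultra_null_closed = subspace_0[OF subspace_ultra_null] subspace_add[OF subspace_ultra_null]
  subspace_diff[OF subspace_ultra_null] subspace_neg[OF subspace_ultra_null]

lemma mem_ultra_coset: "g \<in> ultra_coset \<U> f \<longleftrightarrow> g - f \<in> ultra_null \<U>"
  unfolding ultra_coset_def by (auto simp: image_iff intro: bexI[of _ "g - f"])

lemma self_mem_ultra_coset: "f \<in> ultra_coset \<U> f"
  by (simp add: mem_ultra_coset ultra_null_closed)

lemma ultra_coset_eq_iff: "ultra_coset \<U> f = ultra_coset \<U> g \<longleftrightarrow> f - g \<in> ultra_null \<U>"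
proof
  assume "ultra_coset \<U> f = ultra_coset \<U> g"
  then show "f - g \<in> ultra_null \<U>" using self_mem_ultra_coset[of f \<U>] mem_ultra_coset by blast
next
  assume *: "f - g \<in> ultra_null \<U>"
  have "h - f \<in> ultra_null \<U> \<longleftrightarrow> h - g \<in> ultra_null \<U>" for h
    using ultra_null_closed(2)[OF _ *, of "h - f"] ultra_null_closed(3)[OF _ *, of "h - g"] by auto
  then show "ultra_coset \<U> f = ultra_coset \<U> g" by (auto simp: mem_ultra_coset)
qed

lemma ultra_coset_cong: "g \<in> ultra_coset \<U> f \<Longrightarrow> ultra_coset \<U> g = ultra_coset \<U> f"
  by (simp add: ultra_coset_eq_iff mem_ultra_coset)

lemma ultra_add_coset: "ultra_add (ultra_coset \<U> f) (ultra_coset \<U> g) = ultra_coset \<U> (f + g)"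
proof (intro subset_antisym subsetI)
  fix h assume "h \<in> ultra_add (ultra_coset \<U> f) (ultra_coset \<U> g)"
  then obtain f' g' where "h = f' + g'" "f' - f \<in> ultra_null \<U>" "g' - g \<in> ultra_null \<U>"
    by (auto simp: ultra_add_def mem_ultra_coset)
  then show "h \<in> ultra_coset \<U> (f + g)"
    using ultra_null_closed(2)[of "f' - f" \<U> "g' - g"] by (simp add: mem_ultra_coset algebra_simps)
next
  fix h assume "h \<in> ultra_coset \<U> (f + g)"
  then have "f \<in> ultra_coset \<U> f" "h - f \<in> ultra_coset \<U> g" "h = f + (h - f)"
    by (auto simp: mem_ultra_coset ultra_null_closed algebra_simps)
  then show "h \<in> ultra_add (ultra_coset \<U> f) (ultra_coset \<U> g)" unfolding ultra_add_def by blast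
qed

lemma ultra_diff_coset: "ultra_diff (ultra_coset \<U> f) (ultra_coset \<U> g) = ultra_coset \<U> (f - g)"
proof (intro subset_antisym subsetI)
  fix h assume "h \<in> ultra_diff (ultra_coset \<U> f) (ultra_coset \<U> g)"
  then obtain f' g' where h: "h = f' - g'" and *: "f' - f \<in> ultra_null \<U>" "g' - g \<in> ultra_null \<U>"
    by (auto simp: ultra_diff_def mem_ultra_coset)
  have "h - (f - g) = f' - f - (g' - g)" by (simp add: h)
  then show "h \<in> ultra_coset \<U> (f - g)"
    using ultra_null_closed(3)[OF *] by (simp only: mem_ultra_coset)
next
  fix h assume "h \<in> ultra_coset \<U> (f - g)"
  then have "h + g \<in> ultra_coset \<U> f" "g \<in> ultra_coset \<U> g" "h = h + g - g"
    by (auto simp: mem_ultra_coset ultra_null_closed algebra_simps)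
  then show "h \<in> ultra_diff (ultra_coset \<U> f) (ultra_coset \<U> g)" unfolding ultra_diff_def by blast
qed

lemma bmap_ultra_null:
  assumes "bounded_linear \<phi>" "f \<in> ultra_null \<U>"
 shows "bmap \<phi> f \<in> ultra_null \<U>"
proof -
  have "apply_bcontfun (bmap \<phi> f) = (\<lambda>k. \<phi> (f k))" using assms(1) by auto
  then show ?thesis
    using assms(2) bounded_linear.tendsto_zero[OF assms(1)]
    by (simp add: ultra_null_def tendsto_norm_zero_iff)
qed

lemma bmap_diff: "bounded_linear \<phi> \<Longrightarrow> bmap \<phi> (f - g) = bmap \<phi> f - bmap \<phi> g"
  by (rule bcontfun_eqI) (simp add: linear_diff bounded_linear.linear)

lemma ultra_map_coset:
  assumes "bounded_linear \<phi>"
  shows "ultra_map \<U> \<phi> (ultra_coset \<U> f) = ultra_coset \<U> (bmap \<phi> f)"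
proof -
  have "ultra_coset \<U> (bmap \<phi> g) = ultra_coset \<U> (bmap \<phi> f)" if "g \<in> ultra_coset \<U> f" for g
    using bmap_ultra_null[OF assms, of "g - f"] that
    by (simp add: ultra_coset_eq_iff mem_ultra_coset bmap_diff assms)
  then show ?thesis
    unfolding ultra_map_def bmap_def[symmetric] using self_mem_ultra_coset by blast
qed

lemma foldr_ultra_add:
  "foldr ultra_add (map (\<lambda>k. ultra_coset \<U> (a k)) ks) (ultra_null \<U>) = ultra_coset \<U> (\<Sum>k\<leftarrow>ks. a k)"
proof (induction ks)
  case Nil
  show ?case by (auto simp: mem_ultra_coset)
qed (simp add: ultra_add_coset)

lemma bounded_linear_funpow_blinfun:
  fixes T :: "'a::real_normed_vector \<Rightarrow>\<^sub>L 'a"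
  shows "bounded_linear (blinfun_apply T ^^ k)"
proof -
  have "blinfun_apply T ^^ k = blinfun_apply (((o\<^sub>L) T ^^ k) id_blinfun)"
    by (simp add: fun_eq_iff blinfun_funpow_apply)
  then show ?thesis by (simp add: blinfun.bounded_linear_right)
qed

lemma apply_bcontfun_sum: "apply_bcontfun (sum f A) k = (\<Sum>i\<in>A. apply_bcontfun (f i) k)"
  by (induction A rule: infinite_finite_induct) auto

text \<open>Powers, sums and scaling act on representatives, so a mean in the ultrapower is taken
  coordinatewise; all later estimates can then be made for representatives along
  \<open>\<U>\<close>.\<close>

lemma ultra_cesaro_coset:
  "ultra_cesaro \<U> (ultra_op \<U> T) n (ultra_coset \<U> f) = ultra_coset \<U> (bmap (cesaro T n) f)"
proof -
  have pow: "(ultra_op \<U> T ^^ k) (ultra_coset \<U> f) = ultra_coset \<U> (bmap (blinfun_apply T ^^ k) f)" for k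
  proof (induction k)
    case 0
    have "bmap (\<lambda>x. x) f = f" by (rule bcontfun_eqI) (simp add: bounded_linear_ident)
    then show ?case by (simp add: id_def)
  next
    case (Suc k)
    have "bmap T (bmap (blinfun_apply T ^^ k) f) = bmap (blinfun_apply T ^^ Suc k) f"
      using bounded_linear_funpow_blinfun[of "Suc k" T]
      by (intro bcontfun_eqI) (simp add: bounded_linear_funpow_blinfun blinfun.bounded_linear_right)
    moreover have "(ultra_op \<U> T ^^ Suc k) (ultra_coset \<U> f) =
        ultra_op \<U> T (ultra_coset \<U> (bmap (blinfun_apply T ^^ k) f))"
      using Suc by simp
    ultimately show ?case
      by (simp only: ultra_op_def ultra_map_coset blinfun.bounded_linear_right)
  qed
  have "bmap (scaleR (1 / real n)) (\<Sum>k\<leftarrow>[0..<n]. bmap (blinfun_apply T ^^ k) f) = bmap (cesaro T n) f"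
    by (rule bcontfun_eqI)
      (simp add: bounded_linear_scaleR_right blinfun.bounded_linear_right interv_sum_list_conv_sum_set_nat
        apply_bcontfun_sum bounded_linear_funpow_blinfun cesaro_apply atLeast0LessThan del: sum_list_upt)
  then show ?thesis
    unfolding ultra_cesaro_def ultra_scale_def pow
    by (simp add: foldr_ultra_add ultra_map_coset bounded_linear_scaleR_right)
qed

lemma bdd_below_norm: "bdd_below (norm ` A)"
  by (rule bdd_belowI[of _ 0]) auto

lemma ultra_norm_coset_nonneg: "ultra_norm (ultra_coset \<U> f) \<ge> 0"
  unfolding ultra_norm_def by (rule cINF_greatest) (use self_mem_ultra_coset in auto)

text \<open>A representative of norm below \<open>r\<close> differs from \<open>h\<close> by a null
  sequence, which is eventually smaller than the remaining slack.\<close>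

lemma eventually_norm_less:
  fixes h :: "nat \<Rightarrow>\<^sub>C 'a::banach"
  assumes "ultra_norm (ultra_coset \<U> h) < r"
  shows "eventually (\<lambda>k. norm (h k) < r) \<U>"
proof -
  obtain g where g: "g \<in> ultra_coset \<U> h" "norm g < r"
    using assms self_mem_ultra_coset[of h \<U>]
    unfolding ultra_norm_def by (subst (asm) cINF_less_iff) (auto intro: bdd_below_norm)
  then have "eventually (\<lambda>k. norm ((g - h) k) < r - norm g) \<U>"
    by (simp add: mem_ultra_coset ultra_null_iff)
  then show ?thesis
  proof eventually_elim
    case (elim k)
    then show ?case
      using norm_bounded[of g k] norm_triangle_ineq4[of "g k" "(g - h) k"]
      by simp
  qed
qed

text \<open>Setting \<open>h\<close> to 0 where its norm exceeds \<open>r\<close> changes it only on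
  a negligible set of coordinates, hence not its coset, and the truncated representative has norm at
  most \<open>r\<close>.\<close>

lemma ultra_norm_le:
  fixes h :: "nat \<Rightarrow>\<^sub>C 'a::banach"
  assumes "eventually (\<lambda>k. norm (h k) \<le> r) \<U>" "r \<ge> 0"
  shows "ultra_norm (ultra_coset \<U> h) \<le> r"
proof -
  let ?g = "\<lambda>k. if norm (h k) \<le> r then h k else 0"
  have g: "apply_bcontfun (Bcontfun ?g) k = ?g k" for k
    by (rule apply_Bcontfun[of _ r]) (use assms(2) in auto)
  have "eventually (\<lambda>k. apply_bcontfun (Bcontfun ?g - h) k = 0) \<U>"
    using assms(1) by eventually_elim (simp add: g)
  then have "Bcontfun ?g \<in> ultra_coset \<U> h"
    unfolding mem_ultra_coset ultra_null_iff by (auto elim: eventually_mono)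
  then have "ultra_norm (ultra_coset \<U> h) \<le> norm (Bcontfun ?g)"
    unfolding ultra_norm_def by (intro cINF_lower bdd_below_norm)
  also have "\<dots> \<le> r" by (rule norm_bound) (use assms(2) in \<open>auto simp: g\<close>)
  finally show ?thesis .
qed

text \<open>Real homogeneity holds because real scalars act through \<open>of_real\<close> and the
  field is commutative.\<close>

lemma banach_over_bounded_linear:
  assumes "banach_over smul" shows "bounded_linear (smul c)"
proof -
  interpret banach_over smul by fact
  show ?thesis
  proof (rule bounded_linear_intro[where K = "norm c"])
    show "smul c (r *\<^sub>R x) = r *\<^sub>R smul c x" for r x
      by (simp only: scale_of_real[symmetric] scale_scale mult.commute)
  qed (simp_all add: scale_right_distrib norm_scale mult.commute)
qed

lemma cesaro_smul:
  assumes "banach_over smul" "T \<in> ops smul"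
  shows "cesaro T n (smul c x) = smul c (cesaro T n x)"
proof -
  have "(blinfun_apply T ^^ k) (smul c x) = smul c ((blinfun_apply T ^^ k) x)" for k
    using assms(2) by (induction k) (auto simp: ops_def)
  then show ?thesis
    using bounded_linear.linear[OF banach_over_bounded_linear[OF assms(1), of c]]
    by (simp add: cesaro_apply linear_scale linear_sum)
qed

section \<open>Super-ergodicity and branches\<close>

lemma super_ergodic_imp_no_branch:
  assumes "super_ergodic smul T" "\<epsilon> > 0"
  shows "\<not> has_branch (ergodic_tree T \<epsilon>)"
proof
  assume "has_branch (ergodic_tree T \<epsilon>)"
  then obtain z x where z: "strict_mono z" and x: "\<forall>k. x k \<in> cball 0 1"
    and gap: "\<forall>k. \<forall>p<k. norm (cesaro T (z p) (x k) - cesaro T (z (Suc p)) (x k)) > \<epsilon>"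
    by (rule has_branch_ergodic_treeE)
  obtain \<U> :: "nat filter" where \<U>: "ultrafilter \<U>" "\<U> \<le> sequentially"
    using ex_free_ultrafilter by blast
  define f where "f = Bcontfun x"
  have f: "f k = x k" for k
    unfolding f_def by (rule apply_Bcontfun[of _ 1]) (use x in simp)
  obtain P where P: "ultra_bounded_linear \<U> smul P"
    and lim: "\<And>\<xi>. \<xi> \<in> ultrapower \<U> \<Longrightarrow>
      (\<lambda>n. ultra_norm (ultra_diff (ultra_cesaro \<U> (ultra_op \<U> T) n \<xi>) (P \<xi>))) \<longlonglongrightarrow> 0"
    using assms(1) \<U>(1) unfolding super_ergodic_def ultra_ergodic_def by blast
  have "ultra_coset \<U> f \<in> ultrapower \<U>" by (simp add: ultrapower_def)
  then have "P (ultra_coset \<U> f) \<in> ultrapower \<U>"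
    using P unfolding ultra_bounded_linear_def by blast
  then obtain g where g: "P (ultra_coset \<U> f) = ultra_coset \<U> g"
    unfolding ultrapower_def by blast
  have "(\<lambda>n. ultra_norm (ultra_coset \<U> (bmap (cesaro T n) f - g))) \<longlonglongrightarrow> 0"
    using lim[OF \<open>ultra_coset \<U> f \<in> _\<close>] by (simp add: g ultra_cesaro_coset ultra_diff_coset)
  then have "eventually (\<lambda>n. ultra_norm (ultra_coset \<U> (bmap (cesaro T n) f - g)) < \<epsilon> / 2) sequentially"
    using assms(2) by (intro order_tendstoD) auto
  then obtain N where N: "\<And>n. n \<ge> N \<Longrightarrow> ultra_norm (ultra_coset \<U> (bmap (cesaro T n) f - g)) < \<epsilon> / 2"
    by (auto simp: eventually_sequentially)
  have near: "eventually (\<lambda>k. norm (cesaro T n (x k) - g k) < \<epsilon> / 2) \<U>" if "n \<ge> N" for n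
    using eventually_norm_less[OF N[OF that]] by (simp add: blinfun.bounded_linear_right f)
  \<comment> \<open>The number \<open>N\<close> doubles as a position on the branch:
    \<open>z N\<close> and \<open>z (Suc N)\<close> are both beyond the threshold, and
    \<open>N < k\<close> is eventual because the ultrafilter is free.\<close>
  have "N \<le> z N" using strict_mono_imp_increasing[OF z] by simp
  moreover then have "N \<le> z (Suc N)" using strict_monoD[OF z, of N "Suc N"] by simp
  moreover have "eventually (\<lambda>k. N < k) \<U>"
    using eventually_gt_at_top[of N] \<U>(2) filter_leD by blast
  ultimately have "eventually (\<lambda>k. N < k \<and> norm (cesaro T (z N) (x k) - g k) < \<epsilon> / 2
      \<and> norm (cesaro T (z (Suc N)) (x k) - g k) < \<epsilon> / 2) \<U>"
    using near by (simp add: eventually_conj)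
  then have "eventually (\<lambda>k. False) \<U>"
  proof eventually_elim
    case (elim k)
    have "norm (cesaro T (z N) (x k) - cesaro T (z (Suc N)) (x k)) < \<epsilon> / 2 + \<epsilon> / 2"
      using dist_triangle_half_l[of "cesaro T (z N) (x k)" "g k" \<epsilon> "cesaro T (z (Suc N)) (x k)"] elim
      by (simp add: dist_norm)
    then show False using gap[rule_format, of N k] elim by simp
  qed
  then show False using \<U>(1) by (simp add: ultrafilter_def trivial_limit_def)
qed

context
  fixes smul :: "'k::real_normed_field \<Rightarrow> 'a::banach \<Rightarrow> 'a" and T :: "'a \<Rightarrow>\<^sub>L 'a" and \<U> :: "nat filter"
  assumes banach: "banach_over smul" and T: "T \<in> ops smul" and \<U>: "ultrafilter \<U>"
    and no_branch: "\<And>\<epsilon>. \<epsilon> > 0 \<Longrightarrow> \<not> has_branch (ergodic_tree T \<epsilon>)"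
begin

abbreviation mean :: "nat \<Rightarrow> (nat \<Rightarrow>\<^sub>C 'a) \<Rightarrow> nat \<Rightarrow> 'a" where
  "mean n f k \<equiv> cesaro T n (f k)"

abbreviation close :: "nat \<Rightarrow> (nat \<Rightarrow>\<^sub>C 'a) \<Rightarrow> (nat \<Rightarrow>\<^sub>C 'a) \<Rightarrow> real \<Rightarrow> bool" where
  "close n f g e \<equiv> eventually (\<lambda>k. norm (mean n f k - g k) \<le> e) \<U>"

lemma \<U>_not_bot: "\<U> \<noteq> bot" using \<U> by (simp add: ultrafilter_def)

lemma not_eventually_le: "\<not> eventually (\<lambda>k. h k \<le> (r::real)) \<U> \<Longrightarrow> eventually (\<lambda>k. h k > r) \<U>"
  using \<U> by (auto simp: ultrafilter_def not_le)

text \<open>If this failed, every \<open>m\<close> would have a later \<open>m'\<close> at distance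
  above \<open>e / 2\<close> along \<open>\<U>\<close>, since indices within \<open>e / 2\<close> of
  \<open>m\<close> are within \<open>e\<close> of each other. After iteration, any finite number of
  gaps occurs at a common coordinate \<open>k\<close>, and \<open>f k\<close> scaled into the unit
  ball witnesses a node.\<close>

lemma eventually_Cauchy:
  assumes "e > 0"
  shows "\<exists>N. \<forall>m\<ge>N. \<forall>n\<ge>N.
    eventually (\<lambda>k. norm (mean m f k - mean n f k) \<le> e) \<U>"
proof (rule ccontr)
  let ?d = "\<lambda>m n k. norm (mean m f k - mean n f k)"
  assume not: "\<not> ?thesis"
  have step: "\<exists>m'>m. eventually (\<lambda>k. ?d m m' k > e / 2) \<U>" for m
  proof (rule ccontr)
    assume "\<not> (\<exists>m'>m. eventually (\<lambda>k. ?d m m' k > e / 2) \<U>)"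
    then have near: "eventually (\<lambda>k. ?d m m' k \<le> e / 2) \<U>" if "m' > m" for m'
      using not_eventually_le[of "?d m m'" "e / 2"] that by blast
    have "eventually (\<lambda>k. ?d n n' k \<le> e) \<U>" if "n \<ge> Suc m" "n' \<ge> Suc m" for n n'
    proof -
      have "m < n" "m < n'" using that by auto
      from near[OF this(1)] near[OF this(2)] show ?thesis
      proof eventually_elim
        case (elim k)
        show ?case
          using norm_triangle_le_diff[of "mean m f k - mean n' f k"
              "mean m f k - mean n f k" e] elim by simp
      qed
    qed
    then show False using not by blast
  qed
  have "\<exists>z. \<forall>i. z i \<ge> 1 \<and> (z i < z (Suc i) \<and> eventually (\<lambda>k. ?d (z i) (z (Suc i)) k > e / 2) \<U>)"
  proof (rule dependent_nat_choice)
    fix n i :: nat assume "n \<ge> 1"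
    then show "\<exists>m\<ge>1. n < m \<and> eventually (\<lambda>k. ?d n m k > e / 2) \<U>"
      using step[of n] by (meson le_trans less_imp_le)
  qed auto
  then obtain z where z: "\<And>i. z i \<ge> 1" "\<And>i. z i < z (Suc i)"
    "\<And>i. eventually (\<lambda>k. ?d (z i) (z (Suc i)) k > e / 2) \<U>" by blast
  \<comment> \<open>Adding 1 keeps the scaling defined when \<open>f\<close> is 0.\<close>
  define \<epsilon> where "\<epsilon> = e / 2 / (norm f + 1)"
  have pos: "norm f + 1 > 0" by (simp add: add_nonneg_pos)
  have "has_branch (ergodic_tree T \<epsilon>)"
  proof (rule has_branch_ergodic_treeI)
    show "strict_mono z" using z(2) by (simp add: strict_mono_Suc_iff)
    fix p
    have "eventually (\<lambda>k. \<forall>i\<in>{..<p}. ?d (z i) (z (Suc i)) k > e / 2) \<U>"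
      using z(3) by (intro eventually_ball_finite) auto
    from eventually_happens'[OF \<U>_not_bot this]
    obtain k where k: "\<And>i. i < p \<Longrightarrow> ?d (z i) (z (Suc i)) k > e / 2"
      by auto
    let ?x = "(1 / (norm f + 1)) *\<^sub>R f k"
    have "norm ?x \<le> 1" using norm_bounded[of f k] pos by (simp add: divide_simps)
    moreover have "norm (cesaro T (z i) ?x - cesaro T (z (Suc i)) ?x) > \<epsilon>" if "i < p" for i
    proof -
      have "cesaro T (z i) ?x - cesaro T (z (Suc i)) ?x =
        (1 / (norm f + 1)) *\<^sub>R (mean (z i) f k - mean (z (Suc i)) f k)"
        by (simp add: blinfun.scaleR_right scaleR_diff_right)
      then have "norm (cesaro T (z i) ?x - cesaro T (z (Suc i)) ?x) = ?d (z i) (z (Suc i)) k / (norm f + 1)"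
        using pos by simp
      then show ?thesis using k[OF that] pos by (simp only: \<epsilon>_def divide_strict_right_mono)
    qed
    ultimately show "\<exists>x\<in>cball 0 1. \<forall>i<p. norm (cesaro T (z i) x - cesaro T (z (Suc i)) x) > \<epsilon>"
      by (intro bexI[of _ ?x]) auto
  qed (rule z)
  moreover have "\<epsilon> > 0" using assms pos by (simp add: \<epsilon>_def)
  ultimately show False using no_branch by blast
qed

text \<open>Convergence of the means of the coset of \<open>f\<close> to the coset of
  \<open>g\<close>, expressed on representatives; the exceptional set of coordinates may depend on
  \<open>n\<close>.\<close>

definition ulim :: "(nat \<Rightarrow>\<^sub>C 'a) \<Rightarrow> (nat \<Rightarrow>\<^sub>C 'a) \<Rightarrow> bool" where
  "ulim f g \<longleftrightarrow> (\<forall>e>0. \<exists>N. \<forall>n\<ge>N.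
     close n f g e)"

text \<open>
  The limit is a series of increments, each truncated at the coordinates where it is not yet small.
\<close>

lemma ex_ulim: "\<exists>g. ulim f g"
proof -
  let ?A = "\<lambda>n k. mean n f k"
  obtain N0 where N0: "\<And>j m n. m \<ge> N0 j \<Longrightarrow> n \<ge> N0 j \<Longrightarrow>
      eventually (\<lambda>k. norm (?A m k - ?A n k) \<le> (1/2)^j) \<U>"
  proof -
    have "\<forall>j. \<exists>N. \<forall>m\<ge>N. \<forall>n\<ge>N. eventually (\<lambda>k. norm (?A m k - ?A n k) \<le> (1/2)^j) \<U>"
      using eventually_Cauchy by simp
    from choice[OF this] show ?thesis using that by blast
  qed
  \<comment> \<open>Summing makes the thresholds monotone while keeping them above
    \<open>N0\<close>.\<close>
  define N where "N j = (\<Sum>i\<le>j. N0 i)" for j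
  have N_ge: "N0 j \<le> N j" "N j \<le> N (Suc j)" for j
    by (auto simp: N_def intro: member_le_sum)
  have N: "eventually (\<lambda>k. norm (?A m k - ?A n k) \<le> (1/2)^j) \<U>" if "m \<ge> N j" "n \<ge> N j" for j m n
    using N0[of j m n] N_ge(1)[of j] that by simp
  define d where "d j k = (if norm (?A (N (Suc j)) k - ?A (N j) k) \<le> (1/2)^j
      then ?A (N (Suc j)) k - ?A (N j) k else 0)" for j k
  have d: "norm (d j k) \<le> (1/2)^j" for j k by (simp add: d_def)
  have geo: "summable (\<lambda>j. (1/2::real)^(j + i))" for i
    using summable_geometric[of "1/2::real"] by (subst summable_iff_shift) simp
  have d_sum: "summable (\<lambda>j. d (j + i) k)" for i k
    by (rule summable_comparison_test'[OF geo[of i], of 0]) (simp add: d)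
  have d_tail: "norm (\<Sum>j. d (j + i) k) \<le> 2 * (1/2)^i" for i k
  proof -
    have "norm (\<Sum>j. d (j + i) k) \<le> (\<Sum>j. (1/2)^(j + i))"
      using geo[of i] d by (intro norm_suminf_le) auto
    also have "\<dots> = (\<Sum>j. (1/2)^i * (1/2)^j)" by (simp add: power_add mult.commute)
    also have "\<dots> = 2 * (1/2)^i"
      by (subst suminf_mult) (auto simp: suminf_geometric summable_geometric)
    finally show ?thesis .
  qed
  define g0 where "g0 k = ?A (N 0) k + (\<Sum>j. d j k)" for k
  have "norm (g0 k) \<le> norm (cesaro T (N 0)) * norm f + 2" for k
  proof -
    have "norm (?A (N 0) k) \<le> norm (cesaro T (N 0)) * norm f"
      by (rule order_trans[OF norm_blinfun]) (intro mult_left_mono norm_bounded norm_ge_zero)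
    then show ?thesis
      unfolding g0_def using d_tail[of 0 k] by (intro norm_triangle_le add_mono) auto
  qed
  then have g0: "apply_bcontfun (Bcontfun g0) k = g0 k" for k by (rule apply_Bcontfun)
  \<comment> \<open>At stage \<open>j\<close> only the first \<open>j\<close> increments have to be
    untruncated, a finite intersection of large sets; the remaining terms are controlled at every
    \<open>k\<close> by the geometric tail.\<close>
  have near: "eventually (\<lambda>k. norm (?A (N j) k - g0 k) \<le> 2 * (1/2)^j) \<U>" for j
  proof -
    have "eventually (\<lambda>k. \<forall>i\<in>{..<j}. norm (?A (N (Suc i)) k - ?A (N i) k) \<le> (1/2)^i) \<U>"
      using N N_ge(2) by (intro eventually_ball_finite) auto
    then show ?thesis
    proof eventually_elim
      case (elim k)
      have "(\<Sum>i<j. d i k) = (\<Sum>i<j. ?A (N (Suc i)) k - ?A (N i) k)"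
        using elim by (intro sum.cong) (auto simp: d_def)
      also have "\<dots> = ?A (N j) k - ?A (N 0) k" by (rule sum_lessThan_telescope)
      finally have "?A (N j) k - g0 k = - (\<Sum>i. d (i + j) k)"
        using suminf_split_initial_segment[OF d_sum[of 0 k, simplified], of j] by (simp add: g0_def)
      then show ?case using d_tail[of j k] by simp
    qed
  qed
  have "ulim f (Bcontfun g0)" unfolding ulim_def g0
  proof (intro allI impI)
    fix e :: real assume "e > 0"
    \<comment> \<open>The 3 collects \<open>(1/2)^j\<close> from the Cauchy estimate and
      \<open>2 * (1/2)^j\<close> from the tail.\<close>
    then obtain j where j: "(1/2)^j < e / 3"
      using real_arch_pow_inv[of "e / 3" "1 / 2"] by auto
    have "eventually (\<lambda>k. norm (?A n k - g0 k) \<le> e) \<U>" if "n \<ge> N j" for n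
      using near[of j] N[OF that order_refl]
    proof eventually_elim
      case (elim k)
      show ?case
        using norm_triangle_ineq[of "?A n k - ?A (N j) k" "?A (N j) k - g0 k"] elim j by simp
    qed
    then show "\<exists>N. \<forall>n\<ge>N. eventually (\<lambda>k. norm (?A n k - g0 k) \<le> e) \<U>" by blast
  qed
  then show ?thesis by blast
qed

text \<open>The means of the null sequence \<open>f - f'\<close> must be small for all large
  \<open>n\<close> with a bound independent of \<open>n\<close>; this is where the uniform bound on
  the norms of the means enters.\<close>

lemma ulim_cong:
  assumes "ulim f g" "f - f' \<in> ultra_null \<U>" shows "ulim f' g"
proof -
  obtain M where M: "M > 0" "\<And>n. norm (cesaro T n) \<le> M"
    using bounded_cesaro[OF no_branch] by auto
  show ?thesis unfolding ulim_def
  proof (intro allI impI)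
    fix e :: real assume "e > 0"
    then obtain N where N: "\<And>n. n \<ge> N \<Longrightarrow>
        close n f g (e / 2)"
      using assms(1) unfolding ulim_def by (meson half_gt_zero)
    have "eventually (\<lambda>k. norm ((f - f') k) \<le> e / (2 * M)) \<U>"
      using assms(2) \<open>e > 0\<close> M(1) unfolding ultra_null_le_iff by simp
    then have "close n f' g e"
      if "n \<ge> N" for n
      using N[OF that]
    proof eventually_elim
      case (elim k)
      have "norm (mean n (f - f') k) \<le> norm (cesaro T n) * norm ((f - f') k)"
        by (rule norm_blinfun)
      also have "\<dots> \<le> M * (e / (2 * M))"
        using elim(1) M by (intro mult_mono) auto
      also have "\<dots> = e / 2" using M(1) by simp
      finally have "norm (mean n f k - mean n f' k) \<le> e / 2"
        by (simp add: blinfun.diff_right)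
      then show ?case
        using norm_triangle_le_diff[of "mean n f k - g k"
          "mean n f k - mean n f' k" e] elim(2) by simp
    qed
    then show "\<exists>N. \<forall>n\<ge>N. close n f' g e"
      by blast
  qed
qed

lemma ulim_unique:
  assumes "ulim f g" "ulim f g'" shows "g - g' \<in> ultra_null \<U>"
  unfolding ultra_null_le_iff
proof (intro allI impI)
  fix e :: real assume "e > 0"
  then obtain N N' where N: "\<And>n. n \<ge> N \<Longrightarrow>
        close n f g (e / 2)"
      and N': "\<And>n. n \<ge> N' \<Longrightarrow>
        close n f g' (e / 2)"
    using assms unfolding ulim_def by (meson half_gt_zero)
  show "eventually (\<lambda>k. norm ((g - g') k) \<le> e) \<U>"
    using N[OF max.cobounded1[of N N']] N'[OF max.cobounded2[of N' N]]
  proof eventually_elim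
    case (elim k)
    let ?a = "cesaro T (max N N') (f k)"
    show ?case
      using norm_triangle_le_diff[of "?a - g' k" "?a - g k" e] elim
      by simp
  qed
qed

lemma ulim_add:
  assumes "ulim f g" "ulim f' g'" shows "ulim (f + f') (g + g')"
  unfolding ulim_def
proof (intro allI impI)
  fix e :: real assume "e > 0"
  then obtain N N' where N: "\<And>n. n \<ge> N \<Longrightarrow>
        close n f g (e / 2)"
      and N': "\<And>n. n \<ge> N' \<Longrightarrow>
        close n f' g' (e / 2)"
    using assms unfolding ulim_def by (meson half_gt_zero)
  have "close n (f + f') (g + g') e"
    if "n \<ge> max N N'" for n
    using N[OF order_trans[OF max.cobounded1 that]] N'[OF order_trans[OF max.cobounded2 that]]
  proof eventually_elim
    case (elim k)
    show ?case
      using norm_triangle_le[of "mean n f k - g k"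
        "mean n f' k - g' k" e] elim
      by (simp add: blinfun.add_right algebra_simps)
  qed
  then show "\<exists>N. \<forall>n\<ge>N. close n (f + f') (g + g') e"
    by blast
qed

lemma ulim_smul:
  assumes "ulim f g" shows "ulim (bmap (smul c) f) (bmap (smul c) g)"
  unfolding ulim_def
proof (intro allI impI)
  note bl = banach_over_bounded_linear[OF banach, of c]
  have pos: "norm c + 1 > 0" by (simp add: add_nonneg_pos)
  fix e :: real assume "e > 0"
  then obtain N where N: "\<And>n. n \<ge> N \<Longrightarrow>
      close n f g (e / (norm c + 1))"
    using assms pos unfolding ulim_def by (meson divide_pos_pos)
  have "close n (bmap (smul c) f) (bmap (smul c) g) e"
    if "n \<ge> N" for n
    using N[OF that]
  proof eventually_elim
    case (elim k)
    have "norm (smul c (mean n f k - g k))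
        \<le> (norm c + 1) * norm (mean n f k - g k)"
      by (simp add: banach_over.norm_scale[OF banach] mult_right_mono)
    also have "\<dots> \<le> (norm c + 1) * (e / (norm c + 1))" using elim pos by (intro mult_left_mono) auto
    also have "\<dots> = e" using pos by simp
    finally show ?case
      by (simp add: bl cesaro_smul[OF banach T] linear_diff[OF bounded_linear.linear[OF bl]])
  qed
  then show "\<exists>N. \<forall>n\<ge>N. close n (bmap (smul c) f) (bmap (smul c) g) e"
    by blast
qed

text \<open>Both representatives are left to choice; \<open>ulim_cong\<close> and
  \<open>ulim_unique\<close> show that the value does not depend on them.\<close>

definition ulim_coset :: "(nat \<Rightarrow>\<^sub>C 'a) set \<Rightarrow> (nat \<Rightarrow>\<^sub>C 'a) set" where
  "ulim_coset \<xi> = (SOME \<zeta>. \<exists>f g. \<xi> = ultra_coset \<U> f \<and> ulim f g \<and> \<zeta> = ultra_coset \<U> g)"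

lemma ulim_coset_eq: assumes "ulim f g" shows "ulim_coset (ultra_coset \<U> f) = ultra_coset \<U> g"
proof -
  have "\<exists>f' g'. ultra_coset \<U> f = ultra_coset \<U> f' \<and> ulim f' g' \<and> ulim_coset (ultra_coset \<U> f) = ultra_coset \<U> g'"
    unfolding ulim_coset_def by (rule someI_ex) (use assms in blast)
  then obtain f' g' where "f - f' \<in> ultra_null \<U>" "ulim f' g'"
    and eq: "ulim_coset (ultra_coset \<U> f) = ultra_coset \<U> g'"
    by (auto simp: ultra_coset_eq_iff)
  then have "ulim f' g" using ulim_cong[OF assms] by blast
  then show ?thesis unfolding eq ultra_coset_eq_iff by (rule ulim_unique[OF \<open>ulim f' g'\<close>])
qed

lemma ultra_norm_ulim_le:
  assumes "\<And>n. norm (cesaro T n) \<le> M" "ulim f g"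
  shows "ultra_norm (ultra_coset \<U> g) \<le> M * norm f"
proof (rule field_le_epsilon)
  fix e :: real assume "e > 0"
  have "0 \<le> M" using assms(1)[of 0] norm_ge_zero order_trans by blast
  obtain n where "close n f g e"
    using assms(2) \<open>e > 0\<close> unfolding ulim_def by blast
  then have "eventually (\<lambda>k. norm (g k) \<le> M * norm f + e) \<U>"
  proof eventually_elim
    case (elim k)
    have "norm (mean n f k) \<le> norm (cesaro T n) * norm (f k)"
      by (rule norm_blinfun)
    also have "\<dots> \<le> M * norm f" using assms(1) norm_bounded \<open>0 \<le> M\<close> by (intro mult_mono) auto
    finally show ?case
      using elim norm_triangle_le_diff[of "mean n f k"
        "mean n f k - g k" "M * norm f + e"] by simp
  qed
  then show "ultra_norm (ultra_coset \<U> g) \<le> M * norm f + e"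
    by (rule ultra_norm_le) (use \<open>0 \<le> M\<close> \<open>e > 0\<close> in simp)
qed

lemma ultra_bounded_linear_ulim_coset: "ultra_bounded_linear \<U> smul ulim_coset"
  unfolding ultra_bounded_linear_def
proof (intro conjI)
  have rep: "\<exists>f g. \<xi> = ultra_coset \<U> f \<and> ulim f g" if "\<xi> \<in> ultrapower \<U>"
    for \<xi> :: "(nat \<Rightarrow>\<^sub>C 'a) set"
    using that ex_ulim unfolding ultrapower_def by blast
  show "ulim_coset ` ultrapower \<U> \<subseteq> ultrapower \<U>"
  proof
    fix \<zeta> assume "\<zeta> \<in> ulim_coset ` ultrapower \<U>"
    then obtain \<xi> where "\<xi> \<in> ultrapower \<U>" "\<zeta> = ulim_coset \<xi>" by blast
    moreover from rep[OF this(1)] obtain f g where "\<xi> = ultra_coset \<U> f" "ulim f g" by blast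
    ultimately show "\<zeta> \<in> ultrapower \<U>" using ulim_coset_eq by (simp add: ultrapower_def)
  qed
  show "\<forall>\<xi>\<in>ultrapower \<U>. \<forall>\<zeta>\<in>ultrapower \<U>.
      ulim_coset (ultra_add \<xi> \<zeta>) = ultra_add (ulim_coset \<xi>) (ulim_coset \<zeta>)"
  proof (intro ballI)
    fix \<xi> \<zeta> :: "(nat \<Rightarrow>\<^sub>C 'a) set" assume "\<xi> \<in> ultrapower \<U>" "\<zeta> \<in> ultrapower \<U>"
    then obtain f g f' g' where "\<xi> = ultra_coset \<U> f" "ulim f g" "\<zeta> = ultra_coset \<U> f'" "ulim f' g'"
      using rep by meson
    then show "ulim_coset (ultra_add \<xi> \<zeta>) = ultra_add (ulim_coset \<xi>) (ulim_coset \<zeta>)"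
      using ulim_coset_eq ulim_add by (simp add: ultra_add_coset)
  qed
  show "\<forall>c. \<forall>\<xi>\<in>ultrapower \<U>. ulim_coset (ultra_scale \<U> smul c \<xi>) = ultra_scale \<U> smul c (ulim_coset \<xi>)"
  proof (intro ballI allI)
    fix c and \<xi> :: "(nat \<Rightarrow>\<^sub>C 'a) set" assume "\<xi> \<in> ultrapower \<U>"
    then obtain f g where "\<xi> = ultra_coset \<U> f" "ulim f g" using rep by meson
    then show "ulim_coset (ultra_scale \<U> smul c \<xi>) = ultra_scale \<U> smul c (ulim_coset \<xi>)"
      using ulim_coset_eq ulim_smul
      by (simp add: ultra_scale_def ultra_map_coset banach_over_bounded_linear[OF banach])
  qed
  obtain M where M: "M > 0" "\<And>n. norm (cesaro T n) \<le> M"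
    using bounded_cesaro[OF no_branch] by auto
  have "ultra_norm (ulim_coset \<xi>) \<le> M * ultra_norm \<xi>" if \<xi>: "\<xi> \<in> ultrapower \<U>"
    for \<xi> :: "(nat \<Rightarrow>\<^sub>C 'a) set"
  proof -
    \<comment> \<open>Each representative gives a bound, and the quotient norm is the infimum over
      them; dividing by \<open>M\<close> leaves the bare norm of \<open>f\<close> on the
      right.\<close>
    have "ultra_norm (ulim_coset \<xi>) / M \<le> norm f" if "f \<in> \<xi>" for f
    proof -
      have eq: "\<xi> = ultra_coset \<U> f" using \<xi> that ultra_coset_cong by (auto simp: ultrapower_def)
      obtain g where g: "ulim f g" using ex_ulim by blast
      show ?thesis
        using ultra_norm_ulim_le[OF M(2) g] M(1)
        by (simp add: eq ulim_coset_eq[OF g] divide_le_eq mult.commute)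
    qed
    moreover have "\<xi> \<noteq> {}" using \<xi> self_mem_ultra_coset by (auto simp: ultrapower_def)
    ultimately have "ultra_norm (ulim_coset \<xi>) / M \<le> ultra_norm \<xi>"
      unfolding ultra_norm_def[of \<xi>] by (intro cINF_greatest) auto
    then show ?thesis using M(1) by (simp add: divide_le_eq mult.commute)
  qed
  then show "\<exists>B. \<forall>\<xi>\<in>ultrapower \<U>. ultra_norm (ulim_coset \<xi>) \<le> B * ultra_norm \<xi>" by blast
qed

lemma ultra_ergodic_of_no_branch: "ultra_ergodic \<U> smul (ultra_op \<U> T)"
  unfolding ultra_ergodic_def
proof (intro exI[of _ ulim_coset] conjI ballI ultra_bounded_linear_ulim_coset)
  fix \<xi> :: "(nat \<Rightarrow>\<^sub>C 'a) set" assume "\<xi> \<in> ultrapower \<U>"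
  then obtain f g where f: "\<xi> = ultra_coset \<U> f" and g: "ulim f g"
    using ex_ulim unfolding ultrapower_def by blast
  have "(\<lambda>n. ultra_norm (ultra_coset \<U> (bmap (cesaro T n) f - g))) \<longlonglongrightarrow> 0"
  proof (rule LIMSEQ_I)
    fix r :: real assume "r > 0"
    then obtain N where N: "\<And>n. n \<ge> N \<Longrightarrow>
        close n f g (r / 2)"
      using g unfolding ulim_def by (meson half_gt_zero)
    have "ultra_norm (ultra_coset \<U> (bmap (cesaro T n) f - g)) \<le> r / 2" if "n \<ge> N" for n
      using N[OF that] \<open>r > 0\<close> by (intro ultra_norm_le) (simp_all add: blinfun.bounded_linear_right)
    then have "norm (ultra_norm (ultra_coset \<U> (bmap (cesaro T n) f - g)) - 0) < r" if "n \<ge> N" for n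
      using \<open>r > 0\<close> ultra_norm_coset_nonneg[of \<U> "bmap (cesaro T n) f - g"] that by fastforce
    then show "\<exists>N. \<forall>n\<ge>N. norm (ultra_norm (ultra_coset \<U> (bmap (cesaro T n) f - g)) - 0) < r"
      by blast
  qed
  then show "(\<lambda>n. ultra_norm (ultra_diff (ultra_cesaro \<U> (ultra_op \<U> T) n \<xi>) (ulim_coset \<xi>))) \<longlonglongrightarrow> 0"
    by (simp add: f ulim_coset_eq[OF g] ultra_cesaro_coset ultra_diff_coset)
qed

end

theorem super_ergodic_iff_no_branch:
  assumes "banach_over smul" "T \<in> ops smul"
  shows "super_ergodic smul T \<longleftrightarrow> (\<forall>\<epsilon>>0. \<not> has_branch (ergodic_tree T \<epsilon>))"
  using super_ergodic_imp_no_branch[of smul T] ultra_ergodic_of_no_branch[OF assms]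
  by (auto simp: super_ergodic_def)

section \<open>The Borel structure of the space of operators\<close>

text \<open>Additivity gives homogeneity over the integers and then the rationals, and continuity
  extends it to the reals. This recovers scalars from codes that record only differences.\<close>

lemma linear_if_additive_continuous:
  fixes h :: "'a::real_normed_vector \<Rightarrow> 'b::real_normed_vector"
  assumes add: "\<And>x y. h (x + y) = h x + h y" and cont: "continuous_on UNIV h"
  shows "linear h"
proof (rule linearI)
  fix r x
  have additive: "Modules.additive h" using add by (simp add: Modules.additive_def)
  have nat: "h (real n *\<^sub>R y) = real n *\<^sub>R h y" for n y
    by (induction n) (simp_all add: Modules.additive.zero[OF additive] scaleR_left_distrib add)
  have int: "h (real_of_int i *\<^sub>R y) = real_of_int i *\<^sub>R h y" for i y
    by (cases i rule: int_cases2) (simp_all add: nat Modules.additive.minus[OF additive])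
  have rat: "h (q *\<^sub>R x) = q *\<^sub>R h x" if "q \<in> \<rat>" for q
  proof -
    obtain a b :: int where ab: "b > 0" "q = of_int a / of_int b"
      using \<open>q \<in> \<rat>\<close> by (auto elim!: Rats_cases')
    have "real_of_int b *\<^sub>R h (q *\<^sub>R x) = h (real_of_int a *\<^sub>R x)"
      using ab by (simp flip: int)
    then have eq: "real_of_int b *\<^sub>R h (q *\<^sub>R x) = real_of_int a *\<^sub>R h x" by (simp only: int)
    have "h (q *\<^sub>R x) = (1 / real_of_int b) *\<^sub>R (real_of_int b *\<^sub>R h (q *\<^sub>R x))" using ab by simp
    also have "\<dots> = q *\<^sub>R h x" unfolding eq using ab by simp
    finally show ?thesis .
  qed
  let ?R = "{r. h (r *\<^sub>R x) = r *\<^sub>R h x}"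
  have "closed ?R"
    by (intro closed_Collect_eq continuous_on_compose2[OF cont] continuous_intros) auto
  moreover have "\<rat> \<subseteq> ?R" using rat by auto
  ultimately have "closure \<rat> \<subseteq> ?R" by (rule closure_minimal[rotated])
  then show "h (r *\<^sub>R x) = r *\<^sub>R h x" by (auto simp: Rats_closure_real)
qed (rule add)

text \<open>Integer combinations of a dense sequence are countable in number and form a
  group.\<close>

lemma ex_dense_subgroup_sequence:
  fixes X :: "'a::real_normed_vector topology"
  assumes "separable_space X" "X = euclidean"
  obtains d :: "nat \<Rightarrow> 'a" where "closure (range d) = UNIV" "\<And>i j. \<exists>k. d k = d i - d j"
proof -
  obtain C :: "'a set" where C: "countable C" "closure C = UNIV"
    using assms by (auto simp: separable_space_def)
  then have "C \<noteq> {}" by auto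
  define c where "c = from_nat_into C"
  have c: "range c = C" unfolding c_def by (rule range_from_nat_into[OF \<open>C \<noteq> {}\<close> C(1)])
  define v where "v l = (\<Sum>p\<leftarrow>l. of_int (fst p) *\<^sub>R c (snd p))" for l :: "(int \<times> nat) list"
  define d where "d k = v (from_nat k)" for k
  have diff: "v l - v l' = v (l @ map (\<lambda>p. (- fst p, snd p)) l')" for l l'
    by (simp add: v_def comp_def uminus_sum_list_map)
  show ?thesis
  proof
    have "c n = d (to_nat [(1 :: int, n)])" for n by (simp add: d_def v_def)
    then have "C \<subseteq> range d" using c by auto
    then show "closure (range d) = UNIV" using C(2) closure_mono by blast
    fix i j
    have "d (to_nat (from_nat i @ map (\<lambda>p. (- fst p, snd p)) (from_nat j) :: (int \<times> nat) list)) = d i - d j"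
      by (simp add: d_def diff)
    then show "\<exists>k. d k = d i - d j" by blast
  qed
qed

locale dense_sequence =
  fixes d :: "nat \<Rightarrow> 'a::banach"
  assumes dense: "closure (range d) = UNIV"
    and diff_closed: "\<exists>k. d k = d i - d j"
begin

lemma ex_near: "e > 0 \<Longrightarrow> \<exists>n. norm (x - d n) < e"
  using closure_approachable[of x "range d"] dense by (auto simp: dist_norm norm_minus_commute)

lemma ex_zero: "\<exists>k. d k = 0" using diff_closed[of 0 0] by auto

lemma ex_in_open: "open U \<Longrightarrow> x \<in> U \<Longrightarrow> \<exists>n. d n \<in> U"
  using dense open_Int_closure_eq_empty[of U "range d"] by auto

text \<open>Compatibility with differences and the bound make \<open>y\<close> Lipschitz on the
  dense set, so it extends by uniform continuity; additivity and the bound pass to the limit as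
  closed conditions.\<close>

lemma ex_extension:
  assumes diff: "\<And>i j k. d k = d i - d j \<Longrightarrow> y k = y i - y j"
    and bound: "\<And>i. norm (y i) \<le> M * norm (d i)" and "M \<ge> 0"
  shows "\<exists>T :: 'a \<Rightarrow>\<^sub>L 'a. \<forall>i. T (d i) = y i"
proof -
  have lip: "norm (y i - y j) \<le> M * norm (d i - d j)" for i j
    using diff_closed[of i j] diff bound by metis
  \<comment> \<open>The sequence \<open>d\<close> may repeat values; the Lipschitz estimate makes
    \<open>y\<close> agree on repetitions, so the choice is harmless.\<close>
  define f where "f x = y (SOME i. d i = x)" for x
  have f: "f (d i) = y i" for i
  proof -
    have "d (SOME j. d j = d i) = d i" by (rule someI_ex) blast
    then show ?thesis using lip[of "SOME j. d j = d i" i] by (simp add: f_def)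
  qed
  have "uniformly_continuous_on (range d) f"
    unfolding uniformly_continuous_on_def
  proof (intro allI impI)
    fix e :: real assume "e > 0"
    have "dist (f x') (f x) < e" if "x \<in> range d" "x' \<in> range d" "dist x' x < e / (M + 1)" for x x'
    proof -
      have "dist (f x') (f x) \<le> M * dist x' x" using that lip by (auto simp: f dist_norm)
      also have "\<dots> \<le> (M + 1) * dist x' x" by (intro mult_right_mono) auto
      also have "\<dots> < e" using that(3) \<open>M \<ge> 0\<close> by (simp add: less_divide_eq mult.commute)
      finally show ?thesis .
    qed
    then show "\<exists>\<delta>>0. \<forall>x\<in>range d. \<forall>x'\<in>range d. dist x' x < \<delta> \<longrightarrow> dist (f x') (f x) < e"
      using \<open>e > 0\<close> \<open>M \<ge> 0\<close> by (intro exI[of _ "e / (M + 1)"]) auto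
  qed
  then obtain g where g: "uniformly_continuous_on (closure (range d)) g"
    "\<And>x. x \<in> range d \<Longrightarrow> f x = g x"
    by (rule uniformly_continuous_on_extension_on_closure) blast
  have cont: "continuous_on UNIV g"
    using uniformly_continuous_imp_continuous[OF g(1)] dense by simp
  have g_d: "g (d i) = y i" for i using g(2) f by (metis rangeI)
  have g_diff: "g (x - x') = g x - g x'" for x x'
  proof -
    let ?S = "{p. g (fst p - snd p) = g (fst p) - g (snd p)}"
    have "closed ?S"
      by (intro closed_Collect_eq continuous_on_compose2[OF cont] continuous_intros) auto
    moreover have "range d \<times> range d \<subseteq> ?S"
      using diff diff_closed g_d by (auto; metis)
    ultimately have "closure (range d \<times> range d) \<subseteq> ?S" by (rule closure_minimal[rotated])
    moreover have "(x, x') \<in> closure (range d \<times> range d)" by (simp add: closure_Times dense)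
    ultimately have "(x, x') \<in> ?S" by (rule subsetD)
    then show ?thesis by simp
  qed
  have g_add: "g (x + x') = g x + g x'" for x x'
    using g_diff[of x "- x'"] g_diff[of 0 x'] g_diff[of 0 0] by simp
  have "norm (g x) \<le> M * norm x" for x
  proof -
    have "closed {x. norm (g x) \<le> M * norm x}"
      by (intro closed_Collect_le continuous_intros cont)
    moreover have "range d \<subseteq> {x. norm (g x) \<le> M * norm x}" using bound g_d by auto
    ultimately have "closure (range d) \<subseteq> {x. norm (g x) \<le> M * norm x}" by (rule closure_minimal[rotated])
    then show ?thesis using dense by auto
  qed
  then have "bounded_linear g"
    using linear_if_additive_continuous[OF g_add cont]
    by (intro bounded_linear.intro bounded_linear_axioms.intro) (auto simp: mult.commute)
  then show ?thesis using g_d by (intro exI[of _ "Blinfun g"]) (simp add: bounded_linear_Blinfun_apply)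
qed

lemma blinfun_eqI_dense:
  assumes "\<And>i. blinfun_apply S (d i) = blinfun_apply T (d i)" shows "S = T"
proof (rule blinfun_eqI)
  fix x
  have "closed {x. blinfun_apply S x = blinfun_apply T x}"
    by (intro closed_Collect_eq linear_continuous_on blinfun.bounded_linear_right)
  then have "closure (range d) \<subseteq> {x. blinfun_apply S x = blinfun_apply T x}"
    using assms by (intro closure_minimal) auto
  then show "blinfun_apply S x = blinfun_apply T x" using dense by auto
qed

abbreviation near :: "('a \<Rightarrow>\<^sub>L 'a) \<Rightarrow> nat \<Rightarrow> nat \<Rightarrow> rat \<Rightarrow> bool" where
  "near T n m q \<equiv> norm (blinfun_apply T (d n) - d m) < of_rat q"

definition op_code :: "('a \<Rightarrow>\<^sub>L 'a) \<Rightarrow> nat \<Rightarrow> nat" where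
  "op_code T i = (case from_nat i :: nat \<times> nat \<times> rat of
     (n, m, q) \<Rightarrow> if near T n m q then 1 else 0)"

definition rel :: "(nat \<Rightarrow> nat) \<Rightarrow> nat \<Rightarrow> nat \<Rightarrow> rat \<Rightarrow> bool" where
  "rel b n m q \<longleftrightarrow> b (to_nat (n, m, q)) = 1"

lemma rel_op_code: "rel (op_code T) n m q \<longleftrightarrow> near T n m q"
  by (simp add: rel_def op_code_def)

text \<open>
  The range of \<^const>\<open>op_code\<close>: each row \<open>rel b n\<close> records the distances of some point \<open>y n\<close> to
  the \<open>d m\<close>, the \<open>y n\<close> respect differences of the \<open>d n\<close>, and \<open>norm (y n) \<le> M * norm (d n)\<close>.
\<close>

definition codes :: "(nat \<Rightarrow> nat) set" where
  "codes = {b. (\<forall>i. (b i = 0 \<or> b i = 1) \<and> (b (to_nat (from_nat i :: nat \<times> nat \<times> rat)) = 1 \<longleftrightarrow> b i = 1)) \<and>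
    (\<forall>n q. q > 0 \<longrightarrow> (\<exists>m. rel b n m q)) \<and>
    (\<forall>n m q. rel b n m q \<longrightarrow> (\<exists>q'. q' < q \<and> rel b n m q')) \<and>
    (\<forall>n m q m' q'. rel b n m q \<and> rel b n m' q' \<longrightarrow> norm (d m - d m') < of_rat (q + q')) \<and>
    (\<forall>n m q m' q'. rel b n m q \<and> of_rat q + norm (d m - d m') \<le> of_rat q' \<longrightarrow> rel b n m' q') \<and>
    (\<forall>i j k q. d k = d i - d j \<and> q > 0 \<longrightarrow> (\<exists>m m' m''. rel b i m q \<and> rel b j m' q \<and> rel b k m'' q \<and>
       norm (d m'' - (d m - d m')) < 3 * of_rat q)) \<and>
    (\<exists>M::nat. \<forall>i m q. d m = 0 \<and> real M * norm (d i) < of_rat q \<longrightarrow> rel b i m q)}"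

text \<open>Every quantifier in \<open>codes\<close> ranges over a countable type, the radii being
  rational and the bound \<open>M\<close> natural.\<close>

lemma sets_codes: "codes \<in> sets borel"
proof -
  have "Measurable.pred borel (\<lambda>b :: nat \<Rightarrow> nat. P (b i))" for P i
    using measurable_compose[OF measurable_product_coordinates[of i, where ?'b = nat], of P "count_space UNIV"]
    by (simp add: measurable_cong_sets[OF sets_borel_eq_count_space refl])
  then have [measurable]: "Measurable.pred borel (\<lambda>b :: nat \<Rightarrow> nat. b i = c)"
      "Measurable.pred borel (\<lambda>b. rel b n m q)" for i c n m q
    unfolding rel_def by auto
  have "Measurable.pred borel (\<lambda>b. b \<in> codes)"
    unfolding codes_def mem_Collect_eq
    by (intro pred_intros_logic pred_intros_countable measurable_const) measurable
  then show ?thesis by (simp add: pred_def)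
qed

lemma real_le_rat: fixes x y :: real assumes "\<And>q :: rat. y < of_rat q \<Longrightarrow> x < of_rat q" shows "x \<le> y"
  by (rule ccontr) (meson assms not_le of_rat_dense order_less_asym)

text \<open>As \<open>d k\<close> is 0, \<open>near T n k q\<close> says that \<open>T (d n)\<close>
  has norm below \<open>q\<close>, and density carries the estimate from the sequence to all
  vectors. Norm balls thus become conditions on codes.\<close>

lemma norm_blinfun_le_iff:
  fixes T :: "'a \<Rightarrow>\<^sub>L 'a"
  assumes "d k = 0"
  shows "norm T \<le> real M \<longleftrightarrow> (\<forall>n q. real M * norm (d n) < of_rat q \<longrightarrow> near T n k q)"
proof
  assume le: "norm T \<le> real M"
  have "norm (T (d n)) \<le> real M * norm (d n)" for n
    by (rule order_trans[OF norm_blinfun]) (intro mult_right_mono le norm_ge_zero)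
  then show "\<forall>n q. real M * norm (d n) < of_rat q \<longrightarrow> near T n k q"
    using assms by (auto intro: order_le_less_trans)
next
  assume *: "\<forall>n q. real M * norm (d n) < of_rat q \<longrightarrow> near T n k q"
  have bound: "norm (T (d n)) \<le> real M * norm (d n)" for n
    by (rule real_le_rat) (use * assms in auto)
  have "closed {x. norm (T x) \<le> real M * norm x}"
    by (intro closed_Collect_le continuous_intros)
  then have "closure (range d) \<subseteq> {x. norm (T x) \<le> real M * norm x}"
    using bound by (intro closure_minimal) auto
  then show "norm T \<le> real M" using dense by (intro norm_blinfun_bound) auto
qed

lemma op_code_in_codes: "op_code T \<in> codes"
proof -
  have near: "\<exists>m. near T n m q" if "q > 0" for n q
    using ex_near[of "of_rat q" "T (d n)"] that by simp
  show ?thesis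
    unfolding codes_def mem_Collect_eq rel_op_code
  proof (intro conjI allI impI)
    show "op_code T i = 0 \<or> op_code T i = 1" for i by (simp add: op_code_def split: prod.splits)
    show "op_code T (to_nat (from_nat i :: nat \<times> nat \<times> rat)) = 1 \<longleftrightarrow> op_code T i = 1" for i
      by (simp add: op_code_def)
    show "\<exists>m. near T n m q" if "q > 0" for n q using near that by blast
    show "\<exists>q'<q. near T n m q'" if "near T n m q" for n m q
      using of_rat_dense[OF that] of_rat_less by blast
    show "norm (d m - d m') < of_rat (q + q')"
      if "near T n m q \<and> near T n m' q'" for n m q m' q'
      using that norm_triangle_ineq4[of "T (d n) - d m'" "T (d n) - d m"] by (simp add: of_rat_add)
    show "near T n m' q'"
      if "near T n m q \<and> of_rat q + norm (d m - d m') \<le> of_rat q'" for n m q m' q'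
      using that norm_triangle_ineq[of "T (d n) - d m" "d m - d m'"] by simp
    fix i j k and q :: rat assume *: "d k = d i - d j \<and> q > 0"
    then obtain m m' m'' where m: "near T i m q" "near T j m' q"
      "near T k m'' q" using near by meson
    \<comment> \<open>Three approximation errors, each below \<open>q\<close>, separate
      \<open>d m''\<close> from \<open>d m - d m'\<close>; hence the constant 3 in
      \<open>codes\<close>.\<close>
    have "d m'' - (d m - d m') = (T (d i) - d m) - (T (d j) - d m') - (T (d k) - d m'')"
      using * by (simp add: blinfun.diff_right)
    then have "norm (d m'' - (d m - d m')) \<le> norm ((T (d i) - d m) - (T (d j) - d m')) + norm (T (d k) - d m'')"
      by (simp only: norm_triangle_ineq4)
    also have "\<dots> \<le> norm (T (d i) - d m) + norm (T (d j) - d m') + norm (T (d k) - d m'')"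
      by (intro add_right_mono norm_triangle_ineq4)
    finally have "norm (d m'' - (d m - d m')) \<le> norm (T (d i) - d m) + norm (T (d j) - d m') + norm (T (d k) - d m'')" .
    then show "\<exists>m m' m''. near T i m q \<and> near T j m' q \<and>
       near T k m'' q \<and> norm (d m'' - (d m - d m')) < 3 * of_rat q"
      using m by (intro exI[of _ m] exI[of _ m'] exI[of _ m'']) auto
  next
    obtain M :: nat where M: "norm T \<le> real M" using real_arch_simple by blast
    show "\<exists>M::nat. \<forall>i m q. d m = 0 \<and> real M * norm (d i) < of_rat q \<longrightarrow> near T i m q"
      using norm_blinfun_le_iff[THEN iffD1, OF _ M] by blast
  qed
qed

text \<open>Points \<open>d (a k)\<close> named by row \<open>n\<close> at radii tending to 0 form a
  Cauchy sequence, whose limit is the coded point. Since a radius can always be shrunk, the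
  inequality stays strict in the limit; the enlargement clause gives the converse.\<close>

lemma codes_ex_point:
  assumes "b \<in> codes" shows "\<exists>x. \<forall>m q. rel b n m q \<longleftrightarrow> norm (x - d m) < of_rat q"
proof -
  note c1 = assms[unfolded codes_def mem_Collect_eq, THEN conjunct2] note c2 = c1[THEN conjunct2]
  note c3 = c2[THEN conjunct2] note c4 = c3[THEN conjunct2]
  note b = c1[THEN conjunct1, rule_format, of _ n] c2[THEN conjunct1, rule_format, of n]
    c3[THEN conjunct1, rule_format, of n, OF conjI] c4[THEN conjunct1, rule_format, OF conjI, of n]
  define q where "q k = (1 / of_nat (Suc k) :: rat)" for k
  have q: "q k > 0" "(of_rat (q k) :: real) = inverse (real (Suc k))" for k
    by (simp_all add: q_def of_rat_divide divide_inverse of_rat_inverse del: of_nat_Suc)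
  have "\<forall>k. \<exists>m. rel b n m (q k)" using b(1) q(1) by blast
  then obtain a where a: "\<And>k. rel b n (a k) (q k)" by metis
  have q_lim: "(\<lambda>k. of_rat (q k) :: real) \<longlonglongrightarrow> 0" unfolding q(2) by (rule LIMSEQ_inverse_real_of_nat)
  have close: "norm (d (a k) - d m) < of_rat (q k) + of_rat r" if "rel b n m r" for k m r
    using b(3)[OF a that] by (simp add: of_rat_add)
  have "Cauchy (\<lambda>k. d (a k))"
  proof (rule metric_CauchyI)
    fix e :: real assume "e > 0"
    then have "eventually (\<lambda>k. of_rat (q k) < e / 2) sequentially"
      using q_lim by (intro order_tendstoD) auto
    then obtain K where K: "\<And>k. k \<ge> K \<Longrightarrow> of_rat (q k) < e / 2" by (auto simp: eventually_sequentially)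
    have "dist (d (a k)) (d (a l)) < e" if "k \<ge> K" "l \<ge> K" for k l
      using close[OF a, of k l] K[OF that(1)] K[OF that(2)] by (simp add: dist_norm)
    then show "\<exists>K. \<forall>k\<ge>K. \<forall>l\<ge>K. dist (d (a k)) (d (a l)) < e" by blast
  qed
  then obtain x where x: "(\<lambda>k. d (a k)) \<longlonglongrightarrow> x" using Cauchy_convergent convergent_def by blast
  have lim: "(\<lambda>k. norm (d (a k) - d m)) \<longlonglongrightarrow> norm (x - d m)" for m
    by (intro tendsto_intros x)
  have "norm (x - d m) < of_rat r" if "rel b n m r" for m r
  proof -
    have "rel b n m r" by fact
    then obtain r' where r': "r' < r" "rel b n m r'" using b(2) by blast
    have "(\<lambda>k. of_rat (q k) + of_rat r') \<longlonglongrightarrow> (0 + of_rat r' :: real)" by (intro tendsto_add q_lim tendsto_const)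
    then have "norm (x - d m) \<le> 0 + of_rat r'"
      by (rule LIMSEQ_le[OF lim]) (use close[OF r'(2)] less_imp_le in blast)
    then show ?thesis using r'(1) by (simp add: of_rat_less order_le_less_trans)
  qed
  moreover have "rel b n m r" if "norm (x - d m) < of_rat r" for m r
  proof -
    have "(\<lambda>k. of_rat (q k) + norm (d (a k) - d m)) \<longlonglongrightarrow> 0 + norm (x - d m)" by (intro tendsto_add q_lim lim)
    then have "eventually (\<lambda>k. of_rat (q k) + norm (d (a k) - d m) < of_rat r) sequentially"
      using that by (intro order_tendstoD(2)) auto
    then obtain k where "of_rat (q k) + norm (d (a k) - d m) < of_rat r"
      using eventually_happens'[OF sequentially_bot] by blast
    then show ?thesis using b(4)[OF a, of k m r] by simp
  qed
  ultimately show ?thesis by blast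
qed

lemma codes_ex_op: assumes "b \<in> codes" shows "\<exists>T. op_code T = b"
proof -
  obtain y where y: "\<And>n m q. rel b n m q \<longleftrightarrow> norm (y n - d m) < of_rat q"
    using codes_ex_point[OF assms] by metis
  note c = assms[unfolded codes_def mem_Collect_eq]
  note c5 = c[THEN conjunct2, THEN conjunct2, THEN conjunct2, THEN conjunct2, THEN conjunct2]
  note b01 = c[THEN conjunct1, rule_format] and b6 = c5[THEN conjunct2]
    and b5 = c5[THEN conjunct1, rule_format, OF conjI]
  have diff: "y k = y i - y j" if k: "d k = d i - d j" for i j k
  proof -
    have "norm (y k - (y i - y j)) \<le> 0"
    proof (rule real_le_rat)
      fix p :: rat assume "0 < (of_rat p :: real)"
      \<comment> \<open>Three errors below \<open>p / 6\<close> and one below three times as much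
        add up to \<open>p\<close>.\<close>
      then have "p / 6 > 0" by simp
      then obtain m m' m'' where m: "norm (y i - d m) < of_rat (p / 6)" "norm (y j - d m') < of_rat (p / 6)"
        "norm (y k - d m'') < of_rat (p / 6)" "norm (d m'' - (d m - d m')) < 3 * of_rat (p / 6)"
        using b5[OF k] unfolding y by meson
      have "y k - (y i - y j) = (y k - d m'') + (d m'' - (d m - d m')) - (y i - d m) + (y j - d m')" by simp
      then have "norm (y k - (y i - y j)) \<le>
          norm ((y k - d m'') + (d m'' - (d m - d m')) - (y i - d m)) + norm (y j - d m')"
        by (simp only: norm_triangle_ineq)
      also have "\<dots> \<le> norm (y k - d m'') + norm (d m'' - (d m - d m')) + norm (y i - d m) + norm (y j - d m')"
        by (intro add_right_mono order_trans[OF norm_triangle_ineq4] norm_triangle_ineq)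
      finally have "norm (y k - (y i - y j)) \<le> norm (y k - d m'') + norm (d m'' - (d m - d m'))
          + norm (y i - d m) + norm (y j - d m')" .
      moreover have "(of_rat (p / 6) :: real) = of_rat p / 6" by (simp add: of_rat_divide)
      ultimately show "norm (y k - (y i - y j)) < of_rat p" using m by simp
    qed
    then show ?thesis by simp
  qed
  obtain M :: nat where M: "\<And>i m q. d m = 0 \<Longrightarrow> real M * norm (d i) < of_rat q \<Longrightarrow> rel b i m q"
    using b6 by blast
  obtain m0 where "d m0 = 0" using ex_zero by blast
  then have "norm (y i) \<le> real M * norm (d i)" for i
    using M[OF \<open>d m0 = 0\<close>] unfolding y by (intro real_le_rat) simp
  then obtain T :: "'a \<Rightarrow>\<^sub>L 'a" where T: "\<And>i. T (d i) = y i"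
    using ex_extension[of y "real M"] diff by auto
  have "op_code T i = b i" for i
  proof -
    obtain n m and q :: rat where i: "from_nat i = (n :: nat, m :: nat, q)"
      by (cases "from_nat i :: nat \<times> nat \<times> rat") auto
    \<comment> \<open>The index \<open>i\<close> need not be the canonical code of
      \<open>from_nat i\<close>; the first clause of \<open>codes\<close> makes \<open>b\<close>
      take the same value at both.\<close>
    show ?thesis using y[of n m q] b01[of i] by (auto simp: i op_code_def T rel_def)
  qed
  then have "op_code T = b" by blast
  then show ?thesis by blast
qed

lemma inj_op_code: assumes "op_code S = op_code T" shows "S = T"
proof (rule blinfun_eqI_dense)
  fix n
  have iff: "near S n m q \<longleftrightarrow> near T n m q" for m q
    using assms rel_op_code by metis
  have "norm (S (d n) - T (d n)) \<le> 0"
  proof (rule real_le_rat)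
    fix q :: rat assume "0 < (of_rat q :: real)"
    then obtain m where m: "near S n m (q / 2)"
      using ex_near[of "of_rat (q / 2)"] by (auto simp: of_rat_divide)
    moreover have "near T n m (q / 2)" using m iff by blast
    ultimately show "norm (S (d n) - T (d n)) < of_rat q"
      using norm_triangle_ineq4[of "S (d n) - d m" "T (d n) - d m"] by (simp add: of_rat_divide)
  qed
  then show "S (d n) = T (d n)" by simp
qed

end

section \<open>Measurability of operator codes for the strong operator topology\<close>

definition sop :: "('a::real_normed_vector \<Rightarrow>\<^sub>L 'a) measure" where "sop = borel_of strong_operator_topology"

lemma space_sop: "space sop = UNIV"
  by (simp add: sop_def space_borel_of strong_operator_topology_topspace)

context dense_sequence
begin

lemma sets_sop_openin: "openin strong_operator_topology U \<Longrightarrow> U \<in> sets sop"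
  unfolding sop_def sets_borel_of by (intro sigma_sets.Basic) simp

lemma sets_sop_basic: "{T. near T n m q} \<in> sets sop"
proof -
  have "openin strong_operator_topology {T. \<forall>u\<in>{()}. blinfun_apply T (d n) \<in> ball (d m) (of_rat q)}"
    by (rule strong_operator_topology_basis) auto
  then show ?thesis by (intro sets_sop_openin) (simp add: dist_norm norm_minus_commute)
qed

lemma measurable_op_code: "op_code \<in> sop \<rightarrow>\<^sub>M borel"
proof (rule measurable_coordinatewise_then_product)
  fix i
  obtain n m :: nat and q :: rat where i: "from_nat i = (n, m, q)" by (metis prod_cases3)
  have "{T. near T n m q} \<in> sets sop" by (rule sets_sop_basic)
  then have "(\<lambda>T. if near T n m q then 1 else 0 :: nat) \<in> sop \<rightarrow>\<^sub>M borel"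
    by (intro measurable_If) (auto simp: space_sop)
  then show "(\<lambda>T. op_code T i) \<in> sop \<rightarrow>\<^sub>M borel" by (simp add: op_code_def i)
qed

lemma sets_vimage_op_code_basic:
  "{T. near T n m q} \<in> sets (vimage_algebra UNIV op_code borel)"
proof -
  have "{b :: nat \<Rightarrow> nat. b (to_nat (n, m, q)) = 1} = (\<lambda>b. b (to_nat (n, m, q))) -` {1} \<inter> space borel"
    by auto
  also have "\<dots> \<in> sets borel"
    by (rule measurable_sets[OF measurable_product_coordinates]) simp
  finally have "op_code -` {b. b (to_nat (n, m, q)) = 1} \<inter> UNIV \<in> sets (vimage_algebra UNIV op_code borel)"
    by (rule in_vimage_algebra)
  moreover have "op_code -` {b. b (to_nat (n, m, q)) = 1} \<inter> UNIV = {T. near T n m q}"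
    using rel_op_code by (auto simp: rel_def)
  ultimately show ?thesis by simp
qed

lemma sets_vimage_op_code_ball: "{T :: 'a \<Rightarrow>\<^sub>L 'a. norm T \<le> real M} \<in> sets (vimage_algebra UNIV op_code borel)"
proof -
  let ?V = "vimage_algebra UNIV op_code borel"
  obtain k where k: "d k = 0" using ex_zero by blast
  have "{T :: 'a \<Rightarrow>\<^sub>L 'a. norm T \<le> real M} =
      (\<Inter>p\<in>{(n, q). real M * norm (d n) < of_rat q}. {T. norm (blinfun_apply T (d (fst p)) - d k) < of_rat (snd p)})"
    by (auto simp: norm_blinfun_le_iff[OF k])
  also have "\<dots> \<in> sets ?V"
  proof (rule sets.countable_INT')
    have "real M * norm (d 0) < of_rat (of_nat (nat \<lceil>real M * norm (d 0)\<rceil> + 1))"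
      by (simp add: of_rat_add) linarith
    then show "{(n, q). real M * norm (d n) < of_rat q} \<noteq> {}" by blast
  qed (use sets_vimage_op_code_basic in auto)
  finally show ?thesis .
qed

text \<open>A norm ball of operators is equicontinuous, so evaluation at \<open>x\<close> may be
  replaced by evaluation at a near \<open>d n\<close>. Of the four errors, two come from moving to
  \<open>d n\<close> and two from the distance to \<open>d m\<close>; each is at most
  \<open>e / 4\<close>.\<close>

lemma ex_basic_subset:
  fixes T :: "'a \<Rightarrow>\<^sub>L 'a"
  assumes "norm T \<le> real M" "open V" "T x \<in> V"
  shows "\<exists>p :: nat \<times> nat \<times> rat. case p of (n, m, q) \<Rightarrow> near T n m q \<and>
    (\<forall>S :: 'a \<Rightarrow>\<^sub>L 'a. norm S \<le> real M \<longrightarrow> near S n m q \<longrightarrow> blinfun_apply S x \<in> V)"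
proof -
  obtain e where e: "e > 0" "ball (T x) e \<subseteq> V" using assms(2,3) open_contains_ball by blast
  obtain q :: rat where "0 < (of_rat q :: real)" "of_rat q < e / 4"
    using of_rat_dense[of 0 "e / 4"] e(1) by auto
  then have q: "(of_rat q :: real) > 0" "of_rat q < e / 4" by auto
  obtain n where n: "norm (x - d n) < e / (4 * (real M + 1))"
    using ex_near[of "e / (4 * (real M + 1))" x] e(1) by auto
  obtain m where m: "near T n m q" using ex_near[OF q(1)] by blast
  have small: "norm (R (x - d n)) \<le> e / 4" if "norm R \<le> real M" for R :: "'a \<Rightarrow>\<^sub>L 'a"
  proof -
    have "norm (R (x - d n)) \<le> norm R * norm (x - d n)" by (rule norm_blinfun)
    also have "\<dots> \<le> (real M + 1) * (e / (4 * (real M + 1)))" using that n by (intro mult_mono) auto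
    also have "\<dots> = e / 4" by (simp add: field_simps)
    finally show ?thesis .
  qed
  have "S x \<in> V" if "norm S \<le> real M" "near S n m q" for S :: "'a \<Rightarrow>\<^sub>L 'a"
  proof -
    have "T x - S x = T (x - d n) - S (x - d n) + ((T (d n) - d m) - (S (d n) - d m))"
      by (simp add: blinfun.diff_right)
    then have "norm (T x - S x) \<le> norm (T (x - d n) - S (x - d n)) + norm ((T (d n) - d m) - (S (d n) - d m))"
      by (simp only: norm_triangle_ineq)
    also have "\<dots> \<le> (norm (T (x - d n)) + norm (S (x - d n))) + (norm (T (d n) - d m) + norm (blinfun_apply S (d n) - d m))"
      by (intro add_mono norm_triangle_ineq4)
    also have "\<dots> < e" using small[OF assms(1)] small[OF that(1)] m that(2) q(2) by linarith
    finally show ?thesis using e(2) by (auto simp: dist_norm)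
  qed
  then show ?thesis using m by (intro exI[of _ "(n, m, q)"]) auto
qed

text \<open>A basic open set of the product topology restricts finitely many evaluations, and
  \<open>ex_basic_subset\<close> supplies one coded condition for each.\<close>

lemma openin_sop_bounded_basis:
  fixes T :: "'a \<Rightarrow>\<^sub>L 'a"
  assumes "openin strong_operator_topology U" "T \<in> U" "norm T \<le> real M"
  obtains l :: "(nat \<times> nat \<times> rat) list" where
    "\<forall>(n, m, q)\<in>set l. near T n m q"
    "\<forall>S. norm S \<le> real M \<longrightarrow> (\<forall>(n, m, q)\<in>set l. near S n m q) \<longrightarrow> S \<in> U"
proof -
  obtain V where V: "openin euclidean V" "U = blinfun_apply -` V \<inter> UNIV"
    using assms(1) unfolding strong_operator_topology_def openin_pullback_topology by blast
  have "openin (product_topology (\<lambda>_ :: 'a. euclidean :: 'a topology) UNIV) V"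
    using V(1) by (simp add: euclidean_product_topology)
  moreover have "blinfun_apply T \<in> V" using assms(2) V(2) by blast
  ultimately obtain X where X: "blinfun_apply T \<in> Pi\<^sub>E UNIV X" "\<And>i. open (X i)"
    "finite {i. X i \<noteq> UNIV}" "Pi\<^sub>E UNIV X \<subseteq> V"
    using product_topology_open_contains_basis[of "\<lambda>_. euclidean" UNIV V "blinfun_apply T"] by auto
  have "\<forall>x. \<exists>p :: nat \<times> nat \<times> rat. case p of (n, m, q) \<Rightarrow> near T n m q \<and>
    (\<forall>S :: 'a \<Rightarrow>\<^sub>L 'a. norm S \<le> real M \<longrightarrow> near S n m q \<longrightarrow> blinfun_apply S x \<in> X x)"
    using ex_basic_subset[OF assms(3) X(2)] X(1) by blast
  from choice[OF this] obtain h :: "'a \<Rightarrow> nat \<times> nat \<times> rat" where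
    h: "\<And>x. case h x of (n, m, q) \<Rightarrow> near T n m q \<and>
    (\<forall>S :: 'a \<Rightarrow>\<^sub>L 'a. norm S \<le> real M \<longrightarrow> near S n m q \<longrightarrow> blinfun_apply S x \<in> X x)"
    by blast
  obtain l0 where l0: "set l0 = {i. X i \<noteq> UNIV}" using finite_list[OF X(3)] by blast
  show ?thesis
  proof (rule that[of "map h l0"])
    show "\<forall>(n, m, q)\<in>set (map h l0). near T n m q"
    proof
      fix p assume "p \<in> set (map h l0)"
      then obtain x where "p = h x" by auto
      then show "case p of (n, m, q) \<Rightarrow> near T n m q"
        using h[of x] by (auto split: prod.splits)
    qed
    show "\<forall>S. norm S \<le> real M \<longrightarrow>
        (\<forall>(n, m, q)\<in>set (map h l0). near S n m q) \<longrightarrow> S \<in> U"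
    proof (intro allI impI)
      fix S :: "'a \<Rightarrow>\<^sub>L 'a"
      assume S: "norm S \<le> real M" "\<forall>(n, m, q)\<in>set (map h l0). near S n m q"
      have "S x \<in> X x" for x
      proof (cases "X x = UNIV")
        case False
        then have "h x \<in> set (map h l0)" using l0 by auto
        then show ?thesis using S h[of x] by (auto split: prod.splits)
      qed simp
      then show "S \<in> U" using X(4) V(2) by auto
    qed
  qed
qed

text \<open>
  The space need not be second countable, but countably many closed balls cover it, and each of
  them has a countable base.
\<close>

lemma sets_vimage_op_code_openin:
  assumes "openin strong_operator_topology U"
  shows "U \<in> sets (vimage_algebra UNIV op_code borel)"
proof -
  let ?V = "vimage_algebra UNIV op_code borel"
  define W where "W p = {T :: 'a \<Rightarrow>\<^sub>L 'a. norm T \<le> real (fst p)} \<inter>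
      (\<Inter>t\<in>set (snd p). {T. case t of (n, m, q) \<Rightarrow> near T n m q})"
    for p :: "nat \<times> (nat \<times> nat \<times> rat) list"
  have "W p \<in> sets ?V" for p
  proof (cases "snd p = []")
    case True then show ?thesis using sets_vimage_op_code_ball by (simp add: W_def)
  next
    case False
    then show ?thesis
      using sets_vimage_op_code_ball sets_vimage_op_code_basic unfolding W_def
      by (intro sets.Int sets.finite_INT) (auto split: prod.splits)
  qed
  then have "(\<Union>p\<in>{p. W p \<subseteq> U}. W p) \<in> sets ?V"
    by (intro sets.countable_UN') auto
  moreover have "U = (\<Union>p\<in>{p. W p \<subseteq> U}. W p)"
  proof (intro subset_antisym subsetI)
    fix T assume T: "T \<in> U"
    obtain M :: nat where M: "norm T \<le> real M" using real_arch_simple by blast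
    obtain l :: "(nat \<times> nat \<times> rat) list" where
      "\<forall>(n, m, q)\<in>set l. near T n m q"
      "\<forall>S. norm S \<le> real M \<longrightarrow> (\<forall>(n, m, q)\<in>set l. near S n m q) \<longrightarrow> S \<in> U"
      by (rule openin_sop_bounded_basis[OF assms T M])
    then have "T \<in> W (M, l)" "W (M, l) \<subseteq> U" using M by (auto simp: W_def)
    then show "T \<in> (\<Union>p\<in>{p. W p \<subseteq> U}. W p)" by blast
  qed auto
  ultimately show ?thesis by simp
qed

text \<open>The inverse of \<open>op_code\<close> is measurable because every open set is the
  preimage of a Borel set under \<open>op_code\<close>, and the set of codes is Borel.\<close>

lemma standard_sop: "standard (sop :: ('a \<Rightarrow>\<^sub>L 'a) measure)"
proof -
  define \<psi> where "\<psi> b = (SOME T. op_code T = b)" for b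
  have 1: "\<psi> (op_code T) = T" for T
    unfolding \<psi>_def using inj_op_code by blast
  have 2: "op_code (\<psi> b) = b" if "b \<in> codes" for b
    unfolding \<psi>_def using codes_ex_op[OF that] by (rule someI_ex)
  have "op_code \<in> sop \<rightarrow>\<^sub>M restrict_space borel codes"
    by (intro measurable_restrict_space2 measurable_op_code) (use op_code_in_codes in auto)
  moreover have "\<psi> \<in> restrict_space borel codes \<rightarrow>\<^sub>M sop"
    unfolding sop_def borel_of_def
  proof (rule measurable_measure_of)
    fix U :: "('a \<Rightarrow>\<^sub>L 'a) set" assume "U \<in> {U. openin strong_operator_topology U}"
    then have "U \<in> sets (vimage_algebra UNIV op_code borel)"
      using sets_vimage_op_code_openin by blast
    then obtain V where V: "V \<in> sets borel" "U = op_code -` V \<inter> UNIV"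
      by (auto simp: sets_vimage_algebra2)
    have "\<psi> -` U \<inter> space (restrict_space borel codes) = V \<inter> codes"
      using V(2) 2 by (auto simp: space_restrict_space)
    also have "\<dots> \<in> sets (restrict_space borel codes)"
      using V(1) sets_codes by (simp add: sets_restrict_space_iff)
    finally show "\<psi> -` U \<inter> space (restrict_space borel codes) \<in> sets (restrict_space borel codes)" .
  qed (auto simp: strong_operator_topology_topspace)
  ultimately have "borel_code sop codes op_code \<psi>"
    using sets_codes 1 2 by (simp add: borel_code_def)
  then show ?thesis unfolding standard_def by blast
qed

text \<open>Balls around the \<open>d m\<close> with rational radii form a countable base of the
  norm topology.\<close>

lemma borel_measurable_iff_balls:
  "f \<in> borel_measurable N \<longleftrightarrow> (\<forall>m (q :: rat). {w \<in> space N. norm (f w - d m) < of_rat q} \<in> sets N)"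
proof (intro iffI allI)
  fix m and q :: rat
  assume "f \<in> borel_measurable N"
  then have "f -` ball (d m) (of_rat q) \<inter> space N \<in> sets N" by (rule measurable_sets) simp
  then show "{w \<in> space N. norm (f w - d m) < of_rat q} \<in> sets N"
    by (simp add: vimage_def Int_def dist_norm norm_minus_commute conj_commute)
next
  assume *: "\<forall>m (q :: rat). {w \<in> space N. norm (f w - d m) < of_rat q} \<in> sets N"
  show "f \<in> borel_measurable N"
  proof (rule borel_measurableI)
    fix U :: "'a set" assume "open U"
    let ?P = "{p :: nat \<times> rat. ball (d (fst p)) (of_rat (snd p)) \<subseteq> U}"
    have "f -` U \<inter> space N = (\<Union>p\<in>?P. {w \<in> space N. norm (f w - d (fst p)) < of_rat (snd p)})" (is "_ = ?U")
    proof (intro subset_antisym subsetI)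
      fix w assume w: "w \<in> f -` U \<inter> space N"
      then obtain e where e: "e > 0" "ball (f w) e \<subseteq> U" using \<open>open U\<close> open_contains_ball by blast
      obtain q :: rat where q: "0 < (of_rat q :: real)" "of_rat q < e / 2"
        using of_rat_dense[of 0 "e / 2"] e(1) by auto
      obtain m where m: "norm (f w - d m) < of_rat q" using ex_near[OF q(1)] by blast
      have "ball (d m) (of_rat q) \<subseteq> U"
      proof
        fix x assume "x \<in> ball (d m) (of_rat q)"
        then have "dist (f w) x < e"
          using m q(2) dist_triangle[of "f w" x "d m"] by (simp add: dist_norm)
        then show "x \<in> U" using e(2) by auto
      qed
      then show "w \<in> ?U"
        using w m by (intro UN_I[of "(m, q)"]) auto
    next
      fix w assume "w \<in> ?U"
      then show "w \<in> f -` U \<inter> space N" by (force simp: dist_norm norm_minus_commute)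
    qed
    also have "\<dots> \<in> sets N" using * by (intro sets.countable_UN') auto
    finally show "f -` U \<inter> space N \<in> sets N" .
  qed
qed

lemma borel_measurable_add_dense:
  fixes f g :: "'w \<Rightarrow> 'a"
  assumes "f \<in> borel_measurable N" "g \<in> borel_measurable N"
  shows "(\<lambda>w. f w + g w) \<in> borel_measurable N"
  unfolding borel_measurable_iff_balls
proof (intro allI)
  fix k and q :: rat
  let ?P = "{(a, b, r, s). norm (d a + d b - d k) + of_rat r + of_rat s \<le> (of_rat q :: real)}"
  let ?W = "\<lambda>(a, b, r, s). {w \<in> space N. norm (f w - d a) < of_rat r} \<inter> {w \<in> space N. norm (g w - d b) < of_rat s}"
  have "{w \<in> space N. norm (f w + g w - d k) < of_rat q} = (\<Union>p\<in>?P. ?W p)" (is "_ = ?U")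
  proof (intro subset_antisym subsetI)
    fix w assume "w \<in> {w \<in> space N. norm (f w + g w - d k) < of_rat q}"
    then have w: "w \<in> space N" "norm (f w + g w - d k) < of_rat q" by auto
    \<comment> \<open>A quarter of the slack: replacing \<open>f w\<close> and \<open>g w\<close> by
      dense points costs two errors, and the two radii, both equal to \<open>r\<close>, take two
      more.\<close>
    then obtain r :: rat where r: "0 < (of_rat r :: real)" "of_rat r < (of_rat q - norm (f w + g w - d k)) / 4"
      using of_rat_dense[of 0 "(of_rat q - norm (f w + g w - d k)) / 4"] by auto
    obtain a b where ab: "norm (f w - d a) < of_rat r" "norm (g w - d b) < of_rat r"
      using ex_near[OF r(1)] by meson
    have "d a + d b - d k = (f w + g w - d k) - (f w - d a) - (g w - d b)" by simp
    then have "norm (d a + d b - d k) \<le> norm ((f w + g w - d k) - (f w - d a)) + norm (g w - d b)"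
      by (simp only: norm_triangle_ineq4)
    also have "\<dots> \<le> norm (f w + g w - d k) + norm (f w - d a) + norm (g w - d b)"
      by (intro add_right_mono norm_triangle_ineq4)
    finally have "(a, b, r, r) \<in> ?P" using ab r(2) by (simp add: field_simps)
    moreover have "w \<in> ?W (a, b, r, r)" using w ab by simp
    ultimately show "w \<in> ?U" by blast
  next
    fix w assume "w \<in> ?U"
    then obtain a b r s where *: "norm (d a + d b - d k) + of_rat r + of_rat s \<le> (of_rat q :: real)"
      "w \<in> space N" "norm (f w - d a) < of_rat r" "norm (g w - d b) < of_rat s" by auto
    have "f w + g w - d k = (f w - d a) + (g w - d b) + (d a + d b - d k)" by simp
    then have "norm (f w + g w - d k) \<le> norm ((f w - d a) + (g w - d b)) + norm (d a + d b - d k)"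
      by (simp only: norm_triangle_ineq)
    also have "\<dots> \<le> norm (f w - d a) + norm (g w - d b) + norm (d a + d b - d k)"
      by (intro add_right_mono norm_triangle_ineq)
    finally show "w \<in> {w \<in> space N. norm (f w + g w - d k) < of_rat q}" using * by simp
  qed
  also have "\<dots> \<in> sets N"
    using assms unfolding borel_measurable_iff_balls by (intro sets.countable_UN') (auto intro!: sets.Int)
  finally show "{w \<in> space N. norm (f w + g w - d k) < of_rat q} \<in> sets N" .
qed

lemma sets_sop_ball: "{T :: 'a \<Rightarrow>\<^sub>L 'a. norm T \<le> real M} \<in> sets sop"
proof -
  obtain V where "V \<in> sets borel" "{T :: 'a \<Rightarrow>\<^sub>L 'a. norm T \<le> real M} = op_code -` V \<inter> UNIV"
    using sets_vimage_op_code_ball[of M] by (auto simp: sets_vimage_algebra2)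
  then show ?thesis using measurable_sets[OF measurable_op_code] by (simp add: space_sop)
qed

text \<open>On operators of norm at most \<open>M\<close>, replacing \<open>f T\<close> by a dense
  point costs at most \<open>real M * of_rat r\<close>, so the condition is a countable union over
  norm bounds, dense points and radii.\<close>

lemma borel_measurable_apply_dense:
  fixes f :: "('a \<Rightarrow>\<^sub>L 'a) \<Rightarrow> 'a"
  assumes "f \<in> borel_measurable sop"
  shows "(\<lambda>T. blinfun_apply T (f T)) \<in> borel_measurable sop"
  unfolding borel_measurable_iff_balls
proof (intro allI)
  fix k and q :: rat
  let ?P = "{(M, n, r, s). real M * of_rat r + of_rat s \<le> (of_rat q :: real)}"
  let ?W = "\<lambda>(M, n, r, s). {T \<in> space sop. norm T \<le> real M} \<inter> {T \<in> space sop. norm (f T - d n) < of_rat r}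
      \<inter> {T \<in> space sop. near T n k s}"
  have eq: "T (f T) - d k = T (f T - d n) + (T (d n) - d k)" for T :: "'a \<Rightarrow>\<^sub>L 'a" and n
    by (simp add: blinfun.diff_right)
  have small: "norm (T (f T - d n)) \<le> real M * of_rat r" if "norm T \<le> real M" "norm (f T - d n) < of_rat r"
    for T :: "'a \<Rightarrow>\<^sub>L 'a" and M n r
    by (rule order_trans[OF norm_blinfun]) (use that in \<open>intro mult_mono; simp\<close>)
  have "{T \<in> space sop. norm (blinfun_apply T (f T) - d k) < of_rat q} = (\<Union>p\<in>?P. ?W p)" (is "_ = ?U")
  proof (intro subset_antisym subsetI)
    fix T assume "T \<in> {T \<in> space sop. norm (blinfun_apply T (f T) - d k) < of_rat q}"
    then have T: "norm (T (f T) - d k) < of_rat q" by auto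
    obtain M :: nat where M: "norm T \<le> real M" using real_arch_simple by blast
    define g where "g = of_rat q - norm (T (f T) - d k)"
    have "g > 0" using T by (simp add: g_def)
    \<comment> \<open>The slack \<open>g\<close> has to pay \<open>real M * of_rat r\<close> twice,
      once for passing to \<open>d n\<close> and once for the reserve in \<open>?P\<close>; the
      added 2 covers \<open>M = 0\<close>.\<close>
    then obtain r :: rat where r: "0 < (of_rat r :: real)" "of_rat r < g / (2 * real M + 2)"
      using of_rat_dense[of 0 "g / (2 * real M + 2)"] by auto
    have "of_rat r * (2 * real M + 2) < g"
      using r(2) by (simp add: less_divide_eq)
    moreover have "of_rat r * (2 * real M + 2) = 2 * (real M * of_rat r) + 2 * of_rat r"
      by (simp add: algebra_simps)
    ultimately have Mr: "2 * (real M * of_rat r) < g" using r(1) by linarith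
    obtain n where n: "norm (f T - d n) < of_rat r" using ex_near[OF r(1)] by blast
    have "norm (T (d n) - d k) \<le> norm (T (f T) - d k) + norm (T (f T - d n))"
      using norm_triangle_ineq4[of "T (f T) - d k" "T (f T - d n)"] by (simp add: eq[of T n])
    also have "\<dots> < of_rat q - real M * of_rat r"
      using small[OF M n] Mr by (simp add: g_def)
    finally obtain s :: rat where s: "near T n k s" "of_rat s < of_rat q - real M * of_rat r"
      using of_rat_dense by blast
    have "(M, n, r, s) \<in> ?P" using s(2) by simp
    moreover have "T \<in> ?W (M, n, r, s)" using M n s(1) by (simp add: space_sop)
    ultimately show "T \<in> ?U" by blast
  next
    fix T assume "T \<in> ?U"
    then obtain M n r s where *: "real M * of_rat r + of_rat s \<le> (of_rat q :: real)" "norm T \<le> real M"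
      "norm (f T - d n) < of_rat r" "near T n k s" by auto
    have "norm (T (f T) - d k) \<le> norm (T (f T - d n)) + norm (T (d n) - d k)"
      unfolding eq[of T n] by (rule norm_triangle_ineq)
    then show "T \<in> {T \<in> space sop. norm (blinfun_apply T (f T) - d k) < of_rat q}"
      using small[OF *(2,3)] * by (simp add: space_sop)
  qed
  also have "\<dots> \<in> sets sop"
    using assms sets_sop_ball sets_sop_basic
    unfolding borel_measurable_iff_balls by (intro sets.countable_UN') (auto intro!: sets.Int simp: space_sop)
  finally show "{T \<in> space sop. norm (blinfun_apply T (f T) - d k) < of_rat q} \<in> sets sop" .
qed

end

section \<open>The ergodicity index\<close>

abbreviation harmonic_tree :: "('a::banach \<Rightarrow>\<^sub>L 'a) \<Rightarrow> nat \<Rightarrow> nat list set" where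
  "harmonic_tree T n \<equiv> ergodic_tree T (1 / real (Suc n))"

lemma closedin_ops:
  fixes smul :: "'k::real_normed_field \<Rightarrow> 'a::banach \<Rightarrow> 'a"
  assumes "banach_over smul"
  shows "closedin strong_operator_topology (ops smul)"
proof -
  let ?S = "\<lambda>c x. {T \<in> topspace strong_operator_topology. blinfun_apply T (smul c x) = smul c (blinfun_apply T x)}"
  have "closedin strong_operator_topology (?S c x)" for c x
  proof (rule closedin_continuous_maps_eq)
    show "Hausdorff_space (euclidean :: 'a topology)" by (rule Hausdorff_space_euclidean)
    show "continuous_map strong_operator_topology euclidean (\<lambda>T. blinfun_apply T (smul c x))"
      by (rule strong_operator_topology_continuous_evaluation)
    have "continuous_map euclidean euclidean (smul c)"
      using linear_continuous_on[OF banach_over_bounded_linear[OF assms]] by simp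
    then show "continuous_map strong_operator_topology euclidean (\<lambda>T. smul c (blinfun_apply T x))"
      by (rule continuous_map_compose[OF strong_operator_topology_continuous_evaluation, unfolded comp_def])
  qed
  then have "closedin strong_operator_topology (\<Inter>p. ?S (fst p) (snd p))"
    by (intro closedin_INT) auto
  moreover have "(\<Inter>p. ?S (fst p) (snd p)) = ops smul"
    by (auto simp: ops_def strong_operator_topology_topspace)
  ultimately show ?thesis by simp
qed

lemma sets_ops: assumes "banach_over smul" shows "ops smul \<in> sets sop"
proof -
  have "UNIV - ops smul \<in> sets sop"
    using closedin_ops[OF assms] unfolding sop_def sets_borel_of
    by (intro sigma_sets.Basic) (simp add: closedin_def strong_operator_topology_topspace)
  from sets.compl_sets[OF this] show ?thesis by (simp add: space_sop double_diff)
qed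

lemma sets_sop_borel:
  assumes "banach_over smul"
  shows "sets (sop_borel smul) = sets (restrict_space sop (ops smul))"
proof -
  have ops: "ops smul \<in> sigma_sets UNIV {U. openin strong_operator_topology U}"
    using sets_ops[OF assms] by (simp add: sop_def sets_borel_of strong_operator_topology_topspace)
  have "sets (restrict_space sop (ops smul)) =
      (\<inter>) (ops smul) ` sigma_sets UNIV {U. openin strong_operator_topology U}"
    by (simp add: sets_restrict_space sop_def sets_borel_of strong_operator_topology_topspace)
  also have "\<dots> = sigma_sets (ops smul) ((\<inter>) (ops smul) ` {U. openin strong_operator_topology U})"
    by (rule sigma_sets_Int[OF ops]) simp
  also have "(\<inter>) (ops smul) ` {U. openin strong_operator_topology U} =
      {U. openin (subtopology strong_operator_topology (ops smul)) U}"
    by (auto simp: openin_subtopology)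
  finally show ?thesis
    by (simp add: sop_borel_def sets_borel_of topspace_subtopology strong_operator_topology_topspace)
qed

lemma space_sop_borel: "space (sop_borel smul) = ops smul"
  by (simp add: sop_borel_def space_borel_of topspace_subtopology strong_operator_topology_topspace)

context dense_sequence
begin

text \<open>Induction on the power: each step applies \<open>T\<close> to a vector that is already a
  Borel function of \<open>T\<close>.\<close>

lemma borel_measurable_cesaro:
  fixes x :: 'a
  shows "(\<lambda>T. blinfun_apply (cesaro T n) x) \<in> borel_measurable sop"
proof -
  have pow: "(\<lambda>T. (blinfun_apply T ^^ k) x) \<in> borel_measurable sop" for k
    by (induction k) (auto intro: borel_measurable_apply_dense)
  have "(\<lambda>T. \<Sum>k<n. (blinfun_apply T ^^ k) x) \<in> borel_measurable sop"
    by (induction n) (auto intro: borel_measurable_add_dense pow)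
  then show ?thesis
    unfolding cesaro_apply
    by (rule measurable_compose) (intro borel_measurable_continuous_onI continuous_intros)
qed

lemma sets_cesaro_gap:
  fixes x :: 'a
  shows "{T. norm (blinfun_apply (cesaro T m) x - blinfun_apply (cesaro T n) x) > \<epsilon>} \<in> sets sop"
proof -
  have "(\<lambda>T. - blinfun_apply (cesaro T n) x) \<in> borel_measurable sop"
    by (rule measurable_compose[OF borel_measurable_cesaro])
      (intro borel_measurable_continuous_onI continuous_intros)
  from borel_measurable_add_dense[OF borel_measurable_cesaro this]
  have "(\<lambda>T. norm (blinfun_apply (cesaro T m) x + - blinfun_apply (cesaro T n) x)) \<in> borel_measurable sop"
    by (rule measurable_compose) (intro borel_measurable_continuous_onI continuous_intros)
  from measurable_sets[OF this, of "{\<epsilon><..}"] show ?thesis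
    by (simp add: vimage_def space_sop)
qed

text \<open>The gaps of a node are finitely many strict inequalities, continuous in
  \<open>x\<close>, so a witness can be moved into the open unit ball and then to a point of the
  dense sequence; the existential becomes a countable union.\<close>

lemma sets_ergodic_tree: "{T :: 'a \<Rightarrow>\<^sub>L 'a. s \<in> ergodic_tree T \<epsilon>} \<in> sets sop"
proof (cases "sorted_wrt (<) s \<and> (\<forall>n\<in>set s. n \<ge> 1)")
  case False
  then have "{T :: 'a \<Rightarrow>\<^sub>L 'a. s \<in> ergodic_tree T \<epsilon>} = {}" by (auto simp: ergodic_tree_def)
  then show ?thesis by simp
next
  case True
  show ?thesis
  proof (cases "length s \<le> 1")
    case short: True
    then have "{T :: 'a \<Rightarrow>\<^sub>L 'a. s \<in> ergodic_tree T \<epsilon>} = space sop"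
      using True by (auto simp: ergodic_tree_def space_sop)
    then show ?thesis by (simp only: sets.top)
  next
    case long: False
    let ?G = "\<lambda>x p. {T :: 'a \<Rightarrow>\<^sub>L 'a. norm (cesaro T (s ! p) x - cesaro T (s ! Suc p) x) > \<epsilon>}"
    have "{T. s \<in> ergodic_tree T \<epsilon>} =
        (\<Union>i\<in>{i. d i \<in> cball 0 1}. \<Inter>p\<in>{p. Suc p < length s}. ?G (d i) p)" (is "_ = ?U")
    proof (intro subset_antisym subsetI)
      fix T :: "'a \<Rightarrow>\<^sub>L 'a" assume "T \<in> {T. s \<in> ergodic_tree T \<epsilon>}"
      then obtain x where x: "x \<in> cball 0 1"
        "\<And>p. Suc p < length s \<Longrightarrow> norm (cesaro T (s ! p) x - cesaro T (s ! Suc p) x) > \<epsilon>"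
        using long by (auto simp: ergodic_tree_def)
      let ?O = "\<Inter>p\<in>{p. Suc p < length s}. {v. norm (cesaro T (s ! p) v - cesaro T (s ! Suc p) v) > \<epsilon>}"
      have "finite {p. Suc p < length s}" by (rule finite_subset[of _ "{..<length s}"]) auto
      then have "open ?O"
        by (intro open_INT ballI open_Collect_less continuous_intros)
      moreover have "x \<in> ?O" using x(2) by auto
      moreover have "x \<in> closure (ball 0 1)" using x(1) by simp
      ultimately have "?O \<inter> ball 0 1 \<noteq> {}"
        using open_Int_closure_eq_empty[of ?O "ball 0 1"] by blast
      then obtain v where "v \<in> ?O \<inter> ball 0 1" by blast
      then obtain i where "d i \<in> ?O \<inter> ball 0 1"
        using ex_in_open[of "?O \<inter> ball 0 1"] \<open>open ?O\<close> by blast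
      then show "T \<in> ?U"
        by (intro UN_I[of i]) auto
    next
      fix T :: "'a \<Rightarrow>\<^sub>L 'a"
      assume "T \<in> ?U"
      then show "T \<in> {T. s \<in> ergodic_tree T \<epsilon>}"
        using True unfolding ergodic_tree_def by blast
    qed
    also have "\<dots> \<in> sets sop"
    proof (rule sets.countable_UN')
      have "Suc 0 < length s" using long by simp
      then have "{p. Suc p < length s} \<noteq> {}" by blast
      then have "(\<Inter>p\<in>{p. Suc p < length s}. ?G (d i) p) \<in> sets sop" for i
        using sets_cesaro_gap by (intro sets.countable_INT') auto
      then show "(\<lambda>i. \<Inter>p\<in>{p. Suc p < length s}. ?G (d i) p) ` {i. d i \<in> cball 0 1} \<subseteq> sets sop"
        by blast
    qed simp
    finally show ?thesis .
  qed
qed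

lemma tree_family_ergodic_tree:
  fixes smul :: "'k::real_normed_field \<Rightarrow> 'a \<Rightarrow> 'a"
  assumes "banach_over smul"
  shows "tree_family (sop_borel smul) harmonic_tree"
proof
  show "standard (sop_borel smul)"
    using standard_restrict_space[OF standard_sop sets_ops[OF assms]]
    by (simp add: standard_cong_sets[OF sets_sop_borel[OF assms]])
  fix s n
  have "{T \<in> ops smul. s \<in> harmonic_tree T n} =
      {T. s \<in> harmonic_tree T n} \<inter> ops smul" by auto
  then show "{T \<in> space (sop_borel smul). s \<in> harmonic_tree T n} \<in> sets (sop_borel smul)"
    using sets_ergodic_tree sets_ops[OF assms]
    by (simp add: space_sop_borel sets_sop_borel[OF assms] sets_restrict_space_iff space_sop)
next
  fix T n
  show "is_tree (harmonic_tree T n)" by (rule is_tree_ergodic_tree)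
  show "[] \<in> harmonic_tree T n" by (simp add: ergodic_tree_def)
qed

end

section \<open>Heights of the ergodic trees\<close>

lemma ergodic_tree_antimono:
  assumes "\<epsilon> \<le> \<epsilon>'" shows "ergodic_tree T \<epsilon>' \<subseteq> ergodic_tree T \<epsilon>"
  unfolding ergodic_tree_def using order_le_less_trans[OF assms] by blast

lemma tree_height_mono: "\<T> \<subseteq> \<S> \<Longrightarrow> is_tree \<T> \<Longrightarrow> is_tree \<S> \<Longrightarrow> tree_height \<T> \<le> tree_height \<S>"
  by (rule tree_map_height_le[of _ _ id]) (auto simp: tree_map_def)

lemma ex_inverse_Suc_le: "\<epsilon> > 0 \<Longrightarrow> \<exists>n. 1 / real (Suc n) \<le> \<epsilon>"
  using nat_approx_posE less_imp_le by metis

lemma no_branch_iff_inverse_Suc: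
  "(\<forall>\<epsilon>>0. \<not> has_branch (ergodic_tree T \<epsilon>)) \<longleftrightarrow> (\<forall>n. \<not> has_branch (harmonic_tree T n))"
proof (intro iffI allI impI)
  fix \<epsilon> :: real assume *: "\<forall>n. \<not> has_branch (harmonic_tree T n)" and "\<epsilon> > 0"
  then obtain n where "1 / real (Suc n) \<le> \<epsilon>" using ex_inverse_Suc_le by blast
  from ergodic_tree_antimono[OF this] show "\<not> has_branch (ergodic_tree T \<epsilon>)"
    using * unfolding has_branch_def by blast
qed simp

text \<open>Trees grow as the threshold decreases, and below every positive threshold there is some
  \<open>1 / real (Suc n)\<close>.\<close>

lemma SUP_height_inverse_Suc:
  "(SUP \<epsilon>\<in>{0<..}. tree_height (ergodic_tree T \<epsilon>)) = (SUP n. tree_height (harmonic_tree T n))"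
  (is "?L = ?R")
proof (rule antisym)
  show "?L \<le> ?R"
  proof (rule SUP_least)
    fix \<epsilon> :: real assume "\<epsilon> \<in> {0<..}"
    then obtain n where "1 / real (Suc n) \<le> \<epsilon>" using ex_inverse_Suc_le by auto
    then have "tree_height (ergodic_tree T \<epsilon>) \<le> tree_height (harmonic_tree T n)"
      by (intro tree_height_mono ergodic_tree_antimono is_tree_ergodic_tree)
    also have "\<dots> \<le> ?R" by (rule SUP_upper) simp
    finally show "tree_height (ergodic_tree T \<epsilon>) \<le> ?R" .
  qed
  show "?R \<le> ?L"
    by (rule SUP_least, rule SUP_upper) simp
qed

definition finite_ordinal :: "nat \<Rightarrow> ordinal" where "finite_ordinal n = (osucc ^^ n) bot"

lemma finite_ordinal_less_omega1: "finite_ordinal n < \<omega>\<^sub>1"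
proof (induction n)
  case 0
  obtain \<alpha> where "\<alpha> \<in> {..<\<omega>\<^sub>1}" using uncountable_lessThan_omega1 by (metis countable_empty ex_in_conv)
  then show ?case unfolding finite_ordinal_def using bot_least[of \<alpha>] by (simp add: order_le_less_trans)
qed (simp add: finite_ordinal_def osucc_less_omega1)

text \<open>A node surviving \<open>n\<close> derivations has \<open>n\<close> successive proper
  extensions, each at least one entry longer.\<close>

lemma derived_tree_finite:
  "s \<in> derived_tree \<T> (finite_ordinal n) \<Longrightarrow> \<exists>t\<in>\<T>. length s + n \<le> length t"
proof (induction n arbitrary: s)
  case 0 then show ?case by (auto simp: finite_ordinal_def derived_tree_0)
next
  case (Suc n)
  then obtain t where "t \<in> derived_tree \<T> (finite_ordinal n)" "strict_prefix s t"
    using derived_tree_osucc[OF finite_ordinal_less_omega1[of n], of \<T>] by (auto simp: finite_ordinal_def)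
  then show ?case using Suc.IH[of t] prefix_length_less[of s t] by force
qed

lemma tree_height_le_length:
  assumes "is_tree \<T>" "\<And>s. s \<in> \<T> \<Longrightarrow> length s < n"
  shows "tree_height \<T> \<le> finite_ordinal n"
proof -
  have "derived_tree \<T> (finite_ordinal n) = {}"
    using derived_tree_finite[of _ \<T> n] assms(2) by force
  then show ?thesis using tree_height_le_iff[OF assms(1) finite_ordinal_less_omega1] by blast
qed

lemma sorted_wrt_less_nth_ge: "sorted_wrt (<) s \<Longrightarrow> i < length s \<Longrightarrow> i \<le> s ! i" for s :: "nat list"
proof (induction i)
  case (Suc i)
  then show ?case using sorted_wrt_nth_less[of "(<)" s i "Suc i"] by simp
qed simp

text \<open>The means are Cauchy in norm from some \<open>N\<close> on, and an increasing node has
  entries at least \<open>N\<close> at positions \<open>N\<close> and \<open>Suc N\<close>, so no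
  gap above \<epsilon> fits there and nodes have length below \<open>N + 2\<close>.\<close>

lemma uniformly_ergodic_height:
  assumes "uniformly_ergodic smul T" "\<epsilon> > 0"
  obtains n where "tree_height (ergodic_tree T \<epsilon>) \<le> finite_ordinal n"
proof -
  obtain P where "cesaro T \<longlonglongrightarrow> P" using assms(1) by (auto simp: uniformly_ergodic_def)
  then have "Cauchy (cesaro T)" by (rule LIMSEQ_imp_Cauchy)
  then obtain N where N: "\<And>m n. m \<ge> N \<Longrightarrow> n \<ge> N \<Longrightarrow> norm (cesaro T m - cesaro T n) < \<epsilon>"
    using assms(2) unfolding Cauchy_iff by blast
  have "length s < N + 2" if s: "s \<in> ergodic_tree T \<epsilon>" for s
  proof (rule ccontr)
    assume "\<not> length s < N + 2"
    then have len: "Suc N < length s" by simp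
    then obtain x where x: "x \<in> cball 0 1" "norm (cesaro T (s ! N) x - cesaro T (s ! Suc N) x) > \<epsilon>"
      using s by (auto simp: ergodic_tree_def)
    have "sorted_wrt (<) s" using s by (simp add: ergodic_tree_def)
    then have ge: "N \<le> s ! N" "N \<le> s ! Suc N"
      using sorted_wrt_less_nth_ge[of s N] sorted_wrt_less_nth_ge[of s "Suc N"] len by auto
    have "norm (cesaro T (s ! N) x - cesaro T (s ! Suc N) x) \<le> norm (cesaro T (s ! N) - cesaro T (s ! Suc N)) * norm x"
      using norm_blinfun[of "cesaro T (s ! N) - cesaro T (s ! Suc N)" x] by (simp add: blinfun.diff_left)
    also have "\<dots> \<le> \<epsilon> * 1" using N[OF ge] x(1) assms(2) by (intro mult_mono) auto
    finally show False using x(2) by simp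
  qed
  then show ?thesis using that tree_height_le_length[OF is_tree_ergodic_tree] by blast
qed

theorem theorem3p4:
  fixes smul :: "'k::real_normed_field \<Rightarrow> 'a::banach \<Rightarrow> 'a"
  assumes "banach_over smul"
    and "separable_space (euclidean :: 'a topology)"
    and "\<not> (\<exists>Basis. finite_dimensional_vector_space smul Basis)"
  shows "(\<forall>T\<in>ops smul. super_ergodic smul T \<longleftrightarrow> eta_e smul T < \<omega>\<^sub>1) \<and>
    coanalytic_in (sop_borel smul) (SE smul) \<and>
    coanalytic_rank (sop_borel smul) (SE smul) (eta_e smul) \<and>
    (\<exists>\<alpha><\<omega>\<^sub>1. UE smul \<subseteq> {T \<in> SE smul. eta_e smul T \<le> \<alpha>}) \<and>
    (SE smul \<in> sets (sop_borel smul) \<longleftrightarrow> (SUP T\<in>SE smul. eta_e smul T) < \<omega>\<^sub>1)"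
proof -
  obtain d :: "nat \<Rightarrow> 'a" where "closure (range d) = UNIV" "\<And>i j. \<exists>k. d k = d i - d j"
    by (rule ex_dense_subgroup_sequence[OF assms(2) refl]) blast
  then interpret dense_sequence d by unfold_locales
  interpret tree_family "sop_borel smul" harmonic_tree
    by (rule tree_family_ergodic_tree[OF assms(1)])
  have super: "super_ergodic smul T \<longleftrightarrow> (\<forall>n. \<not> has_branch (harmonic_tree T n))"
    if "T \<in> ops smul" for T
    using super_ergodic_iff_no_branch[OF assms(1) that] no_branch_iff_inverse_Suc by blast
  have SE: "SE smul = wf_set"
    using super unfolding SE_def wf_set_def space_sop_borel by blast
  have eta: "eta_e smul T = rank T" if "T \<in> wf_set" for T
    using that SE unfolding rank_def SUP_height_inverse_Suc[symmetric] by (auto simp: eta_e_def SE_def)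
  \<comment> \<open>Off the super-ergodic operators \<open>eta_e\<close> is
    \<open>\<omega>\<^sub>1\<close> by definition; the content is that countably many countable
    heights have a countable supremum.\<close>
  have a: "super_ergodic smul T \<longleftrightarrow> eta_e smul T < \<omega>\<^sub>1" if "T \<in> ops smul" for T
  proof
    assume "super_ergodic smul T"
    then have "T \<in> wf_set" using that SE by (auto simp: SE_def)
    then show "eta_e smul T < \<omega>\<^sub>1" using eta rank_less_omega1 by simp
  qed (auto simp: eta_e_def split: if_splits)
  have c: "coanalytic_rank (sop_borel smul) wf_set (eta_e smul)"
    using coanalytic_rank_wf_set eta unfolding coanalytic_rank_def by (simp cong: conj_cong)
  \<comment> \<open>The bounds \<open>n\<close> depend on \<open>T\<close> and on the threshold, but
    their supremum, the ordinal \<omega>, serves all operators at once.\<close>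
  have UE: "T \<in> wf_set \<and> eta_e smul T \<le> (SUP n. finite_ordinal n)" if "T \<in> UE smul" for T
  proof -
    have T: "T \<in> ops smul" "uniformly_ergodic smul T" using that by (auto simp: UE_def)
    have height: "\<exists>n. tree_height (ergodic_tree T \<epsilon>) \<le> finite_ordinal n" if "\<epsilon> > 0" for \<epsilon>
      by (rule uniformly_ergodic_height[OF T(2) that]) blast
    then have "tree_height (ergodic_tree T \<epsilon>) < \<omega>\<^sub>1" if "\<epsilon> > 0" for \<epsilon>
      using that finite_ordinal_less_omega1 order_le_less_trans by blast
    then have "super_ergodic smul T"
      using super_ergodic_iff_no_branch[OF assms(1) T(1)]
        tree_height_less_omega1_iff[OF is_tree_ergodic_tree] by blast
    then have wf: "T \<in> wf_set" using T(1) SE by (auto simp: SE_def)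
    have "rank T \<le> (SUP n. finite_ordinal n)"
      unfolding rank_def using height by (intro SUP_mono) simp
    then show ?thesis using wf eta by simp
  qed
  have "(SUP n. finite_ordinal n) < \<omega>\<^sub>1"
    by (rule Sup_less_omega1) (auto simp: finite_ordinal_less_omega1)
  then have d: "\<exists>\<alpha><\<omega>\<^sub>1. UE smul \<subseteq> {T \<in> SE smul. eta_e smul T \<le> \<alpha>}"
    unfolding SE using UE by blast
  have "(SUP T\<in>wf_set. eta_e smul T) = (SUP T\<in>wf_set. rank T)"
    using eta by (intro SUP_cong) auto
  then have "SE smul \<in> sets (sop_borel smul) \<longleftrightarrow> (SUP T\<in>SE smul. eta_e smul T) < \<omega>\<^sub>1"
    unfolding SE using sets_wf_set_if_bounded bounded_if_sets_wf_set by metis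
  then show ?thesis using a c d coanalytic_wf_set unfolding SE by blast
qed

end
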